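(* Let $\sigma$ be a finite relational signature, P a numerical predicate collection and $d,k,\ell,r,w\in\mathbb{N}$. There is an algorithm $\mathfrak{L}^d_{min}$ which, with only local access to a finite $\sigma$-structure $\mathcal{B}$ of degree at most $d$, receives a training sequence $T\in(U(\mathcal{B})^k\times\{0,1\})^t$ as input, such that, with $n=|\mathcal{B}|$ and $t=|T|$: (1) $\mathfrak{L}^d_{min}$ always returns a hypothesis of the form $(\phi^*(\bar{x};\bar{y}),\bar{v}^* )$, where $\phi^*$ is a first-order formula that is a Boolean combination of sphere formulas with locality radius smaller than $(2w+1)^r$ and $\bar{v}^*\in U(\mathcal{B})^\ell$. (2) If there are an FOCN(P)-formula $\phi(\bar{x};\bar{y},\bar{\kappa})$ with $\mathrm{br}(\phi)\le r$, $\mathrm{bw}(\phi)\le w$ and parameter tuples $\bar{v}\in U(\mathcal{B})^\ell$, $\bar{\lambda}\in\{0,\dots,n\}^{|\bar{\kappa}|}$ such that $\mathrm{err}_T([\![\phi(\bar{x};\bar{v},\bar{\lambda})]\!]^{\mathcal{B}})\le\epsilon$, then the returned hypothesis satisfies $\mathrm{err}_T([\![\phi^*(\bar{x};\bar{v}^* )]\!]^{\mathcal{B}})\le\epsilon$. (3) $\mathfrak{L}^d_{min}$ runs in time $(\log n+t)^{O(1)}$ with only local access to $\mathcal{B}$. (4) The returned hypothesis can be evaluated in time $(\log n)^{O(1)}$ with only local access to $\mathcal{B}$.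
   Context: All structures are finite. For a $\sigma$-structure $\mathcal{A}$, the Gaifman graph has vertex set $U(\mathcal{A})$ and an edge between distinct elements occurring together in a tuple of some relation; the degree of $\mathcal{A}$ is its maximum degree. $N_s^{\mathcal{A}}(\bar{u})$ is the set of elements at Gaifman distance $\le s$ from some entry of $\bar{u}$; $\mathcal{N}_s^{\mathcal{A}}(\bar{u})=(\mathcal{A}[N_s^{\mathcal{A}}(\bar{u})],\bar{u})$ (centers as constants; isomorphisms respect centers). For an $s$-type $\tau$ (a structure $(\mathcal{A},a_1,\dots,a_m)$ with $U(\mathcal{A})=N_s^{\mathcal{A}}(a_1,\dots,a_m)$), a sphere formula $\mathrm{sph}_\tau(\bar{z})$ is a first-order formula with $\mathcal{B}\models\mathrm{sph}_\tau(\bar{b})$ iff $\mathcal{N}_s^{\mathcal{B}}(\bar{b})\cong\tau$; its locality radius is $s$. A numerical predicate collection P consists of names $P$ with arity $\mathrm{ar}(P)\ge1$ and semantics $[\![P]\!]\subseteq\mathbb{Z}^{\mathrm{ar}(P)}$. FOCN(P) extends first-order logic by counting terms $\#(x_1,\dots,x_s).\psi$ (number of satisfying tuples), integers, number variables, $+$, $\cdot$, atoms $P(t_1,\dots,t_{\mathrm{ar}(P)})$ on counting terms and $\exists\kappa$ for number variables ranging over $\{0,\dots,|U(\mathcal{A})|\}$; $\mathrm{br}$ is the maximal nesting depth of $\exists x,\forall x$ (structure variables) and $\#\bar{x}$; $\mathrm{bw}$ is the maximal length of $\bar{x}$ in a term $\#\bar{x}.\psi$, and if there is none, $1$ if there is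 a quantifier over a structure variable and $0$ otherwise. A training sequence is $T=((\bar{u}_1,c_1),\dots,(\bar{u}_t,c_t))$ with $\bar{u}_i\in U(\mathcal{B})^k$, $c_i\in\{0,1\}$. For $\phi(\bar{x};\bar{y},\bar{\kappa})$ ($\bar{x}$ a $k$-tuple, $\bar{y}$ an $\ell$-tuple of structure variables, $\bar{\kappa}$ number variables), $[\![\phi(\bar{x};\bar{v},\bar{\lambda})]\!]^{\mathcal{B}}:U(\mathcal{B})^k\to\{0,1\}$ maps $\bar{u}$ to $1$ iff $\mathcal{B}\models\phi(\bar{u};\bar{v},\bar{\lambda})$. The training error of $H$ is $\mathrm{err}_T(H)=\frac1{|T|}|\{i:H(\bar{u}_i)\ne c_i\}|$. $\epsilon$ is an arbitrary real number. Only local access: $\mathcal{B}$ is accessed only by queries "is $\bar{a}\in R(\mathcal{B})$?" and "list all Gaifman neighbors of $u$". *)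

theory Defs
  imports Complex_Main "HOL-Library.Log_Nat"
begin

section \<open>Structures, Gaifman graph, spheres\<close>

text \<open>A finite relational signature is the list of the arities of its relation symbols; the
  symbols are the positions in the list.\<close>

type_synonym signature = "nat list"

record 'a struct =
  univ :: "'a set"
  rels :: "nat \<Rightarrow> 'a list set"

text \<open>The empty universe is allowed here, because the sphere around an empty tuple is empty.
  Background structures are required to be nonempty where they are used.\<close>

definition is_struct :: "signature \<Rightarrow> 'a struct \<Rightarrow> bool" where
  "is_struct \<sigma> A \<longleftrightarrow> finite (univ A) \<and>
     (\<forall>i < length \<sigma>. rels A i \<subseteq> {t. length t = \<sigma> ! i \<and> set t \<subseteq> univ A}) \<and>
     (\<forall>i \<ge> length \<sigma>. rels A i = {})"

definition gaifman :: "'a struct \<Rightarrow> ('a \<times> 'a) set" where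
  "gaifman A = {(a, b). a \<noteq> b \<and> (\<exists>i. \<exists>t \<in> rels A i. a \<in> set t \<and> b \<in> set t)}"

definition nbrs :: "'a struct \<Rightarrow> 'a \<Rightarrow> 'a set" where
  "nbrs A a = {b. (a, b) \<in> gaifman A}"

definition degree :: "'a struct \<Rightarrow> nat" where
  "degree A = Max ((\<lambda>a. card (nbrs A a)) ` univ A)"

definition nbhd :: "'a struct \<Rightarrow> nat \<Rightarrow> 'a list \<Rightarrow> 'a set" where
  "nbhd A s as = {b \<in> univ A. \<exists>a \<in> set as. \<exists>m \<le> s. (a, b) \<in> gaifman A ^^ m}"

definition induced :: "'a struct \<Rightarrow> 'a set \<Rightarrow> 'a struct" where
  "induced A X = \<lparr>univ = univ A \<inter> X, rels = (\<lambda>i. {t \<in> rels A i. set t \<subseteq> X})\<rparr>"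

definition sphere :: "'a struct \<Rightarrow> nat \<Rightarrow> 'a list \<Rightarrow> 'a struct \<times> 'a list" where
  "sphere A s as = (induced A (nbhd A s as), as)"

definition iso :: "'a struct \<times> 'a list \<Rightarrow> 'b struct \<times> 'b list \<Rightarrow> bool" where
  "iso \<tau> \<rho> \<longleftrightarrow> (\<exists>f. bij_betw f (univ (fst \<tau>)) (univ (fst \<rho>)) \<and> map f (snd \<tau>) = snd \<rho> \<and>
     (\<forall>i t. set t \<subseteq> univ (fst \<tau>) \<longrightarrow> (t \<in> rels (fst \<tau>) i \<longleftrightarrow> map f t \<in> rels (fst \<rho>) i)))"

definition is_type :: "signature \<Rightarrow> nat \<Rightarrow> 'a struct \<times> 'a list \<Rightarrow> bool" where
  "is_type \<sigma> s \<tau> \<longleftrightarrow> is_struct \<sigma> (fst \<tau>) \<and> set (snd \<tau>) \<subseteq> univ (fst \<tau>) \<and>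
     univ (fst \<tau>) = nbhd (fst \<tau>) s (snd \<tau>)"


section \<open>First-order logic\<close>

text \<open>Conjunction and universal quantification are the usual derived connectives.\<close>

datatype fo =
    FEq nat nat
  | FRel nat "nat list"
  | FNeg fo
  | FDisj fo fo
  | FEx nat fo

primrec fo_wf :: "signature \<Rightarrow> fo \<Rightarrow> bool" where
  "fo_wf \<sigma> (FEq x y) = True"
| "fo_wf \<sigma> (FRel i xs) = (i < length \<sigma> \<and> length xs = \<sigma> ! i)"
| "fo_wf \<sigma> (FNeg \<phi>) = fo_wf \<sigma> \<phi>"
| "fo_wf \<sigma> (FDisj \<phi> \<psi>) = (fo_wf \<sigma> \<phi> \<and> fo_wf \<sigma> \<psi>)"
| "fo_wf \<sigma> (FEx x \<phi>) = fo_wf \<sigma> \<phi>"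

primrec fo_fv :: "fo \<Rightarrow> nat set" where
  "fo_fv (FEq x y) = {x, y}"
| "fo_fv (FRel i xs) = set xs"
| "fo_fv (FNeg \<phi>) = fo_fv \<phi>"
| "fo_fv (FDisj \<phi> \<psi>) = fo_fv \<phi> \<union> fo_fv \<psi>"
| "fo_fv (FEx x \<phi>) = fo_fv \<phi> - {x}"

primrec fo_sat :: "'a struct \<Rightarrow> fo \<Rightarrow> (nat \<Rightarrow> 'a) \<Rightarrow> bool" where
  "fo_sat A (FEq x y) \<beta> = (\<beta> x = \<beta> y)"
| "fo_sat A (FRel i xs) \<beta> = (map \<beta> xs \<in> rels A i)"
| "fo_sat A (FNeg \<phi>) \<beta> = (\<not> fo_sat A \<phi> \<beta>)"
| "fo_sat A (FDisj \<phi> \<psi>) \<beta> = (fo_sat A \<phi> \<beta> \<or> fo_sat A \<psi> \<beta>)"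
| "fo_sat A (FEx x \<phi>) \<beta> = (\<exists>a \<in> univ A. fo_sat A \<phi> (\<beta>(x := a)))"

text \<open>\<open>upds \<beta> xs as\<close> is the assignment \<open>\<beta>[as/xs]\<close>, for distinct \<open>xs\<close>.\<close>

definition upds :: "(nat \<Rightarrow> 'a) \<Rightarrow> nat list \<Rightarrow> 'a list \<Rightarrow> nat \<Rightarrow> 'a" where
  "upds \<beta> xs as = (\<lambda>x. case map_of (zip xs as) x of Some a \<Rightarrow> a | None \<Rightarrow> \<beta> x)"

abbreviation asg :: "nat list \<Rightarrow> 'a list \<Rightarrow> nat \<Rightarrow> 'a" where
  "asg \<equiv> upds (\<lambda>_. undefined)"

text \<open>The structures \<open>B\<close> below have universes of natural numbers; up to isomorphism these are
  all finite structures.\<close>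

definition sphere_formula ::
  "signature \<Rightarrow> nat \<Rightarrow> nat struct \<times> nat list \<Rightarrow> nat list \<Rightarrow> fo \<Rightarrow> bool" where
  "sphere_formula \<sigma> s \<tau> zs \<chi> \<longleftrightarrow>
     is_type \<sigma> s \<tau> \<and> distinct zs \<and> length zs = length (snd \<tau>) \<and>
     fo_wf \<sigma> \<chi> \<and> fo_fv \<chi> \<subseteq> set zs \<and>
     (\<forall>(B :: nat struct) bs. is_struct \<sigma> B \<longrightarrow> univ B \<noteq> {} \<longrightarrow>
        length bs = length zs \<longrightarrow> set bs \<subseteq> univ B \<longrightarrow>
        (fo_sat B \<chi> (asg zs bs) \<longleftrightarrow> iso (sphere B s bs) \<tau>))"

text \<open>Boolean combinations of sphere formulas of locality radius smaller than \<open>R\<close>, with free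
  variables from \<open>V\<close>.\<close>

inductive sphere_comb :: "signature \<Rightarrow> nat \<Rightarrow> nat set \<Rightarrow> fo \<Rightarrow> bool"
  for \<sigma> :: signature and R :: nat and V :: "nat set" where
  sphere: "sphere_formula \<sigma> s \<tau> zs \<chi> \<Longrightarrow> s < R \<Longrightarrow> set zs \<subseteq> V \<Longrightarrow> sphere_comb \<sigma> R V \<chi>"
| neg: "sphere_comb \<sigma> R V \<phi> \<Longrightarrow> sphere_comb \<sigma> R V (FNeg \<phi>)"
| disj: "sphere_comb \<sigma> R V \<phi> \<Longrightarrow> sphere_comb \<sigma> R V \<psi> \<Longrightarrow> sphere_comb \<sigma> R V (FDisj \<phi> \<psi>)"


section \<open>First-order logic with counting and numerical predicates\<close>

record 'p numpreds =
  names :: "'p set"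
  arity :: "'p \<Rightarrow> nat"
  sem :: "'p \<Rightarrow> int list set"

definition is_numpreds :: "'p numpreds \<Rightarrow> bool" where
  "is_numpreds P \<longleftrightarrow>
     (\<forall>p \<in> names P. arity P p \<ge> 1 \<and> sem P p \<subseteq> {is. length is = arity P p})"

text \<open>Structure variables and number variables are two separate sorts, both named by natural
  numbers: \<open>Ex\<close> and \<open>Count\<close> bind structure variables, \<open>ExN\<close> binds a number variable. As above,
  \<open>\<forall>x\<close> is \<open>\<not>\<exists>x\<not>\<close>, which does not affect \<open>br\<close> and \<open>bw\<close>.\<close>

datatype 'p fm =
    Eq nat nat
  | Rel nat "nat list"
  | Neg "'p fm"
  | Disj "'p fm" "'p fm"
  | Ex nat "'p fm"
  | NPred 'p "'p cterm list"
  | ExN nat "'p fm"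
and 'p cterm =
    Count "nat list" "'p fm"
  | IntC int
  | NVar nat
  | Plus "'p cterm" "'p cterm"
  | Times "'p cterm" "'p cterm"

text \<open>The tuple bound by a counting term is nonempty and has pairwise distinct entries.\<close>

primrec fm_wf :: "signature \<Rightarrow> 'p numpreds \<Rightarrow> 'p fm \<Rightarrow> bool"
  and cterm_wf :: "signature \<Rightarrow> 'p numpreds \<Rightarrow> 'p cterm \<Rightarrow> bool" where
  "fm_wf \<sigma> P (Eq x y) = True"
| "fm_wf \<sigma> P (Rel i xs) = (i < length \<sigma> \<and> length xs = \<sigma> ! i)"
| "fm_wf \<sigma> P (Neg \<phi>) = fm_wf \<sigma> P \<phi>"
| "fm_wf \<sigma> P (Disj \<phi> \<psi>) = (fm_wf \<sigma> P \<phi> \<and> fm_wf \<sigma> P \<psi>)"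
| "fm_wf \<sigma> P (Ex x \<phi>) = fm_wf \<sigma> P \<phi>"
| "fm_wf \<sigma> P (NPred p ts) =
     (p \<in> names P \<and> length ts = arity P p \<and> list_all id (map (cterm_wf \<sigma> P) ts))"
| "fm_wf \<sigma> P (ExN \<kappa> \<phi>) = fm_wf \<sigma> P \<phi>"
| "cterm_wf \<sigma> P (Count xs \<phi>) = (xs \<noteq> [] \<and> distinct xs \<and> fm_wf \<sigma> P \<phi>)"
| "cterm_wf \<sigma> P (IntC i) = True"
| "cterm_wf \<sigma> P (NVar \<kappa>) = True"
| "cterm_wf \<sigma> P (Plus s t) = (cterm_wf \<sigma> P s \<and> cterm_wf \<sigma> P t)"
| "cterm_wf \<sigma> P (Times s t) = (cterm_wf \<sigma> P s \<and> cterm_wf \<sigma> P t)"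

primrec fv :: "'p fm \<Rightarrow> nat set" and fv_t :: "'p cterm \<Rightarrow> nat set" where
  "fv (Eq x y) = {x, y}"
| "fv (Rel i xs) = set xs"
| "fv (Neg \<phi>) = fv \<phi>"
| "fv (Disj \<phi> \<psi>) = fv \<phi> \<union> fv \<psi>"
| "fv (Ex x \<phi>) = fv \<phi> - {x}"
| "fv (NPred p ts) = \<Union> (set (map fv_t ts))"
| "fv (ExN \<kappa> \<phi>) = fv \<phi>"
| "fv_t (Count xs \<phi>) = fv \<phi> - set xs"
| "fv_t (IntC i) = {}"
| "fv_t (NVar \<kappa>) = {}"
| "fv_t (Plus s t) = fv_t s \<union> fv_t t"
| "fv_t (Times s t) = fv_t s \<union> fv_t t"

primrec nfv :: "'p fm \<Rightarrow> nat set" and nfv_t :: "'p cterm \<Rightarrow> nat set" where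
  "nfv (Eq x y) = {}"
| "nfv (Rel i xs) = {}"
| "nfv (Neg \<phi>) = nfv \<phi>"
| "nfv (Disj \<phi> \<psi>) = nfv \<phi> \<union> nfv \<psi>"
| "nfv (Ex x \<phi>) = nfv \<phi>"
| "nfv (NPred p ts) = \<Union> (set (map nfv_t ts))"
| "nfv (ExN \<kappa> \<phi>) = nfv \<phi> - {\<kappa>}"
| "nfv_t (Count xs \<phi>) = nfv \<phi>"
| "nfv_t (IntC i) = {}"
| "nfv_t (NVar \<kappa>) = {\<kappa>}"
| "nfv_t (Plus s t) = nfv_t s \<union> nfv_t t"
| "nfv_t (Times s t) = nfv_t s \<union> nfv_t t"

primrec br :: "'p fm \<Rightarrow> nat" and br_t :: "'p cterm \<Rightarrow> nat" where
  "br (Eq x y) = 0"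
| "br (Rel i xs) = 0"
| "br (Neg \<phi>) = br \<phi>"
| "br (Disj \<phi> \<psi>) = max (br \<phi>) (br \<psi>)"
| "br (Ex x \<phi>) = Suc (br \<phi>)"
| "br (NPred p ts) = foldr max (map br_t ts) 0"
| "br (ExN \<kappa> \<phi>) = br \<phi>"
| "br_t (Count xs \<phi>) = Suc (br \<phi>)"
| "br_t (IntC i) = 0"
| "br_t (NVar \<kappa>) = 0"
| "br_t (Plus s t) = max (br_t s) (br_t t)"
| "br_t (Times s t) = max (br_t s) (br_t t)"

primrec widths :: "'p fm \<Rightarrow> nat set" and widths_t :: "'p cterm \<Rightarrow> nat set" where
  "widths (Eq x y) = {}"
| "widths (Rel i xs) = {}"
| "widths (Neg \<phi>) = widths \<phi>"
| "widths (Disj \<phi> \<psi>) = widths \<phi> \<union> widths \<psi>"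
| "widths (Ex x \<phi>) = widths \<phi>"
| "widths (NPred p ts) = \<Union> (set (map widths_t ts))"
| "widths (ExN \<kappa> \<phi>) = widths \<phi>"
| "widths_t (Count xs \<phi>) = insert (length xs) (widths \<phi>)"
| "widths_t (IntC i) = {}"
| "widths_t (NVar \<kappa>) = {}"
| "widths_t (Plus s t) = widths_t s \<union> widths_t t"
| "widths_t (Times s t) = widths_t s \<union> widths_t t"

primrec has_quant :: "'p fm \<Rightarrow> bool" and has_quant_t :: "'p cterm \<Rightarrow> bool" where
  "has_quant (Eq x y) = False"
| "has_quant (Rel i xs) = False"
| "has_quant (Neg \<phi>) = has_quant \<phi>"
| "has_quant (Disj \<phi> \<psi>) = (has_quant \<phi> \<or> has_quant \<psi>)"
| "has_quant (Ex x \<phi>) = True"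
| "has_quant (NPred p ts) = list_ex id (map has_quant_t ts)"
| "has_quant (ExN \<kappa> \<phi>) = has_quant \<phi>"
| "has_quant_t (Count xs \<phi>) = has_quant \<phi>"
| "has_quant_t (IntC i) = False"
| "has_quant_t (NVar \<kappa>) = False"
| "has_quant_t (Plus s t) = (has_quant_t s \<or> has_quant_t t)"
| "has_quant_t (Times s t) = (has_quant_t s \<or> has_quant_t t)"

definition bw :: "'p fm \<Rightarrow> nat" where
  "bw \<phi> = (if widths \<phi> \<noteq> {} then Max (widths \<phi>) else if has_quant \<phi> then 1 else 0)"

fun sat :: "'p numpreds \<Rightarrow> 'a struct \<Rightarrow> 'p fm \<Rightarrow> (nat \<Rightarrow> 'a) \<Rightarrow> (nat \<Rightarrow> nat) \<Rightarrow> bool"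
  and val :: "'p numpreds \<Rightarrow> 'a struct \<Rightarrow> 'p cterm \<Rightarrow> (nat \<Rightarrow> 'a) \<Rightarrow> (nat \<Rightarrow> nat) \<Rightarrow> int" where
  "sat P A (Eq x y) \<beta> \<nu> = (\<beta> x = \<beta> y)"
| "sat P A (Rel i xs) \<beta> \<nu> = (map \<beta> xs \<in> rels A i)"
| "sat P A (Neg \<phi>) \<beta> \<nu> = (\<not> sat P A \<phi> \<beta> \<nu>)"
| "sat P A (Disj \<phi> \<psi>) \<beta> \<nu> = (sat P A \<phi> \<beta> \<nu> \<or> sat P A \<psi> \<beta> \<nu>)"
| "sat P A (Ex x \<phi>) \<beta> \<nu> = (\<exists>a \<in> univ A. sat P A \<phi> (\<beta>(x := a)) \<nu>)"
| "sat P A (NPred p ts) \<beta> \<nu> = (map (\<lambda>t. val P A t \<beta> \<nu>) ts \<in> sem P p)"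
| "sat P A (ExN \<kappa> \<phi>) \<beta> \<nu> = (\<exists>m \<le> card (univ A). sat P A \<phi> \<beta> (\<nu>(\<kappa> := m)))"
| "val P A (Count xs \<phi>) \<beta> \<nu> =
     int (card {as. length as = length xs \<and> set as \<subseteq> univ A \<and> sat P A \<phi> (upds \<beta> xs as) \<nu>})"
| "val P A (IntC i) \<beta> \<nu> = i"
| "val P A (NVar \<kappa>) \<beta> \<nu> = int (\<nu> \<kappa>)"
| "val P A (Plus s t) \<beta> \<nu> = val P A s \<beta> \<nu> + val P A t \<beta> \<nu>"
| "val P A (Times s t) \<beta> \<nu> = val P A s \<beta> \<nu> * val P A t \<beta> \<nu>"


section \<open>Hypotheses and training error\<close>

text \<open>In \<open>focn_hyp P B \<phi> xs ys ks v \<mu>\<close> the tuples \<open>xs\<close>, \<open>ys\<close> list the instance and the parameter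
  variables, \<open>ks\<close> the free number variables. A returned formula always uses the variables
  \<open>0, \<dots>, k - 1\<close> for instances and \<open>k, \<dots>, k + l - 1\<close> for parameters.\<close>

definition focn_hyp ::
  "'p numpreds \<Rightarrow> 'a struct \<Rightarrow> 'p fm \<Rightarrow> nat list \<Rightarrow> nat list \<Rightarrow> nat list \<Rightarrow> 'a list \<Rightarrow> nat list \<Rightarrow>
   'a list \<Rightarrow> bool" where
  "focn_hyp P B \<phi> xs ys ks v \<mu> = (\<lambda>u. sat P B \<phi> (asg (xs @ ys) (u @ v)) (asg ks \<mu>))"

definition fo_hyp :: "'a struct \<Rightarrow> fo \<Rightarrow> nat \<Rightarrow> nat \<Rightarrow> 'a list \<Rightarrow> 'a list \<Rightarrow> bool" where
  "fo_hyp B \<phi> k l v = (\<lambda>u. fo_sat B \<phi> (asg [0..<k + l] (u @ v)))"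

definition is_training :: "'a struct \<Rightarrow> nat \<Rightarrow> ('a list \<times> bool) list \<Rightarrow> bool" where
  "is_training B k T \<longleftrightarrow> (\<forall>(u, c) \<in> set T. length u = k \<and> set u \<subseteq> univ B)"

text \<open>For the empty training sequence this is \<open>0 / 0 = 0\<close>.\<close>

definition err :: "('a list \<times> bool) list \<Rightarrow> ('a list \<Rightarrow> bool) \<Rightarrow> real" where
  "err T H = real (card {i. i < length T \<and> H (fst (T ! i)) \<noteq> snd (T ! i)}) / real (length T)"


section \<open>Random access machines with local access\<close>

text \<open>Programs of a random access machine with logarithmic cost measure, in structured form. The
  machine has registers and an indirectly addressed memory, both holding natural numbers. The
  background structure is reached only through \<open>AskRel\<close> and \<open>AskNbrs\<close>.\<close>

datatype instr =
    Const nat nat             \<comment> \<open>\<open>r\<^sub>a := c\<close>\<close>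
  | Add nat nat nat           \<comment> \<open>\<open>r\<^sub>a := r\<^sub>b + r\<^sub>c\<close>\<close>
  | Sub nat nat nat           \<comment> \<open>\<open>r\<^sub>a := r\<^sub>b - r\<^sub>c\<close>, truncated at 0\<close>
  | Load nat nat              \<comment> \<open>\<open>r\<^sub>a := M[r\<^sub>b]\<close>\<close>
  | Store nat nat             \<comment> \<open>\<open>M[r\<^sub>a] := r\<^sub>b\<close>\<close>
  | AskRel nat nat "nat list" \<comment> \<open>\<open>r\<^sub>a := 1\<close> if the tuple in the listed registers is in relation \<open>i\<close>, else \<open>0\<close>\<close>
  | AskNbrs nat nat           \<comment> \<open>writes the list of all neighbors of \<open>r\<^sub>a\<close> to memory, from address \<open>r\<^sub>b\<close> on\<close>

datatype prog =
    Basic instr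
  | Seq prog prog
  | IfNZ nat prog prog
  | WhileNZ nat prog

type_synonym state = "(nat \<Rightarrow> nat) \<times> (nat \<Rightarrow> nat)"

text \<open>Lists are stored in memory preceded by their length.\<close>

definition put_list :: "nat \<Rightarrow> nat list \<Rightarrow> (nat \<Rightarrow> nat) \<Rightarrow> nat \<Rightarrow> nat" where
  "put_list p vs m = (\<lambda>q. if q = p then length vs
     else if p < q \<and> q \<le> p + length vs then vs ! (q - p - 1) else m q)"

definition get_list :: "nat \<Rightarrow> (nat \<Rightarrow> nat) \<Rightarrow> nat list" where
  "get_list p m = map (\<lambda>j. m (p + 1 + j)) [0..<m p]"

definition bits :: "nat \<Rightarrow> nat" where
  "bits x = 1 + floorlog 2 x"

text \<open>Here and below, \<open>R\<close> answers the membership queries and \<open>N\<close> the neighbor queries.\<close>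

fun effect :: "(nat \<Rightarrow> nat list \<Rightarrow> bool) \<Rightarrow> (nat \<Rightarrow> nat list) \<Rightarrow> instr \<Rightarrow> state \<Rightarrow> state" where
  "effect R N (Const a c) (r, m) = (r(a := c), m)"
| "effect R N (Add a b c) (r, m) = (r(a := r b + r c), m)"
| "effect R N (Sub a b c) (r, m) = (r(a := r b - r c), m)"
| "effect R N (Load a b) (r, m) = (r(a := m (r b)), m)"
| "effect R N (Store a b) (r, m) = (r, m(r a := r b))"
| "effect R N (AskRel a i bs) (r, m) = (r(a := of_bool (R i (map r bs))), m)"
| "effect R N (AskNbrs a b) (r, m) = (r, put_list (r b) (N (r a)) m)"

fun cost :: "(nat \<Rightarrow> nat list) \<Rightarrow> instr \<Rightarrow> state \<Rightarrow> nat" where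
  "cost N (Const a c) (r, m) = bits c"
| "cost N (Add a b c) (r, m) = bits (r b) + bits (r c)"
| "cost N (Sub a b c) (r, m) = bits (r b) + bits (r c)"
| "cost N (Load a b) (r, m) = bits (r b) + bits (m (r b))"
| "cost N (Store a b) (r, m) = bits (r a) + bits (r b)"
| "cost N (AskRel a i bs) (r, m) = 1 + (\<Sum>b \<leftarrow> bs. bits (r b))"
| "cost N (AskNbrs a b) (r, m) = bits (r a) + bits (r b) + bits (length (N (r a))) +
     (\<Sum>j < length (N (r a)). bits (r b + 1 + j) + bits (N (r a) ! j))"

text \<open>\<open>exec R N c s t s'\<close>: started in \<open>s\<close>, program \<open>c\<close> halts in \<open>s'\<close> after time \<open>t\<close>.\<close>

inductive exec ::
  "(nat \<Rightarrow> nat list \<Rightarrow> bool) \<Rightarrow> (nat \<Rightarrow> nat list) \<Rightarrow> prog \<Rightarrow> state \<Rightarrow> nat \<Rightarrow> state \<Rightarrow> bool"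
  for R :: "nat \<Rightarrow> nat list \<Rightarrow> bool" and N :: "nat \<Rightarrow> nat list" where
  basic: "exec R N (Basic i) s (cost N i s) (effect R N i s)"
| seq: "exec R N c s t s' \<Longrightarrow> exec R N c' s' t' s'' \<Longrightarrow> exec R N (Seq c c') s (t + t') s''"
| if_true: "fst s a \<noteq> 0 \<Longrightarrow> exec R N c s t s' \<Longrightarrow>
    exec R N (IfNZ a c c') s (bits (fst s a) + t) s'"
| if_false: "fst s a = 0 \<Longrightarrow> exec R N c' s t s' \<Longrightarrow>
    exec R N (IfNZ a c c') s (bits (fst s a) + t) s'"
| while_true: "fst s a \<noteq> 0 \<Longrightarrow> exec R N c s t s' \<Longrightarrow> exec R N (WhileNZ a c) s' t' s'' \<Longrightarrow>
    exec R N (WhileNZ a c) s (bits (fst s a) + t + t') s''"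
| while_false: "fst s a = 0 \<Longrightarrow> exec R N (WhileNZ a c) s (bits (fst s a)) s"

inductive_cases exec_BasicE: "exec R N (Basic i) s t s'"
inductive_cases exec_SeqE: "exec R N (Seq c c') s t s'"
inductive_cases exec_IfNZE: "exec R N (IfNZ a c c') s t s'"
inductive_cases exec_WhileNZE: "exec R N (WhileNZ a c) s t s'"

lemma exec_deterministic:
  "exec R N c s t s' \<Longrightarrow> exec R N c s t' s'' \<Longrightarrow> t' = t \<and> s'' = s'"
proof (induction arbitrary: t' s'' rule: exec.induct)
  case (basic i s)
  from basic.prems show ?case by (rule exec_BasicE) simp
next
  case (seq c s t s1 c' t1 s2)
  from seq.prems obtain ta sa tb
    where *: "exec R N c s ta sa" "exec R N c' sa tb s''" "t' = ta + tb"
    by (rule exec_SeqE)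
  from seq.IH(1)[OF *(1)] have eq: "ta = t" "sa = s1" by auto
  with * have "exec R N c' s1 tb s''" by simp
  from seq.IH(2)[OF this] show ?case using *(3) eq by simp
next
  case (if_true s a c t s1 c')
  from if_true.prems if_true.hyps(1) obtain ta
    where *: "exec R N c s ta s''" "t' = bits (fst s a) + ta"
    by (elim exec_IfNZE) simp_all
  from if_true.IH[OF *(1)] *(2) show ?case by simp
next
  case (if_false s a c' t s1 c)
  from if_false.prems if_false.hyps(1) obtain ta
    where *: "exec R N c' s ta s''" "t' = bits (fst s a) + ta"
    by (elim exec_IfNZE) simp_all
  from if_false.IH[OF *(1)] *(2) show ?case by simp
next
  case (while_true s a c t s1 t1 s2)
  from while_true.prems obtain ta sa tb
    where *: "exec R N c s ta sa" "exec R N (WhileNZ a c) sa tb s''"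
      "t' = bits (fst s a) + ta + tb"
    by (rule exec_WhileNZE) (use while_true.hyps(1) in simp_all)
  from while_true.IH(1)[OF *(1)] have eq: "ta = t" "sa = s1" by auto
  with * have "exec R N (WhileNZ a c) s1 tb s''" by simp
  from while_true.IH(2)[OF this] show ?case using *(3) eq by simp
next
  case (while_false s a c)
  from while_false.prems show ?case
    by (rule exec_WhileNZE) (use while_false.hyps in simp_all)
qed

text \<open>Input and output are lists of numbers stored at address \<open>0\<close>; everything else is
  initially \<open>0\<close>.\<close>

definition runs ::
  "(nat \<Rightarrow> nat list \<Rightarrow> bool) \<Rightarrow> (nat \<Rightarrow> nat list) \<Rightarrow> prog \<Rightarrow> nat list \<Rightarrow> nat \<Rightarrow> nat list \<Rightarrow> bool" where
  "runs R N c inp t out \<longleftrightarrow>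
     (\<exists>r m. exec R N c (\<lambda>_. 0, put_list 0 inp (\<lambda>_. 0)) t (r, m) \<and> get_list 0 m = out)"

definition local_access ::
  "nat struct \<Rightarrow> (nat \<Rightarrow> nat list \<Rightarrow> bool) \<Rightarrow> (nat \<Rightarrow> nat list) \<Rightarrow> bool" where
  "local_access B R N \<longleftrightarrow> (\<forall>i t. R i t \<longleftrightarrow> t \<in> rels B i) \<and>
     (\<forall>a. distinct (N a) \<and> set (N a) = nbrs B a)"


section \<open>Encoding of training sequences and formulas\<close>

definition enc_training :: "(nat list \<times> bool) list \<Rightarrow> nat list" where
  "enc_training T = length T # concat (map (\<lambda>(u, c). u @ [of_bool c]) T)"

primrec enc_fo :: "fo \<Rightarrow> nat list" where
  "enc_fo (FEq x y) = [0, x, y]"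
| "enc_fo (FRel i xs) = [1, i, length xs] @ xs"
| "enc_fo (FNeg \<phi>) = 2 # enc_fo \<phi>"
| "enc_fo (FDisj \<phi> \<psi>) = 3 # enc_fo \<phi> @ enc_fo \<psi>"
| "enc_fo (FEx x \<phi>) = [4, x] @ enc_fo \<phi>"

lemma enc_fo_prefix_free: "enc_fo \<phi> @ as = enc_fo \<psi> @ bs \<Longrightarrow> \<phi> = \<psi> \<and> as = bs"
proof (induction \<phi> arbitrary: \<psi> as bs)
  case (FEq x y)
  then show ?case by (cases \<psi>) auto
next
  case (FRel i xs)
  then show ?case by (cases \<psi>) auto
next
  case (FNeg \<phi>)
  then show ?case by (cases \<psi>) auto
next
  case (FDisj \<phi>1 \<phi>2)
  from FDisj.prems obtain \<psi>1 \<psi>2 where [simp]: "\<psi> = FDisj \<psi>1 \<psi>2" by (cases \<psi>) auto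
  from FDisj.prems have "enc_fo \<phi>1 @ enc_fo \<phi>2 @ as = enc_fo \<psi>1 @ enc_fo \<psi>2 @ bs" by simp
  from FDisj.IH(1)[OF this] FDisj.IH(2)[of as \<psi>2 bs] show ?case by simp
next
  case (FEx x \<phi>)
  then show ?case by (cases \<psi>) auto
qed

definition enc_hyp :: "nat list \<Rightarrow> fo \<Rightarrow> nat list" where
  "enc_hyp v \<phi> = v @ enc_fo \<phi>"

end

theory Submission
  imports Defs
begin

text \<open>
  Within one structure, an isomorphism between the spheres of radius \<open>R + w * (2 * R + 1)\<close> of two tuples
  \<open>a\<close> and \<open>b\<close> implies that \<open>a\<close> and \<open>b\<close> have equally many extensions by \<open>w\<close>-tuples of each \<open>R\<close>-sphere
  type. Hence whether a counting formula holds depends only on the sphere of radius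
  \<open>((2 * w + 1) ^ r - 1) div 2\<close>, and parameters far from all training instances can be dropped. It
  suffices to try parameters near the instances together with all unions of sphere types, and this is
  a polynomial number of candidates. In a structure of degree at most \<open>d\<close>, the elements of a sphere are
  reached by finitely many words of neighbor indices, and the equalities and relations between them
  determine its isomorphism type; each candidate formula is therefore evaluated by a fixed decision
  tree of local queries.
\<close>

section \<open>Spheres and their isomorphisms\<close>

text \<open>Numerical predicates see exact numbers, so the counts around \<open>a\<close> and
  \<open>b\<close> must agree exactly and not merely up to a threshold. Exact agreement is possible
  because both tuples live in the same structure. It also makes quantifiers over number variables
  free: they cost no radius. Neither program depends on the structure or its size. With signature,
  degree bound, radius and tuple lengths fixed, only finitely many query patterns occur, so formulas
  and their truth tables over patterns may be chosen nonconstructively and written into the program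
  text. Evaluating the quantifiers of the returned formula would mean scanning the universe; instead
  the evaluator only recognizes which stored formula it received. Patterns are compared through
  representatives of sphere types, because one type may show several patterns. Only loops over
  examples depend on the input, at most \<open>l + 1\<close> of them nested; hence the number of
  steps is polynomial in \<open>t\<close>, and \<open>log n\<close> enters through the lengths of
  numbers alone.\<close>

lemma gaifman_sym: "(a, b) \<in> gaifman A \<Longrightarrow> (b, a) \<in> gaifman A"
  by (auto simp: gaifman_def)

lemma rels_univ:
  assumes "is_struct \<sigma> A" "t \<in> rels A i"
  shows "set t \<subseteq> univ A" "i < length \<sigma>" "length t = \<sigma> ! i"
proof -
  show i: "i < length \<sigma>" using assms by (auto simp: is_struct_def intro: leI)
  show "set t \<subseteq> univ A" "length t = \<sigma> ! i" using assms i by (auto simp: is_struct_def)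
qed

lemma gaifman_univ:
  assumes "is_struct \<sigma> A" "(a, b) \<in> gaifman A"
  shows "a \<in> univ A" "b \<in> univ A"
  using assms rels_univ(1)[OF assms(1)] by (auto simp: gaifman_def)

lemma gaifman_relpow_sym: "(a, b) \<in> gaifman A ^^ m \<Longrightarrow> (b, a) \<in> gaifman A ^^ m"
proof (induction m arbitrary: b)
  case (Suc m)
  then obtain c where "(a, c) \<in> gaifman A ^^ m" "(c, b) \<in> gaifman A" by auto
  then show ?case using Suc.IH gaifman_sym by (metis relpow_Suc_I2)
qed auto

lemma nbhd_univ: "nbhd A s as \<subseteq> univ A"
  by (auto simp: nbhd_def)

lemma finite_nbhd: "is_struct \<sigma> A \<Longrightarrow> finite (nbhd A s as)"
  by (rule finite_subset[OF nbhd_univ]) (simp add: is_struct_def)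

lemma nbhd_0: "set as \<subseteq> univ A \<Longrightarrow> nbhd A 0 as = set as"
  by (auto simp: nbhd_def)

lemma nbhd_center: "set as \<subseteq> univ A \<Longrightarrow> set as \<subseteq> nbhd A s as"
  by (force simp: nbhd_def)

lemma nbhd_Suc:
  assumes "is_struct \<sigma> A"
  shows "nbhd A (Suc s) as = nbhd A s as \<union> {b. \<exists>c \<in> nbhd A s as. (c, b) \<in> gaifman A}"
proof (intro equalityI subsetI)
  fix b assume "b \<in> nbhd A (Suc s) as"
  then obtain a m where a: "b \<in> univ A" "a \<in> set as" "m \<le> Suc s" "(a, b) \<in> gaifman A ^^ m"
    by (auto simp: nbhd_def)
  show "b \<in> nbhd A s as \<union> {b. \<exists>c \<in> nbhd A s as. (c, b) \<in> gaifman A}"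
  proof (cases "m \<le> s")
    case True
    then show ?thesis using a by (auto simp: nbhd_def)
  next
    case False
    then obtain c where c: "(a, c) \<in> gaifman A ^^ s" "(c, b) \<in> gaifman A"
      using a by (auto simp: le_Suc_eq)
    then have "c \<in> nbhd A s as"
      using a gaifman_univ(1)[OF assms c(2)] by (auto simp: nbhd_def)
    then show ?thesis using c by auto
  qed
next
  fix b assume "b \<in> nbhd A s as \<union> {b. \<exists>c \<in> nbhd A s as. (c, b) \<in> gaifman A}"
  then show "b \<in> nbhd A (Suc s) as"
  proof
    assume "b \<in> {b. \<exists>c \<in> nbhd A s as. (c, b) \<in> gaifman A}"
    then obtain c a m where "(c, b) \<in> gaifman A" "a \<in> set as" "m \<le> s" "(a, c) \<in> gaifman A ^^ m"
      by (auto simp: nbhd_def)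
    moreover from this have "(a, b) \<in> gaifman A ^^ Suc m" by auto
    ultimately show ?thesis
      using gaifman_univ(2)[OF assms] unfolding nbhd_def by (metis (mono_tags, lifting) Suc_le_mono mem_Collect_eq)
  qed (auto simp: nbhd_def intro: le_SucI)
qed

lemma nbhd_mono: "s \<le> s' \<Longrightarrow> set as \<subseteq> set bs \<Longrightarrow> nbhd A s as \<subseteq> nbhd A s' bs"
  unfolding nbhd_def by (blast intro: le_trans)

lemma nbhd_append: "nbhd A s (as @ bs) = nbhd A s as \<union> nbhd A s bs"
  by (auto simp: nbhd_def)

lemma nbhd_iff_single: "b \<in> nbhd A s as \<longleftrightarrow> (\<exists>a \<in> set as. b \<in> nbhd A s [a])"
  by (auto simp: nbhd_def)

lemma nbhd_trans: "set bs \<subseteq> nbhd A i as \<Longrightarrow> nbhd A j bs \<subseteq> nbhd A (i + j) as"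
proof
  fix x assume b: "set bs \<subseteq> nbhd A i as" and "x \<in> nbhd A j bs"
  then obtain b m where x: "x \<in> univ A" "b \<in> set bs" "m \<le> j" "(b, x) \<in> gaifman A ^^ m"
    by (auto simp: nbhd_def)
  then obtain a m' where "a \<in> set as" "m' \<le> i" "(a, b) \<in> gaifman A ^^ m'"
    using b by (auto simp: nbhd_def)
  moreover from this x have "(a, x) \<in> gaifman A ^^ (m' + m)" by (auto simp: relpow_add)
  ultimately show "x \<in> nbhd A (i + j) as"
    using x unfolding nbhd_def by (metis (mono_tags, lifting) add_mono mem_Collect_eq)
qed

lemma nbhd_sym: "y \<in> nbhd A s [x] \<Longrightarrow> x \<in> univ A \<Longrightarrow> x \<in> nbhd A s [y]"
  by (auto simp: nbhd_def dest: gaifman_relpow_sym)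

text \<open>Distinct entries of one tuple are Gaifman neighbors, so a tuple that meets a ball lies
  in the ball of the next radius.\<close>

lemma nbhd_tuple:
  assumes "is_struct \<sigma> A" "t \<in> rels A i" "x \<in> set t" "x \<in> nbhd A s as"
  shows "set t \<subseteq> nbhd A (Suc s) as"
proof
  fix y assume y: "y \<in> set t"
  show "y \<in> nbhd A (Suc s) as"
  proof (cases "y = x")
    case False
    then have "(x, y) \<in> gaifman A" using assms(2,3) y by (auto simp: gaifman_def)
    then show ?thesis unfolding nbhd_Suc[OF assms(1)] using assms(4) by auto
  qed (use assms(4) nbhd_Suc[OF assms(1)] in auto)
qed

section \<open>Isomorphisms of structures with centers\<close>

lemma iso_refl: "iso \<tau> \<tau>"
  unfolding iso_def by (rule exI[of _ id]) auto

text \<open>The inverse of the bijection is controlled only on the universe, so the centers of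
  \<open>\<tau>\<close> have to lie there to be mapped back.\<close>

lemma iso_sym:
  assumes "iso \<tau> \<rho>" "set (snd \<tau>) \<subseteq> univ (fst \<tau>)"
  shows "iso \<rho> \<tau>"
proof -
  from assms obtain f where f: "bij_betw f (univ (fst \<tau>)) (univ (fst \<rho>))" "map f (snd \<tau>) = snd \<rho>"
    "\<And>i t. set t \<subseteq> univ (fst \<tau>) \<Longrightarrow> t \<in> rels (fst \<tau>) i \<longleftrightarrow> map f t \<in> rels (fst \<rho>) i"
    unfolding iso_def by blast
  let ?g = "inv_into (univ (fst \<tau>)) f"
  have inj: "inj_on f (univ (fst \<tau>))" using f(1) by (auto simp: bij_betw_def)
  have "map ?g (snd \<rho>) = snd \<tau>"
    unfolding f(2)[symmetric] map_map using assms(2) inj by (intro map_idI) (auto simp: subset_iff)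
  moreover have "t \<in> rels (fst \<rho>) i \<longleftrightarrow> map ?g t \<in> rels (fst \<tau>) i"
    if t: "set t \<subseteq> univ (fst \<rho>)" for i t
  proof -
    have "set (map ?g t) \<subseteq> univ (fst \<tau>)"
      using t f(1) by (auto simp: bij_betw_def subset_iff inv_into_into)
    moreover have "map f (map ?g t) = t"
      unfolding map_map using t f(1) by (intro map_idI) (auto simp: bij_betw_def subset_iff f_inv_into_f)
    ultimately show ?thesis using f(3)[of "map ?g t"] by simp
  qed
  ultimately show ?thesis
    unfolding iso_def using bij_betw_inv_into[OF f(1)] by blast
qed

lemma iso_trans:
  assumes "iso \<tau> \<rho>" "iso \<rho> \<pi>"
  shows "iso \<tau> \<pi>"
proof -
  from assms obtain f where f: "bij_betw f (univ (fst \<tau>)) (univ (fst \<rho>))" "map f (snd \<tau>) = snd \<rho>"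
    "\<And>i t. set t \<subseteq> univ (fst \<tau>) \<Longrightarrow> t \<in> rels (fst \<tau>) i \<longleftrightarrow> map f t \<in> rels (fst \<rho>) i"
    unfolding iso_def by blast
  from assms obtain g where g: "bij_betw g (univ (fst \<rho>)) (univ (fst \<pi>))" "map g (snd \<rho>) = snd \<pi>"
    "\<And>i t. set t \<subseteq> univ (fst \<rho>) \<Longrightarrow> t \<in> rels (fst \<rho>) i \<longleftrightarrow> map g t \<in> rels (fst \<pi>) i"
    unfolding iso_def by blast
  have "t \<in> rels (fst \<tau>) i \<longleftrightarrow> map (g \<circ> f) t \<in> rels (fst \<pi>) i" if t: "set t \<subseteq> univ (fst \<tau>)" for i t
  proof -
    have "set (map f t) \<subseteq> univ (fst \<rho>)" using t f(1) by (auto simp: bij_betw_def)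
    then show ?thesis using f(3)[OF t] g(3)[of "map f t"] by simp
  qed
  moreover have "map (g \<circ> f) (snd \<tau>) = snd \<pi>" using f(2) g(2) by (metis map_map)
  ultimately show ?thesis
    unfolding iso_def using bij_betw_trans[OF f(1) g(1)] by blast
qed

section \<open>Isomorphisms between two spheres of one structure\<close>

definition sphere_iso :: "'a struct \<Rightarrow> nat \<Rightarrow> ('a \<Rightarrow> 'a) \<Rightarrow> 'a list \<Rightarrow> 'a list \<Rightarrow> bool" where
  "sphere_iso B s f a b \<longleftrightarrow> bij_betw f (nbhd B s a) (nbhd B s b) \<and> map f a = b \<and>
     (\<forall>i t. set t \<subseteq> nbhd B s a \<longrightarrow> (t \<in> rels B i \<longleftrightarrow> map f t \<in> rels B i))"

abbreviation sim :: "'a struct \<Rightarrow> nat \<Rightarrow> 'a list \<Rightarrow> 'a list \<Rightarrow> bool" where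
  "sim B s a b \<equiv> iso (sphere B s a) (sphere B s b)"

lemma univ_sphere: "univ (fst (sphere B s a)) = nbhd B s a"
  by (auto simp: sphere_def induced_def nbhd_def)

text \<open>The side condition from \<open>induced\<close> disappears because the bijection sends
  tuples inside one ball to tuples inside the other.\<close>

lemma sim_iff_sphere_iso: "sim B s a b \<longleftrightarrow> (\<exists>f. sphere_iso B s f a b)"
proof -
  have *: "t \<in> rels (fst (sphere B s a)) i \<longleftrightarrow> t \<in> rels B i \<and> set t \<subseteq> nbhd B s a" for t i a
    by (auto simp: sphere_def induced_def)
  have s: "snd (sphere B s a) = a" for a by (simp add: sphere_def)
  have im: "set (map f t) \<subseteq> nbhd B s b"
    if "bij_betw f (nbhd B s a) (nbhd B s b)" "set t \<subseteq> nbhd B s a" for f t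
    using that by (auto simp: bij_betw_def)
  show ?thesis
    unfolding iso_def sphere_iso_def univ_sphere s *
  proof (intro ex_cong1 conj_cong refl all_cong1 imp_cong)
    fix f i t
    assume "bij_betw f (nbhd B s a) (nbhd B s b)" "set t \<subseteq> nbhd B s a"
    from this im[OF this]
    show "(t \<in> rels B i \<and> set t \<subseteq> nbhd B s a \<longleftrightarrow> map f t \<in> rels B i \<and> set (map f t) \<subseteq> nbhd B s b) \<longleftrightarrow>
      (t \<in> rels B i \<longleftrightarrow> map f t \<in> rels B i)" by simp
  qed
qed

lemma sim_sym: "sim B s a b \<Longrightarrow> set a \<subseteq> univ B \<Longrightarrow> sim B s b a"
  by (rule iso_sym) (auto simp: univ_sphere sphere_def induced_def dest: nbhd_center[of a B s])

lemma sim_length: "sim B s a b \<Longrightarrow> length a = length b"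
  unfolding sim_iff_sphere_iso sphere_iso_def by auto

lemma sphere_iso_in_univ:
  assumes "sphere_iso B s f a b" "set a \<subseteq> univ B"
  shows "set b \<subseteq> univ B"
proof -
  have "set b = f ` set a" using assms by (auto simp: sphere_iso_def)
  also have "\<dots> \<subseteq> f ` nbhd B s a" using nbhd_center[OF assms(2)] by blast
  also have "\<dots> = nbhd B s b" using assms by (auto simp: sphere_iso_def bij_betw_def)
  finally show ?thesis using nbhd_univ[of B s b] by simp
qed

lemma sphere_iso_inv:
  assumes "sphere_iso B s f a b" "set a \<subseteq> univ B"
  shows "sphere_iso B s (inv_into (nbhd B s a) f) b a"
proof -
  let ?g = "inv_into (nbhd B s a) f"
  have f: "bij_betw f (nbhd B s a) (nbhd B s b)" "map f a = b"
    "\<And>i t. set t \<subseteq> nbhd B s a \<Longrightarrow> t \<in> rels B i \<longleftrightarrow> map f t \<in> rels B i"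
    using assms by (auto simp: sphere_iso_def)
  have inj: "inj_on f (nbhd B s a)" using f(1) by (auto simp: bij_betw_def)
  have "map ?g b = a"
    unfolding f(2)[symmetric] map_map using nbhd_center[OF assms(2)] inj
    by (intro map_idI) (auto simp: subset_iff)
  moreover have "t \<in> rels B i \<longleftrightarrow> map ?g t \<in> rels B i" if t: "set t \<subseteq> nbhd B s b" for i t
  proof -
    have "set (map ?g t) \<subseteq> nbhd B s a"
      using t f(1) by (auto simp: bij_betw_def subset_iff inv_into_into)
    moreover have "map f (map ?g t) = t"
      unfolding map_map using t f(1) by (intro map_idI) (auto simp: bij_betw_def subset_iff f_inv_into_f)
    ultimately show ?thesis using f(3)[of "map ?g t"] by simp
  qed
  ultimately show ?thesis unfolding sphere_iso_def using bij_betw_inv_into[OF f(1)] by blast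
qed

text \<open>A path of length at most \<open>j\<close> from \<open>c\<close> can be followed inside
  the sphere: each edge is witnessed by a tuple within distance \<open>i + j\<close> of
  \<open>a\<close>, which \<open>f\<close> preserves. The reverse inclusion comes later, from the
  inverse isomorphism.\<close>

lemma sphere_iso_image_subset:
  assumes B: "is_struct \<sigma> B" and f: "sphere_iso B s f a b" and "set a \<subseteq> univ B"
    and c: "set c \<subseteq> nbhd B i a" and "i + j \<le> s"
  shows "f ` nbhd B j c \<subseteq> nbhd B j (map f c)"
  using assms(5)
proof (induction j)
  case 0
  have "nbhd B 0 c = set c" using subset_trans[OF c nbhd_univ] by (rule nbhd_0)
  moreover have "nbhd B 0 (map f c) = set (map f c)"
  proof (rule nbhd_0)
    have "set c \<subseteq> nbhd B s a" using c 0 nbhd_mono[of i s a a] by auto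
    then show "set (map f c) \<subseteq> univ B"
      using f nbhd_univ[of B s b] by (auto simp: sphere_iso_def bij_betw_def)
  qed
  ultimately show ?case by simp
next
  case (Suc j)
  have ext: "nbhd B (Suc j) c \<subseteq> nbhd B s a"
    using nbhd_trans[OF c, of "Suc j"] nbhd_mono[of "i + Suc j" s a a B] Suc.prems by auto
  show ?case
  proof
    fix y assume "y \<in> f ` nbhd B (Suc j) c"
    then obtain x where x: "y = f x" "x \<in> nbhd B (Suc j) c" by auto
    then consider "x \<in> nbhd B j c" | z where "z \<in> nbhd B j c" "(z, x) \<in> gaifman B"
      unfolding nbhd_Suc[OF B] by auto
    then show "y \<in> nbhd B (Suc j) (map f c)"
    proof cases
      case 1
      then show ?thesis using Suc x unfolding nbhd_Suc[OF B] by auto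
    next
      case 2
      then obtain i' t where t: "t \<in> rels B i'" "z \<in> set t" "x \<in> set t" "z \<noteq> x"
        by (auto simp: gaifman_def)
      have ts: "set t \<subseteq> nbhd B s a" using nbhd_tuple[OF B t(1,2) 2(1)] ext by auto
      then have "map f t \<in> rels B i'" using f t(1) by (auto simp: sphere_iso_def)
      moreover have "inj_on f (nbhd B s a)" using f by (simp add: sphere_iso_def bij_betw_def)
      then have "f z \<noteq> f x" using ts t by (auto dest: inj_onD)
      ultimately have "(f z, f x) \<in> gaifman B" using t by (force simp: gaifman_def)
      moreover have "f z \<in> nbhd B j (map f c)" using Suc 2 by auto
      ultimately show ?thesis using x unfolding nbhd_Suc[OF B] by auto
    qed
  qed
qed

text \<open>\<open>sphere_iso_image_subset\<close> for \<open>f\<close> and for its inverse gives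
  both inclusions between the smaller balls. The budget \<open>i + j \<le> s\<close> is the distance
  of the new centers plus the new radius.\<close>

lemma sphere_iso_restrict:
  assumes B: "is_struct \<sigma> B" and f: "sphere_iso B s f a b" and a: "set a \<subseteq> univ B"
    and c: "set c \<subseteq> nbhd B i a" and ij: "i + j \<le> s"
  shows "sphere_iso B j f c (map f c)"
proof -
  let ?g = "inv_into (nbhd B s a) f"
  have inj: "inj_on f (nbhd B s a)" using f by (auto simp: sphere_iso_def bij_betw_def)
  have cs: "nbhd B j c \<subseteq> nbhd B s a"
    using nbhd_trans[OF c, of j] nbhd_mono[OF ij, of a a B] by auto
  have c': "set c \<subseteq> nbhd B s a" using c ij nbhd_mono[of i s a a B] by auto
  have gc: "map ?g (map f c) = c"
    unfolding map_map using c' inj by (intro map_idI) (auto simp: subset_iff)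
  have b: "set b \<subseteq> univ B" using sphere_iso_in_univ[OF f a] .
  have fa: "map f a = b" using f by (auto simp: sphere_iso_def)
  have "set a \<subseteq> nbhd B 0 a" using nbhd_center[OF a] .
  then have "f ` nbhd B i a \<subseteq> nbhd B i b"
    using sphere_iso_image_subset[OF B f a, of a 0 i] ij fa by simp
  then have fc: "set (map f c) \<subseteq> nbhd B i b" using c by auto
  have "?g ` nbhd B j (map f c) \<subseteq> nbhd B j c"
    using sphere_iso_image_subset[OF B sphere_iso_inv[OF f a] b fc ij] gc by simp
  moreover have "nbhd B j (map f c) \<subseteq> nbhd B s b"
    using nbhd_trans[OF fc, of j] nbhd_mono[OF ij, of b b B] by auto
  ultimately have "nbhd B j (map f c) \<subseteq> f ` nbhd B j c"
  proof -
    assume 1: "?g ` nbhd B j (map f c) \<subseteq> nbhd B j c" and 2: "nbhd B j (map f c) \<subseteq> nbhd B s b"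
    show ?thesis
    proof
      fix y assume y: "y \<in> nbhd B j (map f c)"
      then have "y \<in> f ` nbhd B s a" using 2 f by (auto simp: sphere_iso_def bij_betw_def)
      then have "f (?g y) = y" by (rule f_inv_into_f)
      moreover have "?g y \<in> nbhd B j c" using 1 y by auto
      ultimately show "y \<in> f ` nbhd B j c" by force
    qed
  qed
  then have "f ` nbhd B j c = nbhd B j (map f c)"
    using sphere_iso_image_subset[OF B f a c ij] by auto
  then have "bij_betw f (nbhd B j c) (nbhd B j (map f c))"
    using inj_on_subset[OF inj cs] by (auto simp: bij_betw_def)
  moreover have "t \<in> rels B i \<longleftrightarrow> map f t \<in> rels B i" if "set t \<subseteq> nbhd B j c" for t i
    using f cs that by (simp add: sphere_iso_def)
  ultimately show ?thesis by (simp add: sphere_iso_def)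
qed

lemma sim_mono:
  assumes "is_struct \<sigma> B" "set a \<subseteq> univ B" "sim B s a b" "s' \<le> s"
  shows "sim B s' a b"
proof -
  obtain f where f: "sphere_iso B s f a b" using assms sim_iff_sphere_iso by blast
  have "sphere_iso B s' f a (map f a)"
    using sphere_iso_restrict[OF assms(1) f assms(2), of a 0 s'] nbhd_center assms by auto
  moreover have "map f a = b" using f by (auto simp: sphere_iso_def)
  ultimately show ?thesis using sim_iff_sphere_iso by metis
qed

lemma sphere_iso_reindex:
  assumes B: "is_struct \<sigma> B" and f: "sphere_iso B s f a b" and a: "set a \<subseteq> univ B"
    and "set is \<subseteq> {..<length a}"
  shows "sphere_iso B s f (map ((!) a) is) (map ((!) b) is)"
proof -
  have "set (map ((!) a) is) \<subseteq> nbhd B 0 a"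
    unfolding nbhd_0[OF a] using assms(4) by auto
  from sphere_iso_restrict[OF B f a this, of s] have "sphere_iso B s f (map ((!) a) is) (map f (map ((!) a) is))"
    by simp
  moreover have "map f (map ((!) a) is) = map ((!) b) is"
    using f assms(4) by (auto simp: sphere_iso_def)
  ultimately show ?thesis by (simp only:)
qed

lemma sim_reindex:
  assumes "is_struct \<sigma> B" "sim B s a b" "set a \<subseteq> univ B" "set is \<subseteq> {..<length a}"
  shows "sim B s (map ((!) a) is) (map ((!) b) is)"
proof -
  obtain f where "sphere_iso B s f a b" using assms(2) sim_iff_sphere_iso by blast
  from sphere_iso_reindex[OF assms(1) this assms(3,4)] show ?thesis using sim_iff_sphere_iso by blast
qed

section \<open>Gluing spheres that are far apart\<close>

lemma far_tuple:
  assumes B: "is_struct \<sigma> B" and a: "set a \<subseteq> univ B" and c: "set c \<subseteq> univ B"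
    and far: "set c \<inter> nbhd B (2 * R + 1) a = {}"
    and t: "t \<in> rels B i" "x \<in> set t" "x \<in> nbhd B R a" "y \<in> set t" "y \<in> nbhd B R c"
  shows False
proof -
  have "y \<in> nbhd B (Suc R) a" using nbhd_tuple[OF B t(1-3)] t(4) by auto
  moreover obtain z where z: "z \<in> set c" "y \<in> nbhd B R [z]" using t(5) nbhd_iff_single by metis
  then have "z \<in> nbhd B R [y]" using nbhd_sym c by fastforce
  ultimately have "z \<in> nbhd B (Suc R + R) a" using nbhd_trans[of "[y]" B "Suc R" a R] by auto
  then show False using far z by (auto simp: mult_2)
qed

lemma far_disjoint:
  assumes a: "set a \<subseteq> univ B" and c: "set c \<subseteq> univ B"
    and far: "set c \<inter> nbhd B (2 * R + 1) a = {}"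
  shows "nbhd B R a \<inter> nbhd B R c = {}"
proof (rule equals0I)
  fix y assume y: "y \<in> nbhd B R a \<inter> nbhd B R c"
  then obtain z where z: "z \<in> set c" "y \<in> nbhd B R [z]" using nbhd_iff_single by (metis IntE)
  then have "z \<in> nbhd B R [y]" using nbhd_sym c by fastforce
  then have "z \<in> nbhd B (R + R) a" using nbhd_trans[of "[y]" B R a R] y by auto
  then have "z \<in> nbhd B (2 * R + 1) a" using nbhd_mono[of "R + R" "2 * R + 1" a a] by auto
  then show False using far z by auto
qed

text \<open>No tuple meets both balls: it would give a walk of \<open>R\<close> steps, one step
  inside the tuple and again \<open>R\<close> steps, which is the origin of
  \<open>2 * R + 1\<close>. So each tuple is handled by one of the two maps. Distance is required on
  both sides because the glued map must not create tuples either.\<close>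

lemma sphere_iso_far_union:
  assumes B: "is_struct \<sigma> B" and a: "set a \<subseteq> univ B" and c: "set c \<subseteq> univ B"
    and f: "sphere_iso B R f a b" and g: "sphere_iso B R g c d"
    and fac: "set c \<inter> nbhd B (2 * R + 1) a = {}"
    and fbd: "set d \<inter> nbhd B (2 * R + 1) b = {}"
  shows "sphere_iso B R (\<lambda>x. if x \<in> nbhd B R a then f x else g x) (a @ c) (b @ d)"
proof -
  let ?h = "\<lambda>x. if x \<in> nbhd B R a then f x else g x"
  have b: "set b \<subseteq> univ B" and d: "set d \<subseteq> univ B"
    using sphere_iso_in_univ[OF f a] sphere_iso_in_univ[OF g c] by auto
  note dac = far_disjoint[OF a c fac] and dbd = far_disjoint[OF b d fbd]
  have hc: "?h x = g x" if "x \<in> nbhd B R c" for x using that dac by auto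
  have bf: "bij_betw ?h (nbhd B R a) (nbhd B R b)"
    using f bij_betw_cong[of "nbhd B R a" ?h f] by (auto simp: sphere_iso_def)
  have bg: "bij_betw ?h (nbhd B R c) (nbhd B R d)"
    using g bij_betw_cong[of "nbhd B R c" ?h g] hc by (auto simp: sphere_iso_def)
  have bij: "bij_betw ?h (nbhd B R (a @ c)) (nbhd B R (b @ d))"
    unfolding nbhd_append by (rule bij_betw_combine[OF bf bg dbd])
  have ma: "map ?h t = map f t" if "set t \<subseteq> nbhd B R a" for t using that by (auto simp: subset_iff)
  have mc: "map ?h t = map g t" if "set t \<subseteq> nbhd B R c" for t using that hc by (simp add: subset_iff)
  have "t \<in> rels B i \<longleftrightarrow> map ?h t \<in> rels B i" if t: "set t \<subseteq> nbhd B R (a @ c)" for t i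
  proof -
    consider "set t \<subseteq> nbhd B R a" | "set t \<subseteq> nbhd B R c"
      | x y where "x \<in> set t" "x \<in> nbhd B R a" "y \<in> set t" "y \<in> nbhd B R c"
      using t unfolding nbhd_append by blast
    then show ?thesis
    proof cases
      case 1
      then show ?thesis unfolding ma[OF 1] using f by (simp add: sphere_iso_def)
    next
      case 2
      then show ?thesis unfolding mc[OF 2] using g by (simp add: sphere_iso_def)
    next
      case 3
      have "t \<notin> rels B i" using far_tuple[OF B a c fac] 3 by blast
      moreover have "map ?h t \<notin> rels B i"
      proof
        assume *: "map ?h t \<in> rels B i"
        have "?h x \<in> nbhd B R b" "?h y \<in> nbhd B R d" using 3 bf bg bij_betwE by blast+
        moreover have "?h x \<in> set (map ?h t)" "?h y \<in> set (map ?h t)" using 3 by auto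
        ultimately show False using far_tuple[OF B b d fbd *] by blast
      qed
      ultimately show ?thesis by simp
    qed
  qed
  moreover have "map ?h (a @ c) = b @ d"
    unfolding map_append ma[OF nbhd_center[OF a]] mc[OF nbhd_center[OF c]] using f g by (simp add: sphere_iso_def)
  ultimately show ?thesis using bij unfolding sphere_iso_def by blast
qed

lemma sim_far_union:
  assumes "is_struct \<sigma> B" "set a \<subseteq> univ B" "set c \<subseteq> univ B"
    and "sim B R a b" "sim B R c d"
    and "set c \<inter> nbhd B (2 * R + 1) a = {}" "set d \<inter> nbhd B (2 * R + 1) b = {}"
  shows "sim B R (a @ c) (b @ d)"
proof -
  obtain f g where "sphere_iso B R f a b" "sphere_iso B R g c d" using assms(4,5) sim_iff_sphere_iso by blast
  from sphere_iso_far_union[OF assms(1-3) this assms(6,7)] show ?thesis using sim_iff_sphere_iso by blast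
qed

section \<open>Counting tuples around isomorphic spheres\<close>

definition same_close :: "'a struct \<Rightarrow> nat \<Rightarrow> 'a list \<Rightarrow> 'a list \<Rightarrow> bool" where
  "same_close B q x y \<longleftrightarrow> (\<forall>i < length x. \<forall>j < length x.
     x ! j \<in> nbhd B q [x ! i] \<longleftrightarrow> y ! j \<in> nbhd B q [y ! i])"

text \<open>An isomorphism of \<open>R\<close>-spheres need not preserve closeness up to distance \<open>2 * R + 1\<close>: a tuple of
  arity at least 3 that witnesses the middle edge of a path may leave both spheres. Gluing isomorphisms
  of far apart spheres needs exactly this bound, so it is recorded separately.\<close>

definition close_sim :: "'a struct \<Rightarrow> nat \<Rightarrow> 'a list \<Rightarrow> 'a list \<Rightarrow> bool" where
  "close_sim B R x y \<longleftrightarrow> sim B R x y \<and> same_close B (2 * R + 1) x y"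

lemma sim_univ:
  assumes "sim B R x y" "set x \<subseteq> univ B"
  shows "set y \<subseteq> univ B"
  using assms sim_iff_sphere_iso[of B R x y] sphere_iso_in_univ[OF _ assms(2)] by blast

lemma close_sim_refl: "close_sim B R x x"
  by (simp add: close_sim_def same_close_def iso_refl)

lemma close_sim_sym:
  assumes "close_sim B R x y" "set x \<subseteq> univ B"
  shows "close_sim B R y x"
proof -
  have "length x = length y" using assms sim_length by (auto simp: close_sim_def)
  then show ?thesis using assms sim_sym[of B R x y] by (simp add: close_sim_def same_close_def)
qed

lemma close_sim_trans:
  assumes "close_sim B R x y" "close_sim B R y z"
  shows "close_sim B R x z"
proof -
  have "length x = length y" using assms sim_length by (auto simp: close_sim_def)
  moreover have "sim B R x z"
    using iso_trans[of "sphere B R x" "sphere B R y" "sphere B R z"] assms by (simp add: close_sim_def)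
  ultimately show ?thesis using assms by (simp add: close_sim_def same_close_def)
qed

lemma close_sim_reindex:
  assumes "is_struct \<sigma> B" "close_sim B R x y" "set x \<subseteq> univ B" "set is \<subseteq> {..<length x}"
  shows "close_sim B R (map ((!) x) is) (map ((!) y) is)"
proof -
  have "is ! i < length x" if "i < length is" for i using that assms(4) nth_mem by blast
  then have "same_close B (2 * R + 1) (map ((!) x) is) (map ((!) y) is)"
    using assms(2) by (simp add: close_sim_def same_close_def)
  then show ?thesis using assms sim_reindex[OF assms(1) _ assms(3,4)] by (simp add: close_sim_def)
qed

text \<open>Since \<open>q \<le> s\<close>, the whole \<open>q\<close>-ball of a center lies in the
  sphere and is mapped onto the \<open>q\<close>-ball of the image; injectivity turns this into an
  equivalence.\<close>

lemma sphere_iso_near_iff: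
  assumes "is_struct \<sigma> B" "sphere_iso B s f a b" "set a \<subseteq> univ B" "q \<le> s"
    and x: "x \<in> nbhd B s a" and i: "i < length a"
  shows "x \<in> nbhd B q [a ! i] \<longleftrightarrow> f x \<in> nbhd B q [b ! i]"
proof -
  have fi: "f (a ! i) = b ! i" using assms(2) i by (auto simp: sphere_iso_def)
  have sub: "set [a ! i] \<subseteq> nbhd B 0 a" unfolding nbhd_0[OF assms(3)] using i by simp
  have p: "sphere_iso B q f [a ! i] [b ! i]"
    using sphere_iso_restrict[OF assms(1-3) sub, of q] fi assms(4) by simp
  have inj: "inj_on f (nbhd B s a)" using assms(2) by (auto simp: sphere_iso_def bij_betw_def)
  have "nbhd B q [a ! i] \<subseteq> nbhd B s a"
    using nbhd_trans[OF sub, of q] nbhd_mono[OF assms(4), of a a B] by auto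
  then show ?thesis
    using p x inj inj_on_image_mem_iff[OF inj x, of "nbhd B q [a ! i]"]
    by (simp add: sphere_iso_def bij_betw_def)
qed

lemma same_close_of_sphere_iso:
  assumes "is_struct \<sigma> B" "sphere_iso B s f a b" "set a \<subseteq> univ B" "q \<le> s"
  shows "same_close B q a b"
  unfolding same_close_def
proof (intro allI impI)
  fix i j assume ij: "i < length a" "j < length a"
  have "a ! j \<in> nbhd B s a" using nbhd_center[OF assms(3), of s] ij(2) nth_mem by blast
  moreover have "f (a ! j) = b ! j" using assms(2) ij by (auto simp: sphere_iso_def)
  ultimately show "a ! j \<in> nbhd B q [a ! i] \<longleftrightarrow> b ! j \<in> nbhd B q [b ! i]"
    using sphere_iso_near_iff[OF assms(1-4) _ ij(1)] by metis
qed

lemma nbhd_single_commute: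
  assumes "x \<in> univ B" "y \<in> univ B"
  shows "y \<in> nbhd B q [x] \<longleftrightarrow> x \<in> nbhd B q [y]"
  using assms nbhd_sym by metis

text \<open>Mixed pairs are required in one order only; the other order follows from the symmetry of
  distance.\<close>

lemma same_close_append:
  assumes u: "set (a @ c) \<subseteq> univ B" "set (b @ d) \<subseteq> univ B"
    and l: "length a = length b" "length c = length d"
    and m: "same_close B q a b" "same_close B q c d"
    and x: "\<And>i j. i < length a \<Longrightarrow> j < length c \<Longrightarrow> c ! j \<in> nbhd B q [a ! i] \<longleftrightarrow> d ! j \<in> nbhd B q [b ! i]"
  shows "same_close B q (a @ c) (b @ d)"
  unfolding same_close_def
proof (intro allI impI)
  fix i j assume i: "i < length (a @ c)" and j: "j < length (a @ c)"
  show "(a @ c) ! j \<in> nbhd B q [(a @ c) ! i] \<longleftrightarrow> (b @ d) ! j \<in> nbhd B q [(b @ d) ! i]"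
  proof (cases "i < length a"; cases "j < length a")
    assume "i < length a" "j < length a"
    then show ?thesis using m(1) l by (simp add: same_close_def nth_append)
  next
    assume "i < length a" "\<not> j < length a"
    then show ?thesis using x[of i "j - length a"] j l by (simp add: nth_append)
  next
    assume ij: "\<not> i < length a" "j < length a"
    have U: "(a @ c) ! i \<in> univ B" "(a @ c) ! j \<in> univ B" "(b @ d) ! i \<in> univ B" "(b @ d) ! j \<in> univ B"
      using u i j l nth_mem[of _ "a @ c"] nth_mem[of _ "b @ d"] by (metis length_append subset_iff)+
    show ?thesis using x[of j "i - length a"] i ij l
      unfolding nbhd_single_commute[OF U(1,2)] nbhd_single_commute[OF U(3,4)]
      by (simp add: nth_append)
  next
    assume "\<not> i < length a" "\<not> j < length a"
    then show ?thesis using m(2) i j l by (simp add: same_close_def nth_append)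
  qed
qed

text \<open>An element at distance at most \<open>q\<close> can become a new center at the price of
  \<open>q\<close>: the \<open>s\<close>-sphere of the longer tuple is still inside the domain of
  \<open>f\<close>.\<close>

lemma sphere_iso_extend:
  assumes B: "is_struct \<sigma> B" and f: "sphere_iso B (q + s) f a b" and a: "set a \<subseteq> univ B"
    and x: "x \<in> nbhd B q a"
  shows "sim B s (a @ [x]) (b @ [f x])" "same_close B q (a @ [x]) (b @ [f x])"
proof -
  have b: "set b \<subseteq> univ B" using sphere_iso_in_univ[OF f a] .
  have sub: "set (a @ [x]) \<subseteq> nbhd B q a" using nbhd_center[OF a, of q] x by simp
  have fa: "map f a = b" using f by (simp add: sphere_iso_def)
  have "sphere_iso B s f (a @ [x]) (b @ [f x])"
    using sphere_iso_restrict[OF B f a sub, of s] fa by simp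
  then show "sim B s (a @ [x]) (b @ [f x])" unfolding sim_iff_sphere_iso by blast
  have xs: "x \<in> nbhd B (q + s) a" using x nbhd_mono[of q "q + s" a a B] by auto
  have "f x \<in> nbhd B (q + s) b" using f xs by (auto simp: sphere_iso_def bij_betw_def)
  then have fx: "f x \<in> univ B" using nbhd_univ by fast
  have xu: "x \<in> univ B" using x nbhd_univ by fast
  show "same_close B q (a @ [x]) (b @ [f x])"
  proof (rule same_close_append)
    show "same_close B q a b" using same_close_of_sphere_iso[OF B f a] by simp
    show "same_close B q [x] [f x]"
      using nbhd_center[of "[x]" B q] nbhd_center[of "[f x]" B q] xu fx by (simp add: same_close_def)
    fix i j assume "i < length a" "j < length [x]"
    then show "[x] ! j \<in> nbhd B q [a ! i] \<longleftrightarrow> [f x] ! j \<in> nbhd B q [b ! i]"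
      using sphere_iso_near_iff[OF B f a _ xs, of q i] by simp
  qed (use a b xu fx fa in auto)
qed

abbreviation tuples :: "'a struct \<Rightarrow> nat \<Rightarrow> 'a list set" where
  "tuples B w \<equiv> {c. length c = w \<and> set c \<subseteq> univ B}"

lemma finite_tuples: "is_struct \<sigma> B \<Longrightarrow> finite (tuples B w)"
  using finite_lists_length_eq[of "univ B" w] by (simp add: is_struct_def conj_commute)

lemma finite_tuples_Collect: "is_struct \<sigma> B \<Longrightarrow> finite {c \<in> tuples B w. p c}"
  by (rule finite_subset[OF _ finite_tuples[of \<sigma> B w]]) auto

text \<open>Sum over the classes of \<open>r\<close>. If a class meets both sides, \<open>P\<close>
  and \<open>P'\<close> are constant on it with the same value, so it contributes everything or
  nothing on both sides; if it misses one side, it misses the other by the equality of the class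
  sizes.\<close>

lemma card_eq_by_classes:
  assumes X: "finite X" "A \<subseteq> X" "A' \<subseteq> X"
    and r: "\<And>c. c \<in> X \<Longrightarrow> r c c" "\<And>c d. c \<in> X \<Longrightarrow> d \<in> X \<Longrightarrow> r c d \<Longrightarrow> r d c"
      "\<And>c d e. r c d \<Longrightarrow> r d e \<Longrightarrow> r c e"
    and eq: "\<And>c0. c0 \<in> X \<Longrightarrow> card {c \<in> A. r c c0} = card {c \<in> A'. r c c0}"
    and P: "\<And>c d. c \<in> A \<Longrightarrow> d \<in> A' \<Longrightarrow> r c d \<Longrightarrow> P c \<longleftrightarrow> P' d"
  shows "card {c \<in> A. P c} = card {c \<in> A'. P' c}"
proof -
  \<comment> \<open>A class is represented by the set of its members in \<open>X\<close>, so that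
    sums can be grouped by the value of a function.\<close>
  let ?key = "\<lambda>c. {d \<in> X. r c d}"
  have key: "?key c = ?key d \<longleftrightarrow> r c d" if "c \<in> X" "d \<in> X" for c d
    using that r by blast
  have split: "card {c \<in> D. p c} = (\<Sum>K \<in> ?key ` X. card {c \<in> {c \<in> D. p c}. ?key c = K})"
    if "D \<subseteq> X" for D p
  proof -
    have "finite {c \<in> D. p c}" using X(1) that finite_subset by fastforce
    then have "(\<Sum>K \<in> ?key ` X. \<Sum>c \<in> {c \<in> {c \<in> D. p c}. ?key c = K}. 1::nat) = (\<Sum>c \<in> {c \<in> D. p c}. 1)"
      using X(1) that by (intro sum.group) auto
    then show ?thesis by simp
  qed
  have "card {c \<in> {c \<in> A. P c}. ?key c = K} = card {c \<in> {c \<in> A'. P' c}. ?key c = K}"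
    if K: "K \<in> ?key ` X" for K
  proof -
    obtain c0 where c0: "c0 \<in> X" "K = ?key c0" using K by auto
    have e: "{c \<in> {c \<in> D. p c}. ?key c = K} = {c \<in> D. r c c0 \<and> p c}" if "D \<subseteq> X" for D p
      using key c0 that by auto
    have fin: "finite {c \<in> D. r c c0}" if "D \<subseteq> X" for D
      using X(1) that finite_subset by fastforce
    show ?thesis
    proof (cases "{c \<in> A. r c c0} = {}")
      case True
      then have "card {c \<in> A'. r c c0} = 0" using eq[OF c0(1)] by (metis card.empty)
      then have "{c \<in> A'. r c c0} = {}" using fin[OF X(3)] by (metis card_0_eq)
      then show ?thesis unfolding e[OF X(2)] e[OF X(3)] using True by (metis (no_types, lifting) empty_Collect_eq)
    next
      case False
      then have "card {c \<in> A. r c c0} \<noteq> 0" using fin[OF X(2)] by (metis card_0_eq)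
      then have "card {c \<in> A'. r c c0} \<noteq> 0" using eq[OF c0(1)] by simp
      then have "{c \<in> A'. r c c0} \<noteq> {}" by (metis card.empty)
      then obtain d where d: "d \<in> A'" "r d c0" by auto
      from False obtain c where c: "c \<in> A" "r c c0" by auto
      have rr: "r x y" if "x \<in> X" "y \<in> X" "r x c0" "r y c0" for x y
        using that r c0(1) by blast
      have "P x \<longleftrightarrow> P c" if "x \<in> A" "r x c0" for x
        using P[OF that(1) d(1) rr] P[OF c(1) d(1) rr] X that d c by blast
      then have 1: "{x \<in> A. r x c0 \<and> P x} = (if P c then {x \<in> A. r x c0} else {})" by auto
      have "P' y \<longleftrightarrow> P c" if "y \<in> A'" "r y c0" for y
        using P[OF c(1) that(1) rr] X that c by blast
      then have 2: "{x \<in> A'. r x c0 \<and> P' x} = (if P c then {x \<in> A'. r x c0} else {})" by auto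
      show ?thesis unfolding e[OF X(2)] e[OF X(3)] 1 2 using eq[OF c0(1)] by simp
    qed
  qed
  then show ?thesis unfolding split[OF X(2)] split[OF X(3)] by (intro sum.cong) auto
qed

lemma map_nth_upt: "n \<le> length z \<Longrightarrow> map ((!) z) [m..<n] = drop m (take n z)"
  by (intro nth_equalityI) auto

text \<open>A tuple \<open>c\<close> with an entry close to \<open>a\<close> is treated by moving its first such entry into the center,
  which consumes \<open>2 * R + 1\<close> of the radius. For the other tuples only the class of \<open>c\<close> alone matters;
  there are as many of them in each class around \<open>a\<close> as around \<open>b\<close>, because the whole class is the
  same on both sides and its close members were already counted.\<close>

lemma hanf_count:
  fixes B :: "'a struct"
  assumes B: "is_struct \<sigma> B"
  shows "set a \<subseteq> univ B \<Longrightarrow> sim B (R + w * (2 * R + 1)) a b \<Longrightarrow> same_close B (2 * R + 1) a b \<Longrightarrow>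
    (\<And>x y. length x = length a + w \<Longrightarrow> set x \<subseteq> univ B \<Longrightarrow> close_sim B R x y \<Longrightarrow> Q x = Q y) \<Longrightarrow>
    card {c \<in> tuples B w. Q (a @ c)} = card {c \<in> tuples B w. Q (b @ c)}"
proof (induction w arbitrary: a b Q)
  case 0
  then have "Q a = Q b" by (simp add: close_sim_def)
  moreover have "{c \<in> tuples B 0. Q (z @ c)} = (if Q z then {[]} else {})" for z by auto
  ultimately show ?case by simp
next
  case (Suc w)
  let ?q = "2 * R + 1"
  let ?m = "length a"
  note a = Suc.prems(1)
  \<comment> \<open>The radius for \<open>Suc w\<close> is split into \<open>?q\<close>, which
    reaches one near entry, and the radius needed by the induction hypothesis.\<close>
  obtain f where f: "sphere_iso B (?q + (R + w * ?q)) f a b"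
    using Suc.prems(2) sim_iff_sphere_iso[of B "?q + (R + w * ?q)" a b] by (auto simp: algebra_simps)
  have b: "set b \<subseteq> univ B" using sphere_iso_in_univ[OF f a] .
  have lab: "length b = ?m" using Suc.prems(2) sim_length by metis
  have bijq: "bij_betw f (nbhd B ?q a) (nbhd B ?q b)"
    using sphere_iso_restrict[OF B f a, of a 0 ?q] nbhd_center[OF a, of 0] f by (auto simp: sphere_iso_def)
  \<comment> \<open>Stated for every invariant predicate, because it is used twice: for the given
    \<open>Q\<close>, and for the membership in one class, which ignores the first \<open>?m\<close>
    entries.\<close>
  have near: "card {c \<in> tuples B (Suc w). set c \<inter> nbhd B ?q a \<noteq> {} \<and> Q (a @ c)} =
      card {c \<in> tuples B (Suc w). set c \<inter> nbhd B ?q b \<noteq> {} \<and> Q (b @ c)}"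
    if Q: "\<And>x y. length x = ?m + Suc w \<Longrightarrow> set x \<subseteq> univ B \<Longrightarrow> close_sim B R x y \<Longrightarrow> Q x = Q y" for Q
  proof -
    \<comment> \<open>Splitting by the position \<open>i\<close> of the first near entry avoids
      counting a tuple twice. In \<open>?Q\<close> this entry has become the last center of
      \<open>z\<close>; \<open>?\<pi> i\<close> puts it back to position \<open>i\<close>, and the
      extra condition says that the \<open>i\<close> entries before it are far.\<close>
    let ?D = "\<lambda>a i. {c \<in> tuples B (Suc w). c ! i \<in> nbhd B ?q a \<and> (\<forall>j<i. c ! j \<notin> nbhd B ?q a) \<and> Q (a @ c)}"
    let ?\<pi> = "\<lambda>i. [0..<?m] @ [?m + 1..<?m + 1 + i] @ [?m] @ [?m + 1 + i..<?m + 1 + w]"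
    let ?Q = "\<lambda>i z. Q (map ((!) z) (?\<pi> i)) \<and> (\<forall>j<i. \<forall>p<?m. z ! (?m + 1 + j) \<notin> nbhd B ?q [z ! p])"
    have cardD: "card (?D e i) = (\<Sum>x\<in>nbhd B ?q e. card {r \<in> tuples B w. ?Q i ((e @ [x]) @ r)})"
      if e: "length e = ?m" "set e \<subseteq> univ B" and i: "i < Suc w" for e i
    proof -
      let ?S = "SIGMA x : nbhd B ?q e. {r \<in> tuples B w. ?Q i ((e @ [x]) @ r)}"
      have perm: "map ((!) ((e @ [x]) @ r)) (?\<pi> i) = e @ take i r @ x # drop i r"
        if "length r = w" for x r
        using that e i by (simp add: map_nth_upt del: upt_Suc) (simp add: nth_append)
      have far: "(\<forall>p<?m. z \<notin> nbhd B ?q [e ! p]) \<longleftrightarrow> z \<notin> nbhd B ?q e" for z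
        unfolding nbhd_iff_single[of z B ?q e] using e(1) by (metis in_set_conv_nth)
      have cond: "?Q i ((e @ [x]) @ r) \<longleftrightarrow> Q (e @ take i r @ x # drop i r) \<and> (\<forall>j<i. r ! j \<notin> nbhd B ?q e)"
        if r: "length r = w" for x r
      proof -
        have "((e @ [x]) @ r) ! (?m + 1 + j) = r ! j" for j using e(1) by (simp add: nth_append)
        moreover have "((e @ [x]) @ r) ! p = e ! p" if "p < ?m" for p
          using e(1) that by (simp add: nth_append)
        ultimately show ?thesis unfolding perm[OF r] using far by auto
      qed
      have glue: "take i (take i c @ drop (Suc i) c) @ c ! i # drop i (take i c @ drop (Suc i) c) = c"
        if "length c = Suc w" for c :: "'a list"
      proof -
        have "take i (take i c @ drop (Suc i) c) = take i c" "drop i (take i c @ drop (Suc i) c) = drop (Suc i) c"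
          using that i by simp_all
        then show ?thesis using id_take_nth_drop[of i c] that i by simp
      qed
      have "bij_betw (\<lambda>(x, r). take i r @ x # drop i r) ?S (?D e i)"
      proof (rule bij_betw_byWitness[where f' = "\<lambda>c. (c ! i, take i c @ drop (Suc i) c)"])
        show "\<forall>p\<in>?S. (\<lambda>c. (c ! i, take i c @ drop (Suc i) c)) ((\<lambda>(x, r). take i r @ x # drop i r) p) = p"
          using i by (auto simp: nth_append min_def)
        show "\<forall>c\<in>?D e i. (\<lambda>(x, r). take i r @ x # drop i r) (c ! i, take i c @ drop (Suc i) c) = c"
          using glue by auto
        show "(\<lambda>(x, r). take i r @ x # drop i r) ` ?S \<subseteq> ?D e i"
        proof
          fix c assume "c \<in> (\<lambda>(x, r). take i r @ x # drop i r) ` ?S"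
          then obtain x r where c: "c = take i r @ x # drop i r" "x \<in> nbhd B ?q e"
            "length r = w" "set r \<subseteq> univ B" "?Q i ((e @ [x]) @ r)" by auto
          have "x \<in> univ B" using c(2) nbhd_univ by fast
          then have "set c \<subseteq> univ B"
            using c(1,4) set_take_subset[of i r] set_drop_subset[of i r] by auto
          moreover have "c ! i = x" "\<And>j. j < i \<Longrightarrow> c ! j = r ! j" "length c = Suc w"
            using c(1,3) i by (auto simp: nth_append)
          ultimately show "c \<in> ?D e i" using c cond[OF c(3), of x] by auto
        qed
        show "(\<lambda>c. (c ! i, take i c @ drop (Suc i) c)) ` ?D e i \<subseteq> ?S"
        proof
          fix p assume "p \<in> (\<lambda>c. (c ! i, take i c @ drop (Suc i) c)) ` ?D e i"
          then obtain c where c: "p = (c ! i, take i c @ drop (Suc i) c)" "c \<in> ?D e i" by auto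
          let ?r = "take i c @ drop (Suc i) c"
          have r: "length ?r = w" using c(2) i by auto
          have "set ?r \<subseteq> univ B" using c(2) set_take_subset[of i c] set_drop_subset[of "Suc i" c] by auto
          moreover have "take i ?r @ c ! i # drop i ?r = c"
            using c(2) glue by auto
          moreover have "\<And>j. j < i \<Longrightarrow> ?r ! j = c ! j" using c(2) i by (auto simp: nth_append)
          ultimately show "p \<in> ?S" using c r cond[OF r, of "c ! i"] by auto
        qed
      qed
      then have "card (?D e i) = card ?S" by (rule bij_betw_same_card[symmetric])
      also have "\<dots> = (\<Sum>x\<in>nbhd B ?q e. card {r \<in> tuples B w. ?Q i ((e @ [x]) @ r)})"
        by (intro card_SigmaI ballI finite_nbhd[OF B] finite_tuples_Collect[OF B])
      finally show ?thesis .
    qed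
    have cardN: "card {c \<in> tuples B (Suc w). set c \<inter> nbhd B ?q e \<noteq> {} \<and> Q (e @ c)} = (\<Sum>i<Suc w. card (?D e i))"
      for e
    proof -
      have "{c \<in> tuples B (Suc w). set c \<inter> nbhd B ?q e \<noteq> {} \<and> Q (e @ c)} = (\<Union>i<Suc w. ?D e i)"
      proof (intro equalityI subsetI)
        fix c assume c: "c \<in> {c \<in> tuples B (Suc w). set c \<inter> nbhd B ?q e \<noteq> {} \<and> Q (e @ c)}"
        then obtain i0 where "i0 < Suc w" "c ! i0 \<in> nbhd B ?q e" by (auto simp: in_set_conv_nth)
        then have "\<exists>i. i < Suc w \<and> c ! i \<in> nbhd B ?q e \<and> (\<forall>j<i. c ! j \<notin> nbhd B ?q e)"
          using exists_least_iff[of "\<lambda>i. i < Suc w \<and> c ! i \<in> nbhd B ?q e"] by (meson less_trans)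
        then show "c \<in> (\<Union>i<Suc w. ?D e i)" using c by auto
      next
        fix c assume "c \<in> (\<Union>i<Suc w. ?D e i)"
        then obtain i where i: "i < Suc w" "c \<in> ?D e i" by blast
        then have "c ! i \<in> set c" by simp
        then have "set c \<inter> nbhd B ?q e \<noteq> {}" using i(2) by blast
        then show "c \<in> {c \<in> tuples B (Suc w). set c \<inter> nbhd B ?q e \<noteq> {} \<and> Q (e @ c)}"
          using i(2) by blast
      qed
      moreover have "card (\<Union>i<Suc w. ?D e i) = (\<Sum>i<Suc w. card (?D e i))"
      proof (rule card_UN_disjoint)
        show "\<forall>i\<in>{..<Suc w}. \<forall>j\<in>{..<Suc w}. i \<noteq> j \<longrightarrow> ?D e i \<inter> ?D e j = {}"
        proof (intro ballI impI)
          fix i j :: nat assume "i \<noteq> j"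
          then consider "i < j" | "j < i" by linarith
          then show "?D e i \<inter> ?D e j = {}" by cases auto
        qed
      qed (intro ballI finite_tuples_Collect[OF B] finite_lessThan)+
      ultimately show ?thesis by simp
    qed
    have "card (?D a i) = card (?D b i)" if i: "i < Suc w" for i
    proof -
      have "card {r \<in> tuples B w. ?Q i ((a @ [x]) @ r)} = card {r \<in> tuples B w. ?Q i ((b @ [f x]) @ r)}"
        if x: "x \<in> nbhd B ?q a" for x
      proof (rule Suc.IH)
        show "set (a @ [x]) \<subseteq> univ B" using a x nbhd_univ[of B ?q a] by auto
        show "sim B (R + w * ?q) (a @ [x]) (b @ [f x])" "same_close B ?q (a @ [x]) (b @ [f x])"
          using sphere_iso_extend[OF B f a x] .
        fix z z' assume z: "length z = length (a @ [x]) + w" "set z \<subseteq> univ B" "close_sim B R z z'"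
        have "set (?\<pi> i) \<subseteq> {..<length z}" using z(1) i by auto
        from close_sim_reindex[OF B z(3,2) this]
        have "Q (map ((!) z) (?\<pi> i)) = Q (map ((!) z') (?\<pi> i))"
        proof (rule Q[rotated 2])
          show "set (map ((!) z) (?\<pi> i)) \<subseteq> univ B"
            using \<open>set (?\<pi> i) \<subseteq> {..<length z}\<close> z(2) nth_mem[of _ z]
            by (simp only: set_map image_subset_iff subset_iff lessThan_iff) blast
        qed (use i in \<open>simp del: upt_Suc\<close>)
        \<comment> \<open>Farness from the old centers is invariant because \<open>close_sim\<close>
          records closeness at distance \<open>?q\<close>.\<close>
        moreover have "z ! (?m + 1 + j) \<in> nbhd B ?q [z ! p] \<longleftrightarrow> z' ! (?m + 1 + j) \<in> nbhd B ?q [z' ! p]"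
          if "j < i" "p < ?m" for j p
          using z(1,3) that i by (simp add: close_sim_def same_close_def)
        ultimately show "?Q i z = ?Q i z'" by blast
      qed
      then have "(\<Sum>x\<in>nbhd B ?q a. card {r \<in> tuples B w. ?Q i ((a @ [x]) @ r)}) =
          (\<Sum>x\<in>nbhd B ?q a. card {r \<in> tuples B w. ?Q i ((b @ [f x]) @ r)})" by (intro sum.cong) auto
      also have "\<dots> = (\<Sum>x\<in>nbhd B ?q b. card {r \<in> tuples B w. ?Q i ((b @ [x]) @ r)})"
        by (rule sum.reindex_bij_betw[OF bijq])
      finally show ?thesis unfolding cardD[OF refl a i] cardD[OF lab b i] .
    qed
    then show ?thesis unfolding cardN by (intro sum.cong) auto
  qed
  let ?far = "\<lambda>a. {c \<in> tuples B (Suc w). set c \<inter> nbhd B ?q a = {}}"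
  have split: "card {c \<in> tuples B (Suc w). p c} =
      card {c \<in> tuples B (Suc w). set c \<inter> nbhd B ?q e \<noteq> {} \<and> p c} + card {c \<in> ?far e. p c}" for e p
  proof -
    let ?A = "{c \<in> tuples B (Suc w). set c \<inter> nbhd B ?q e \<noteq> {} \<and> p c}" and ?D = "{c \<in> ?far e. p c}"
    have fin: "finite D" if "D \<subseteq> tuples B (Suc w)" for D
      by (rule finite_subset[OF that finite_tuples[OF B]])
    have "{c \<in> tuples B (Suc w). p c} = ?A \<union> ?D" by blast
    moreover have "card (?A \<union> ?D) = card ?A + card ?D"
      by (intro card_Un_disjoint fin) blast+
    ultimately show ?thesis by (simp only:)
  qed
  have farclass: "card {c \<in> ?far a. close_sim B R c c0} = card {c \<in> ?far b. close_sim B R c c0}"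
    if c0: "c0 \<in> tuples B (Suc w)" for c0
  proof -
    have "card {c \<in> tuples B (Suc w). set c \<inter> nbhd B ?q a \<noteq> {} \<and> close_sim B R (drop ?m (a @ c)) c0} =
        card {c \<in> tuples B (Suc w). set c \<inter> nbhd B ?q b \<noteq> {} \<and> close_sim B R (drop ?m (b @ c)) c0}"
    proof (rule near)
      fix x y assume x: "length x = ?m + Suc w" "set x \<subseteq> univ B" "close_sim B R x y"
      have y: "length y = length x" using x(3) sim_length by (metis close_sim_def)
      have "close_sim B R (map ((!) x) [?m..<length x]) (map ((!) y) [?m..<length x])"
        using x by (intro close_sim_reindex[OF B]) auto
      then have e: "close_sim B R (drop ?m x) (drop ?m y)" using y by (simp add: map_nth_upt)
      moreover have "set (drop ?m x) \<subseteq> univ B" using x(2) set_drop_subset[of ?m x] by auto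
      ultimately show "close_sim B R (drop ?m x) c0 = close_sim B R (drop ?m y) c0"
        using close_sim_trans close_sim_sym by metis
    qed
    then show ?thesis
      using split[of "\<lambda>c. close_sim B R c c0" a] split[of "\<lambda>c. close_sim B R c c0" b] lab by simp
  qed
  have "card {c \<in> ?far a. Q (a @ c)} = card {c \<in> ?far b. Q (b @ c)}"
  proof (rule card_eq_by_classes[where r = "close_sim B R" and X = "tuples B (Suc w)"])
    show "finite (tuples B (Suc w))" using finite_tuples[OF B] .
    show "\<And>c0. c0 \<in> tuples B (Suc w) \<Longrightarrow>
      card {c \<in> ?far a. close_sim B R c c0} = card {c \<in> ?far b. close_sim B R c c0}" using farclass .
    fix c d assume c: "c \<in> ?far a" and d: "d \<in> ?far b" and cd: "close_sim B R c d"
    have sab: "sim B R a b" using sim_mono[OF B a Suc.prems(2)] by simp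
    \<comment> \<open>Far tuples can be glued to the centers, and mixed pairs are not close on
      either side.\<close>
    have "close_sim B R (a @ c) (b @ d)"
      unfolding close_sim_def
    proof
      show "sim B R (a @ c) (b @ d)"
        using c d cd sab by (intro sim_far_union[OF B a]) (auto simp: close_sim_def)
      show "same_close B ?q (a @ c) (b @ d)"
      proof (rule same_close_append)
        show "same_close B ?q c d" using cd by (simp add: close_sim_def)
        fix i j assume ij: "i < ?m" "j < length c"
        have "c ! j \<notin> nbhd B ?q a" using c ij(2) nth_mem by blast
        moreover have "d ! j \<in> set d" using c d ij(2) by simp
        then have "d ! j \<notin> nbhd B ?q b" using d by blast
        ultimately show "c ! j \<in> nbhd B ?q [a ! i] \<longleftrightarrow> d ! j \<in> nbhd B ?q [b ! i]"
          using nbhd_iff_single ij(1) lab nth_mem by metis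
      qed (use a b c d lab Suc.prems(3) in auto)
    qed
    then show "Q (a @ c) = Q (b @ d)" using Suc.prems(4)[of "a @ c" "b @ d"] a c by auto
  qed (use close_sim_refl close_sim_sym close_sim_trans in blast)+
  then show ?case
    using near[OF Suc.prems(4)] split[of "\<lambda>c. Q (a @ c)" a] split[of "\<lambda>c. Q (b @ c)" b] by simp
qed

section \<open>Locality of counting formulas\<close>

lemma set_zip_map: "set (zip (map f xs) (map g xs)) = (\<lambda>x. (f x, g x)) ` set xs"
  by (induction xs) auto

text \<open>The inclusion of pairs says that the isomorphism from \<open>a\<close> to
  \<open>b\<close> also sends \<open>c\<close> to \<open>d\<close>, whatever the order, repetition
  or omission of entries. It serves wherever variable lists or parameter lists are
  rearranged.\<close>

lemma sim_zip:
  assumes B: "is_struct \<sigma> B" and s: "sim B s a b" and a: "set a \<subseteq> univ B"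
    and l: "length c = length d" and z: "set (zip c d) \<subseteq> set (zip a b)"
  shows "sim B s c d"
proof -
  obtain f where f: "sphere_iso B s f a b" using s sim_iff_sphere_iso by blast
  have fab: "map f a = b" using f by (simp add: sphere_iso_def)
  have "c ! i \<in> set a \<and> d ! i = f (c ! i)" if "i < length c" for i
  proof -
    have "(c ! i, d ! i) \<in> set (zip c d)" using that l by (auto simp: set_zip)
    then have "(c ! i, d ! i) \<in> set (zip a b)" using z by blast
    then show ?thesis unfolding fab[symmetric] set_zip_map[of id, simplified] by auto
  qed
  note * = this
  have "set c \<subseteq> nbhd B 0 a" unfolding nbhd_0[OF a] using * by (auto simp: in_set_conv_nth)
  moreover have "map f c = d" using * l by (intro nth_equalityI) auto
  ultimately have "sphere_iso B s f c d" using sphere_iso_restrict[OF B f a, of c 0 s] by simp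
  then show ?thesis unfolding sim_iff_sphere_iso by blast
qed

lemma upds_notin: "x \<notin> set xs \<Longrightarrow> length as = length xs \<Longrightarrow> upds \<beta> xs as x = \<beta> x"
  by (metis map_of_zip_is_None option.case(1) upds_def)

lemma map_upds_self: "distinct xs \<Longrightarrow> length as = length xs \<Longrightarrow> map (upds \<beta> xs as) xs = as"
  by (intro nth_equalityI) (auto simp: upds_def map_of_zip_nth)

text \<open>Transfers \<open>hanf_count\<close> from tuples to assignments: by the hypothesis on
  \<open>S\<close> only the values on \<open>us @ xs\<close> matter, so \<open>S\<close> can be read
  off the canonical assignment \<open>asg (us @ xs)\<close> of a tuple.\<close>

lemma count_local:
  assumes B: "is_struct \<sigma> B" and d: "distinct (us @ xs)" and "xs \<noteq> []"
    and S: "\<And>\<gamma> \<gamma>'. set (map \<gamma> (us @ xs)) \<subseteq> univ B \<Longrightarrow>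
      sim B R (map \<gamma> (us @ xs)) (map \<gamma>' (us @ xs)) \<Longrightarrow> S \<gamma> = S \<gamma>'"
    and u: "set (map \<beta> us) \<subseteq> univ B"
    and sim: "sim B (R + length xs * (2 * R + 1)) (map \<beta> us) (map \<beta>' us)"
  shows "card {as \<in> tuples B (length xs). S (upds \<beta> xs as)} = card {as \<in> tuples B (length xs). S (upds \<beta>' xs as)}"
proof -
  let ?Q = "\<lambda>z. S (asg (us @ xs) z)"
  have u': "set (map \<beta>' us) \<subseteq> univ B" using sim_univ[OF sim u] .
  have Q: "S (upds \<gamma> xs as) = ?Q (map \<gamma> us @ as)"
    if "set (map \<gamma> us) \<subseteq> univ B" "as \<in> tuples B (length xs)" for \<gamma> as
  proof (rule S)
    have "map (upds \<gamma> xs as) (us @ xs) = map \<gamma> us @ as"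
      using d that by (simp add: map_upds_self upds_notin disjoint_iff)
    moreover have "map (asg (us @ xs) (map \<gamma> us @ as)) (us @ xs) = map \<gamma> us @ as"
      using d that by (intro map_upds_self) auto
    ultimately show "sim B R (map (upds \<gamma> xs as) (us @ xs)) (map (asg (us @ xs) (map \<gamma> us @ as)) (us @ xs))"
      and "set (map (upds \<gamma> xs as) (us @ xs)) \<subseteq> univ B"
      using that by (simp_all only: iso_refl) simp
  qed
  have "card {as \<in> tuples B (length xs). ?Q (map \<beta> us @ as)} = card {as \<in> tuples B (length xs). ?Q (map \<beta>' us @ as)}"
  proof (rule hanf_count[OF B u sim])
    obtain f where "sphere_iso B (R + length xs * (2 * R + 1)) f (map \<beta> us) (map \<beta>' us)"
      using sim sim_iff_sphere_iso by blast
    \<comment> \<open>As \<open>xs\<close> is nonempty, the radius is at least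
      \<open>2 * R + 1\<close>, so closeness of the centers is preserved.\<close>
    from same_close_of_sphere_iso[OF B this u] show "same_close B (2 * R + 1) (map \<beta> us) (map \<beta>' us)"
      using \<open>xs \<noteq> []\<close> by (cases xs) auto
    fix x y assume x: "length x = length (map \<beta> us) + length xs" "set x \<subseteq> univ B" "close_sim B R x y"
    have xy: "sim B R x y" using x(3) by (simp add: close_sim_def)
    have "map (asg (us @ xs) x) (us @ xs) = x" "map (asg (us @ xs) y) (us @ xs) = y"
      using x(1) sim_length[OF xy] by (intro map_upds_self[OF d]; simp)+
    then show "?Q x = ?Q y" using S[of "asg (us @ xs) x" "asg (us @ xs) y"] x(2) xy by (simp only:)
  qed
  moreover have "{as \<in> tuples B (length xs). S (upds \<beta> xs as)} = {as \<in> tuples B (length xs). ?Q (map \<beta> us @ as)}"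
    using Q[OF u] by blast
  moreover have "{as \<in> tuples B (length xs). S (upds \<beta>' xs as)} = {as \<in> tuples B (length xs). ?Q (map \<beta>' us @ as)}"
    using Q[OF u'] by blast
  ultimately show ?thesis by (simp only:)
qed

fun rad :: "nat \<Rightarrow> nat \<Rightarrow> nat" where
  "rad w 0 = 0"
| "rad w (Suc j) = rad w j + w * (2 * rad w j + 1)"

text \<open>Each level of \<open>rad\<close> adds the price of one counted tuple of length
  \<open>w\<close>. For \<open>2 * rad w j + 1\<close> this is multiplication by
  \<open>2 * w + 1\<close>, which yields the required strict bound on the locality radius.\<close>

lemma rad_power: "2 * rad w j + 1 = (2 * w + 1) ^ j"
  by (induction j) (auto simp: algebra_simps)

lemma rad_less: "rad w j < (2 * w + 1) ^ j"
  using rad_power[of w j] by linarith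

lemma foldr_max_le: "foldr max xs (0::nat) \<le> j \<longleftrightarrow> (\<forall>x \<in> set xs. x \<le> j)"
  by (induction xs) auto

text \<open>The list \<open>vs\<close> may repeat variables and contain bound ones, whereas
  \<open>count_local\<close> needs distinct lists; \<open>us\<close> is what remains of
  \<open>vs\<close>. A tuple shorter than \<open>w\<close> needs less radius.\<close>

lemma count_local_fv:
  assumes B: "is_struct \<sigma> B" and xs: "distinct xs" "xs \<noteq> []" "length xs \<le> w"
    and S: "\<And>vs \<gamma> \<gamma>'. V \<subseteq> set vs \<Longrightarrow> \<gamma> ` set vs \<subseteq> univ B \<Longrightarrow>
      sim B (rad w j) (map \<gamma> vs) (map \<gamma>' vs) \<Longrightarrow> S \<gamma> = S \<gamma>'"
    and V: "V - set xs \<subseteq> set vs" and u: "\<beta> ` set vs \<subseteq> univ B"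
    and sim: "sim B (rad w (Suc j)) (map \<beta> vs) (map \<beta>' vs)"
  shows "card {as \<in> tuples B (length xs). S (upds \<beta> xs as)} = card {as \<in> tuples B (length xs). S (upds \<beta>' xs as)}"
proof -
  define us where "us = remdups (filter (\<lambda>x. x \<notin> set xs) vs)"
  have us: "set us = set vs - set xs" "distinct (us @ xs)" using xs by (auto simp: us_def)
  have s: "sim B (rad w (Suc j)) (map \<beta> us) (map \<beta>' us)"
    using us u by (intro sim_zip[OF B sim]) (auto simp: set_zip_map)
  have uu: "set (map \<beta> us) \<subseteq> univ B" using us(1) u by auto
  have "rad w j + length xs * (2 * rad w j + 1) \<le> rad w (Suc j)"
    using mult_le_mono1[OF xs(3), of "2 * rad w j + 1"] by (simp only: rad.simps add_le_cancel_left)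
  note s' = sim_mono[OF B uu s this]
  show ?thesis
  proof (rule count_local[OF B us(2) xs(2) _ uu s'])
    fix \<gamma> \<gamma>'
    assume "set (map \<gamma> (us @ xs)) \<subseteq> univ B" "sim B (rad w j) (map \<gamma> (us @ xs)) (map \<gamma>' (us @ xs))"
    moreover have "V \<subseteq> set (us @ xs)" using us(1) V by auto
    ultimately show "S \<gamma> = S \<gamma>'" using S[of "us @ xs" \<gamma> \<gamma>'] by (simp add: image_Un)
  qed
qed

text \<open>One structure and one number assignment \<open>\<nu>\<close> serve both sides, so
  counting terms get equal values, and arithmetic, numerical predicates and number quantifiers keep
  the radius. Only a counting term or a structure quantifier descends from
  \<open>rad w (Suc i)\<close> to \<open>rad w i\<close>.\<close>

lemma focn_local:
  assumes B: "is_struct \<sigma> B"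
  shows "fm_wf \<sigma> P \<phi> \<Longrightarrow> br \<phi> \<le> j \<Longrightarrow> \<forall>x \<in> widths \<phi>. x \<le> w \<Longrightarrow> (has_quant \<phi> \<longrightarrow> 1 \<le> w) \<Longrightarrow>
      fv \<phi> \<subseteq> set vs \<Longrightarrow> \<beta> ` set vs \<subseteq> univ B \<Longrightarrow> sim B (rad w j) (map \<beta> vs) (map \<beta>' vs) \<Longrightarrow>
      sat P B \<phi> \<beta> \<nu> = sat P B \<phi> \<beta>' \<nu>"
    and "cterm_wf \<sigma> P t \<Longrightarrow> br_t t \<le> j \<Longrightarrow> \<forall>x \<in> widths_t t. x \<le> w \<Longrightarrow> (has_quant_t t \<longrightarrow> 1 \<le> w) \<Longrightarrow>
      fv_t t \<subseteq> set vs \<Longrightarrow> \<beta> ` set vs \<subseteq> univ B \<Longrightarrow> sim B (rad w j) (map \<beta> vs) (map \<beta>' vs) \<Longrightarrow>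
      val P B t \<beta> \<nu> = val P B t \<beta>' \<nu>"
proof (induction \<phi> and t arbitrary: j vs \<beta> \<beta>' \<nu> and j vs \<beta> \<beta>' \<nu> rule: fm.induct cterm.induct)
  case (Eq x y)
  obtain f where f: "sphere_iso B (rad w j) f (map \<beta> vs) (map \<beta>' vs)" using Eq(7) sim_iff_sphere_iso by blast
  have i: "inj_on f (nbhd B (rad w j) (map \<beta> vs))" using f by (simp add: sphere_iso_def bij_betw_def)
  have c: "\<beta> ` set vs \<subseteq> nbhd B (rad w j) (map \<beta> vs)" using nbhd_center[of "map \<beta> vs" B] Eq(6) by simp
  have "f (\<beta> v) = \<beta>' v" if "v \<in> set vs" for v using f that by (auto simp: sphere_iso_def)
  then have "f (\<beta> x) = \<beta>' x" "f (\<beta> y) = \<beta>' y" using Eq(5) by auto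
  then show ?case using inj_on_eq_iff[OF i, of "\<beta> x" "\<beta> y"] c Eq(5) by (auto simp: image_subset_iff)
next
  case (Rel i xs)
  obtain f where f: "sphere_iso B (rad w j) f (map \<beta> vs) (map \<beta>' vs)" using Rel(7) sim_iff_sphere_iso by blast
  have c: "\<beta> ` set vs \<subseteq> nbhd B (rad w j) (map \<beta> vs)" using nbhd_center[of "map \<beta> vs" B] Rel(6) by simp
  have "f (\<beta> v) = \<beta>' v" if "v \<in> set vs" for v using f that by (auto simp: sphere_iso_def)
  then have "map f (map \<beta> xs) = map \<beta>' xs" using Rel(5) by auto
  moreover have "set (map \<beta> xs) \<subseteq> nbhd B (rad w j) (map \<beta> vs)" using Rel(5) c by auto
  then have "map \<beta> xs \<in> rels B i \<longleftrightarrow> map f (map \<beta> xs) \<in> rels B i" using f unfolding sphere_iso_def by blast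
  ultimately show ?case by (simp only: sat.simps)
next
  case (Neg \<phi>)
  show ?case using Neg.IH[of j vs \<beta> \<beta>' \<nu>] Neg.prems by simp
next
  case (Disj \<phi> \<psi>)
  show ?case using Disj.IH(1)[of j vs \<beta> \<beta>' \<nu>] Disj.IH(2)[of j vs \<beta> \<beta>' \<nu>] Disj.prems by auto
next
  case (Ex x \<phi>)
  obtain i where j: "j = Suc i" using Ex.prems(2) by (cases j) auto
  \<comment> \<open>A structure quantifier is treated as a count of 1-tuples: it holds iff this
    count is nonzero.\<close>
  have "card {as \<in> tuples B (length [x]). sat P B \<phi> (upds \<beta> [x] as) \<nu>} =
      card {as \<in> tuples B (length [x]). sat P B \<phi> (upds \<beta>' [x] as) \<nu>}"
  proof (rule count_local_fv[OF B, where j = i and w = w and V = "fv \<phi>"])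
    fix vs \<gamma> \<gamma>'
    assume "fv \<phi> \<subseteq> set vs" "\<gamma> ` set vs \<subseteq> univ B" "sim B (rad w i) (map \<gamma> vs) (map \<gamma>' vs)"
    then show "sat P B \<phi> \<gamma> \<nu> = sat P B \<phi> \<gamma>' \<nu>"
      using Ex.IH[of i vs \<gamma> \<gamma>' \<nu>] Ex.prems j by simp
  next
    show "sim B (rad w (Suc i)) (map \<beta> vs) (map \<beta>' vs)" using Ex.prems(7) j by simp
  qed (use Ex.prems in auto)
  moreover have "sat P B (Ex x \<phi>) \<gamma> \<nu> \<longleftrightarrow> card {as \<in> tuples B (length [x]). sat P B \<phi> (upds \<gamma> [x] as) \<nu>} \<noteq> 0" for \<gamma>
  proof -
    have 1: "upds \<gamma> [x] [a] = \<gamma>(x := a)" for a by (auto simp: upds_def)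
    have "{as \<in> tuples B (length [x]). sat P B \<phi> (upds \<gamma> [x] as) \<nu>} =
      (\<lambda>a. [a]) ` {a \<in> univ B. sat P B \<phi> (\<gamma>(x := a)) \<nu>}"
      by (auto simp: 1 length_Suc_conv)
    moreover have "finite {a \<in> univ B. sat P B \<phi> (\<gamma>(x := a)) \<nu>}" using B by (simp add: is_struct_def)
    ultimately show ?thesis by auto
  qed
  ultimately show ?case by (simp only:)
next
  case (NPred p ts)
  have "val P B t \<beta> \<nu> = val P B t \<beta>' \<nu>" if t: "t \<in> set ts" for t
    using t NPred.prems by (intro NPred.IH[OF t, of j vs]) (auto simp: foldr_max_le list_all_iff list_ex_iff)
  then have "map (\<lambda>t. val P B t \<beta> \<nu>) ts = map (\<lambda>t. val P B t \<beta>' \<nu>) ts" by auto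
  then show ?case by (simp only: sat.simps)
next
  case (ExN \<kappa> \<phi>)
  have "sat P B \<phi> \<beta> (\<nu>(\<kappa> := m)) = sat P B \<phi> \<beta>' (\<nu>(\<kappa> := m))" for m
    using ExN.IH[of j vs \<beta> \<beta>'] ExN.prems by simp
  then show ?case by simp
next
  case (Count xs \<phi>)
  obtain i where j: "j = Suc i" using Count.prems(2) by (cases j) auto
  have "card {as \<in> tuples B (length xs). sat P B \<phi> (upds \<beta> xs as) \<nu>} =
      card {as \<in> tuples B (length xs). sat P B \<phi> (upds \<beta>' xs as) \<nu>}"
  proof (rule count_local_fv[OF B, where j = i and w = w and V = "fv \<phi>"])
    fix vs \<gamma> \<gamma>'
    assume "fv \<phi> \<subseteq> set vs" "\<gamma> ` set vs \<subseteq> univ B" "sim B (rad w i) (map \<gamma> vs) (map \<gamma>' vs)"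
    then show "sat P B \<phi> \<gamma> \<nu> = sat P B \<phi> \<gamma>' \<nu>"
      using Count.IH[of i vs \<gamma> \<gamma>' \<nu>] Count.prems j by simp
  next
    show "sim B (rad w (Suc i)) (map \<beta> vs) (map \<beta>' vs)" using Count.prems(7) j by simp
  qed (use Count.prems in auto)
  then show ?case by simp
next
  case (Plus s t)
  show ?case using Plus.IH(1)[of j vs \<beta> \<beta>' \<nu>] Plus.IH(2)[of j vs \<beta> \<beta>' \<nu>] Plus.prems by auto
next
  case (Times s t)
  show ?case using Times.IH(1)[of j vs \<beta> \<beta>' \<nu>] Times.IH(2)[of j vs \<beta> \<beta>' \<nu>] Times.prems by auto
qed auto

lemma finite_widths:
  fixes \<phi> :: "'p fm" and t :: "'p cterm"
  shows "finite (widths \<phi>)" "finite (widths_t t)"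
  by (induction \<phi> and t rule: fm.induct cterm.induct) auto

lemma widths_pos:
  "fm_wf \<sigma> P \<phi> \<Longrightarrow> x \<in> widths \<phi> \<Longrightarrow> 1 \<le> x"
  "cterm_wf \<sigma> P t \<Longrightarrow> x \<in> widths_t t \<Longrightarrow> 1 \<le> x"
proof (induction \<phi> and t rule: fm.induct cterm.induct)
  case (Count xs \<phi>)
  then show ?case by (cases xs) auto
qed (auto simp: list_all_iff)

lemma focn_hyp_local:
  assumes B: "is_struct \<sigma> B" and \<phi>: "fm_wf \<sigma> P \<phi>" "br \<phi> \<le> r" "bw \<phi> \<le> w"
    and xy: "distinct (xs @ ys)" "fv \<phi> \<subseteq> set (xs @ ys)" "length ys = length v"
    and u: "length u = length xs" "length u' = length xs" "set (u @ v) \<subseteq> univ B"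
    and sim: "sim B (rad w r) (u @ v) (u' @ v)"
  shows "focn_hyp P B \<phi> xs ys ks v \<mu> u = focn_hyp P B \<phi> xs ys ks v \<mu> u'"
proof -
  have w: "\<forall>x \<in> widths \<phi>. x \<le> w"
    using \<phi>(3) Max_ge[OF finite_widths(1), of _ \<phi>] by (force simp: bw_def split: if_splits)
  \<comment> \<open>If counting terms occur, \<open>bw\<close> ignores quantifiers. But the tuple of
    a counting term is nonempty, so \<open>w\<close> is at least 1 and also covers the 1-tuples of
    quantifiers.\<close>
  have q: "has_quant \<phi> \<longrightarrow> 1 \<le> w"
  proof (cases "widths \<phi> = {}")
    case False
    then obtain x where "x \<in> widths \<phi>" by blast
    then have "1 \<le> x" "x \<le> w" using widths_pos(1)[OF \<phi>(1)] w by auto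
    then show ?thesis by simp
  qed (use \<phi>(3) in \<open>auto simp: bw_def\<close>)
  have m: "map (asg (xs @ ys) (z @ v)) (xs @ ys) = z @ v" if "length z = length xs" for z
    using xy that by (intro map_upds_self) auto
  have "asg (xs @ ys) (u @ v) ` set (xs @ ys) \<subseteq> univ B"
    using u(3) m[OF u(1)] by (metis list.set_map)
  then show ?thesis
    unfolding focn_hyp_def using focn_local(1)[OF B \<phi>(1,2) w q xy(2)] sim m u(1,2) by metis
qed

section \<open>Dropping parameters far from the instances\<close>

lemma chain_stabilizes:
  fixes V :: "nat \<Rightarrow> nat set"
  assumes "\<And>i. V i \<subseteq> V (Suc i)" "\<And>i. V i \<subseteq> {..<l}"
  shows "\<exists>i \<le> l. V i = V (Suc i)"
proof (rule ccontr)
  assume neg: "\<not> ?thesis"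
  have fin: "finite (V i)" for i using assms(2) finite_subset by blast
  have "i \<le> card (V i)" if "i \<le> Suc l" for i
    using that
  proof (induction i)
    case (Suc i)
    then have "V i \<subset> V (Suc i)" using neg assms(1) by (metis Suc_le_mono psubsetI)
    then have "card (V i) < card (V (Suc i))" by (intro psubset_card_mono fin)
    then show ?case using Suc by simp
  qed simp
  from this[of "Suc l"] have "Suc l \<le> card (V (Suc l))" by simp
  moreover have "card (V (Suc l)) \<le> l" using card_mono[OF _ assms(2), of "Suc l"] by simp
  ultimately show False by simp
qed

text \<open>Among the first \<open>length v + 1\<close> rings of width \<open>2 * \<rho> + 1\<close> around the instances one contains no
  parameter. The parameters beyond it contribute the same disjoint part to the sphere of every
  instance, so they can be dropped.\<close>

lemma param_reduction:
  assumes B: "is_struct \<sigma> B" and v: "set v \<subseteq> univ B"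
    and us: "\<And>u. u \<in> set us \<Longrightarrow> length u = k \<and> set u \<subseteq> univ B" and z: "z \<in> univ B"
  obtains v' where "length v' = length v"
    and "set v' \<subseteq> insert z (nbhd B (length v * (2 * \<rho> + 1)) (concat us))"
    and "\<And>u u'. u \<in> set us \<Longrightarrow> u' \<in> set us \<Longrightarrow> sim B \<rho> (u @ v') (u' @ v') \<Longrightarrow> sim B \<rho> (u @ v) (u' @ v)"
proof -
  let ?q = "2 * \<rho> + 1" and ?C = "concat us" and ?l = "length v"
  define V where "V i = {j. j < ?l \<and> v ! j \<in> nbhd B (i * ?q) ?C}" for i
  have "\<exists>i \<le> ?l. V i = V (Suc i)"
    using nbhd_mono[of "i * ?q" "Suc i * ?q" ?C ?C B for i]
    by (intro chain_stabilizes) (auto simp: V_def subset_iff)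
  then obtain i where i: "i \<le> ?l" "V i = V (Suc i)" by blast
  \<comment> \<open>The length has to stay the same, so dropped parameters are replaced by
    \<open>z\<close>. \<open>vJ\<close> and \<open>vF\<close> are the kept and the dropped
    parameters without placeholders.\<close>
  define v' where "v' = map (\<lambda>x. if x \<in> nbhd B (i * ?q) ?C then x else z) v"
  define vJ where "vJ = filter (\<lambda>x. x \<in> nbhd B (i * ?q) ?C) v"
  define vF where "vF = filter (\<lambda>x. x \<notin> nbhd B (i * ?q) ?C) v"
  have C: "set ?C \<subseteq> univ B" using us by auto
  have far: "set vF \<inter> nbhd B ?q (u @ vJ) = {}" if u: "u \<in> set us" for u
  proof (rule equals0I)
    fix x assume x: "x \<in> set vF \<inter> nbhd B ?q (u @ vJ)"
    have "set (u @ vJ) \<subseteq> nbhd B (i * ?q) ?C"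
      using u nbhd_center[OF C, of "i * ?q"] by (auto simp: vJ_def)
    from nbhd_trans[OF this, of ?q] have "x \<in> nbhd B (i * ?q + ?q) ?C" using x by blast
    moreover have "i * ?q + ?q = Suc i * ?q" by simp
    ultimately have "x \<in> nbhd B (Suc i * ?q) ?C" by (simp only:)
    moreover obtain j where "j < ?l" "v ! j = x" using x by (auto simp: vF_def in_set_conv_nth)
    ultimately have "j \<in> V (Suc i)" by (simp add: V_def)
    then have "x \<in> nbhd B (i * ?q) ?C" using i(2) \<open>v ! j = x\<close> by (auto simp: V_def)
    then show False using x by (simp add: vF_def)
  qed
  show ?thesis
  proof (rule that)
    show "length v' = ?l" by (simp add: v'_def)
    show "set v' \<subseteq> insert z (nbhd B (?l * ?q) ?C)"
      using nbhd_mono[OF mult_le_mono1[OF i(1), of ?q], of ?C ?C B] by (auto simp: v'_def)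
    fix u u' assume u: "u \<in> set us" "u' \<in> set us" and s: "sim B \<rho> (u @ v') (u' @ v')"
    note lu = us[OF u(1)] us[OF u(2)]
    have "set v' \<subseteq> univ B" using v z by (auto simp: v'_def)
    moreover have "set vJ \<subseteq> set v'" by (auto simp: vJ_def v'_def)
    ultimately have "sim B \<rho> (u @ vJ) (u' @ vJ)"
      using lu by (intro sim_zip[OF B s]) (auto simp: zip_same_conv_map)
    moreover have "set (u @ vJ) \<subseteq> univ B" "set vF \<subseteq> univ B" using lu v by (auto simp: vJ_def vF_def)
    \<comment> \<open>The dropped part is glued to itself by the identity; \<open>far\<close>
      provides its distance from each instance and from the kept parameters.\<close>
    ultimately have s2: "sim B \<rho> ((u @ vJ) @ vF) ((u' @ vJ) @ vF)"
      by (rule sim_far_union[OF B _ _ _ iso_refl far[OF u(1)] far[OF u(2)], rotated -1])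
    show "sim B \<rho> (u @ v) (u' @ v)"
      using lu v by (intro sim_zip[OF B s2])
        (auto simp: vJ_def vF_def zip_same_conv_map)
  qed
qed

section \<open>Existence of sphere formulas\<close>

text \<open>Closure lemmas for this notion spare writing sphere formulas out. Nonempty universes and
  assignments into the universe are exactly what sphere formulas are tested on.\<close>

definition definable :: "signature \<Rightarrow> nat set \<Rightarrow> (nat struct \<Rightarrow> (nat \<Rightarrow> nat) \<Rightarrow> bool) \<Rightarrow> bool" where
  "definable \<sigma> V Q \<longleftrightarrow> (\<exists>\<chi>. fo_wf \<sigma> \<chi> \<and> fo_fv \<chi> \<subseteq> V \<and>
     (\<forall>B \<beta>. is_struct \<sigma> B \<longrightarrow> univ B \<noteq> {} \<longrightarrow> \<beta> ` V \<subseteq> univ B \<longrightarrow> (fo_sat B \<chi> \<beta> \<longleftrightarrow> Q B \<beta>)))"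

lemma definableI:
  assumes "fo_wf \<sigma> \<chi>" "fo_fv \<chi> \<subseteq> V"
    "\<And>B \<beta>. is_struct \<sigma> B \<Longrightarrow> univ B \<noteq> {} \<Longrightarrow> \<beta> ` V \<subseteq> univ B \<Longrightarrow> fo_sat B \<chi> \<beta> \<longleftrightarrow> Q B \<beta>"
  shows "definable \<sigma> V Q"
  using assms unfolding definable_def by blast

lemma definableE:
  assumes "definable \<sigma> V Q"
  obtains \<chi> where "fo_wf \<sigma> \<chi>" "fo_fv \<chi> \<subseteq> V"
    "\<And>B \<beta>. is_struct \<sigma> B \<Longrightarrow> univ B \<noteq> {} \<Longrightarrow> \<beta> ` V \<subseteq> univ B \<Longrightarrow> fo_sat B \<chi> \<beta> \<longleftrightarrow> Q B \<beta>"
  using assms unfolding definable_def by blast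

lemma definable_cong:
  assumes "definable \<sigma> V Q" "V \<subseteq> V'"
    "\<And>B \<beta>. is_struct \<sigma> B \<Longrightarrow> univ B \<noteq> {} \<Longrightarrow> \<beta> ` V' \<subseteq> univ B \<Longrightarrow> Q B \<beta> \<longleftrightarrow> Q' B \<beta>"
  shows "definable \<sigma> V' Q'"
proof -
  obtain \<chi> where \<chi>: "fo_wf \<sigma> \<chi>" "fo_fv \<chi> \<subseteq> V"
    "\<And>B \<beta>. is_struct \<sigma> B \<Longrightarrow> univ B \<noteq> {} \<Longrightarrow> \<beta> ` V \<subseteq> univ B \<Longrightarrow> fo_sat B \<chi> \<beta> \<longleftrightarrow> Q B \<beta>"
    using assms(1) by (rule definableE) blast
  show ?thesis
  proof (rule definableI[OF \<chi>(1)])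
    fix B :: "nat struct" and \<beta> :: "nat \<Rightarrow> nat"
    assume b: "is_struct \<sigma> B" "univ B \<noteq> {}" "\<beta> ` V' \<subseteq> univ B"
    then have "\<beta> ` V \<subseteq> univ B" using assms(2) by blast
    then show "fo_sat B \<chi> \<beta> \<longleftrightarrow> Q' B \<beta>" using \<chi>(3) assms(3) b by blast
  qed (use \<chi>(2) assms(2) in blast)
qed

lemma definable_mono: "definable \<sigma> V Q \<Longrightarrow> V \<subseteq> V' \<Longrightarrow> definable \<sigma> V' Q"
  by (erule definable_cong) auto

lemma definable_neg:
  assumes "definable \<sigma> V Q"
  shows "definable \<sigma> V (\<lambda>B \<beta>. \<not> Q B \<beta>)"
  using assms by (elim definableE, intro definableI[of _ "FNeg _"]) auto

lemma definable_disj: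
  assumes "definable \<sigma> V Q" "definable \<sigma> V Q'"
  shows "definable \<sigma> V (\<lambda>B \<beta>. Q B \<beta> \<or> Q' B \<beta>)"
proof -
  obtain \<chi> where \<chi>: "fo_wf \<sigma> \<chi>" "fo_fv \<chi> \<subseteq> V"
    "\<And>B \<beta>. is_struct \<sigma> B \<Longrightarrow> univ B \<noteq> {} \<Longrightarrow> \<beta> ` V \<subseteq> univ B \<Longrightarrow> fo_sat B \<chi> \<beta> \<longleftrightarrow> Q B \<beta>"
    using assms(1) by (rule definableE) blast
  obtain \<psi> where \<psi>: "fo_wf \<sigma> \<psi>" "fo_fv \<psi> \<subseteq> V"
    "\<And>B \<beta>. is_struct \<sigma> B \<Longrightarrow> univ B \<noteq> {} \<Longrightarrow> \<beta> ` V \<subseteq> univ B \<Longrightarrow> fo_sat B \<psi> \<beta> \<longleftrightarrow> Q' B \<beta>"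
    using assms(2) by (rule definableE) blast
  show ?thesis using \<chi> \<psi> by (intro definableI[of _ "FDisj \<chi> \<psi>"]) auto
qed

lemma definable_conj:
  assumes "definable \<sigma> V Q" "definable \<sigma> V Q'"
  shows "definable \<sigma> V (\<lambda>B \<beta>. Q B \<beta> \<and> Q' B \<beta>)"
  using definable_neg[OF definable_disj[OF definable_neg[OF assms(1)] definable_neg[OF assms(2)]]] by simp

lemma definable_ex:
  assumes "definable \<sigma> (insert x V) Q"
  shows "definable \<sigma> V (\<lambda>B \<beta>. \<exists>a \<in> univ B. Q B (\<beta>(x := a)))"
proof -
  obtain \<chi> where \<chi>: "fo_wf \<sigma> \<chi>" "fo_fv \<chi> \<subseteq> insert x V"
    "\<And>B \<beta>. is_struct \<sigma> B \<Longrightarrow> univ B \<noteq> {} \<Longrightarrow> \<beta> ` insert x V \<subseteq> univ B \<Longrightarrow> fo_sat B \<chi> \<beta> \<longleftrightarrow> Q B \<beta>"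
    using assms by (rule definableE) blast
  show ?thesis
  proof (rule definableI[of _ "FEx x \<chi>"])
    fix B :: "nat struct" and \<beta> :: "nat \<Rightarrow> nat"
    assume b: "is_struct \<sigma> B" "univ B \<noteq> {}" "\<beta> ` V \<subseteq> univ B"
    have "fo_sat B \<chi> (\<beta>(x := a)) \<longleftrightarrow> Q B (\<beta>(x := a))" if "a \<in> univ B" for a
      using b that by (intro \<chi>(3)) auto
    then show "fo_sat B (FEx x \<chi>) \<beta> \<longleftrightarrow> (\<exists>a \<in> univ B. Q B (\<beta>(x := a)))" by auto
  qed (use \<chi> in auto)
qed

lemma definable_all:
  assumes "definable \<sigma> (insert x V) Q"
  shows "definable \<sigma> V (\<lambda>B \<beta>. \<forall>a \<in> univ B. Q B (\<beta>(x := a)))"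
  using definable_neg[OF definable_ex[OF definable_neg[OF assms]]] by simp

text \<open>The witness has no free variables, so \<open>V\<close> may be empty; it is true because
  universes are nonempty.\<close>

lemma definable_True: "definable \<sigma> V (\<lambda>B \<beta>. True)"
  by (rule definableI[of _ "FEx 0 (FEq 0 0)"]) auto

lemma definable_False: "definable \<sigma> V (\<lambda>B \<beta>. False)"
  using definable_neg[OF definable_True] by simp

lemma definable_eq: "x \<in> V \<Longrightarrow> y \<in> V \<Longrightarrow> definable \<sigma> V (\<lambda>B \<beta>. \<beta> x = \<beta> y)"
  by (rule definableI[of _ "FEq x y"]) auto

lemma definable_rel: "i < length \<sigma> \<Longrightarrow> length xs = \<sigma> ! i \<Longrightarrow> set xs \<subseteq> V \<Longrightarrow> definable \<sigma> V (\<lambda>B \<beta>. map \<beta> xs \<in> rels B i)"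
  by (rule definableI[of _ "FRel i xs"]) auto

lemma definable_bex: "finite I \<Longrightarrow> (\<And>i. i \<in> I \<Longrightarrow> definable \<sigma> V (Q i)) \<Longrightarrow> definable \<sigma> V (\<lambda>B \<beta>. \<exists>i \<in> I. Q i B \<beta>)"
proof (induction rule: finite_induct)
  case (insert i I)
  then show ?case using definable_disj[of \<sigma> V "Q i" "\<lambda>B \<beta>. \<exists>i \<in> I. Q i B \<beta>"] by simp
qed (simp add: definable_False)

lemma definable_ball: "finite I \<Longrightarrow> (\<And>i. i \<in> I \<Longrightarrow> definable \<sigma> V (Q i)) \<Longrightarrow> definable \<sigma> V (\<lambda>B \<beta>. \<forall>i \<in> I. Q i B \<beta>)"
proof (induction rule: finite_induct)
  case (insert i I)
  then show ?case using definable_conj[of \<sigma> V "Q i" "\<lambda>B \<beta>. \<forall>i \<in> I. Q i B \<beta>"] by simp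
qed (simp add: definable_True)

lemma upds_Cons: "upds \<beta> (x # xs) (a # as) y = (if y = x then a else upds \<beta> xs as y)"
  by (simp add: upds_def)

lemma definable_exs:
  assumes "definable \<sigma> (V \<union> set xs) Q" "distinct xs"
  shows "definable \<sigma> V (\<lambda>B \<beta>. \<exists>as. length as = length xs \<and> set as \<subseteq> univ B \<and> Q B (upds \<beta> xs as))"
  using assms
proof (induction xs arbitrary: V)
  case Nil
  then show ?case by (elim definable_cong) (auto simp: upds_def)
next
  case (Cons x xs)
  have "definable \<sigma> (insert x V) (\<lambda>B \<beta>. \<exists>as. length as = length xs \<and> set as \<subseteq> univ B \<and> Q B (upds \<beta> xs as))"
    using Cons by simp
  from definable_ex[OF this] show ?case
  proof (rule definable_cong)
    fix B :: "nat struct" and \<beta> :: "nat \<Rightarrow> nat"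
    have u: "upds \<beta> (x # xs) (a # as) = upds (\<beta>(x := a)) xs as" if "length as = length xs" for a as
    proof
      fix y
      show "upds \<beta> (x # xs) (a # as) y = upds (\<beta>(x := a)) xs as y"
        using Cons.prems(2) that upds_notin[of x xs as "\<beta>(x := a)"]
        by (cases "y = x") (simp_all add: upds_Cons, auto simp: upds_def split: option.split dest: set_zip_leftD)
    qed
    show "(\<exists>a \<in> univ B. \<exists>as. length as = length xs \<and> set as \<subseteq> univ B \<and> Q B (upds (\<beta>(x := a)) xs as)) \<longleftrightarrow>
      (\<exists>as. length as = length (x # xs) \<and> set as \<subseteq> univ B \<and> Q B (upds \<beta> (x # xs) as))"
      (is "?l \<longleftrightarrow> ?r")
    proof
      assume ?l
      then obtain a as where "a \<in> univ B" "length as = length xs" "set as \<subseteq> univ B" "Q B (upds (\<beta>(x := a)) xs as)"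
        by blast
      then show ?r using u by (intro exI[of _ "a # as"]) auto
    next
      assume ?r
      then obtain a as where "a \<in> univ B" "length as = length xs" "set as \<subseteq> univ B" "Q B (upds \<beta> (x # xs) (a # as))"
        by (auto simp: length_Suc_conv)
      then show ?l unfolding u[OF \<open>length as = length xs\<close>] by blast
    qed
  qed auto
qed

lemma fresh_list:
  assumes "finite (V :: nat set)"
  obtains xs where "length xs = n" "distinct xs" "set xs \<inter> V = {}"
proof -
  obtain m where "\<forall>x \<in> V. x < m" using assms finite_nat_set_iff_bounded by blast
  then have "set [m..<m + n] \<inter> V = {}" by (auto simp: disjoint_iff)
  then show ?thesis by (intro that[of "[m..<m + n]"]) auto
qed

text \<open>A finite signature turns the search for a relation into a finite disjunction, and the
  tuple is guessed in fresh variables. Distinctness of the two elements is left out: stepping from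
  an element to itself does not enlarge a ball.\<close>

lemma definable_adj: "definable \<sigma> {x, y} (\<lambda>B \<beta>. \<exists>i. \<exists>t \<in> rels B i. \<beta> x \<in> set t \<and> \<beta> y \<in> set t)"
proof -
  have "definable \<sigma> {x, y} (\<lambda>B \<beta>. \<exists>t \<in> rels B i. \<beta> x \<in> set t \<and> \<beta> y \<in> set t)" if i: "i < length \<sigma>" for i
  proof -
    obtain ts where ts: "length ts = \<sigma> ! i" "distinct ts" "set ts \<inter> {x, y} = {}"
      using fresh_list[of "{x, y}" "\<sigma> ! i"] by auto
    have "definable \<sigma> ({x, y} \<union> set ts) (\<lambda>B \<beta>. map \<beta> ts \<in> rels B i \<and>
        (\<exists>p \<in> set ts. \<beta> p = \<beta> x) \<and> (\<exists>p \<in> set ts. \<beta> p = \<beta> y))"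
      using i ts by (intro definable_conj definable_rel definable_bex definable_eq) auto
    from definable_exs[OF this ts(2)] show ?thesis
    proof (rule definable_cong)
      fix B :: "nat struct" and \<beta> :: "nat \<Rightarrow> nat"
      assume B: "is_struct \<sigma> B"
      have *: "(map (upds \<beta> ts as) ts \<in> rels B i \<and>
         (\<exists>p \<in> set ts. upds \<beta> ts as p = upds \<beta> ts as x) \<and> (\<exists>p \<in> set ts. upds \<beta> ts as p = upds \<beta> ts as y)) \<longleftrightarrow>
         as \<in> rels B i \<and> \<beta> x \<in> set as \<and> \<beta> y \<in> set as" if l: "length as = length ts" for as
      proof -
        have m: "map (upds \<beta> ts as) ts = as" using map_upds_self[OF ts(2) l] .
        then have "set as = upds \<beta> ts as ` set ts" by (metis list.set_map)
        moreover have "upds \<beta> ts as x = \<beta> x" "upds \<beta> ts as y = \<beta> y" using ts l by (auto intro: upds_notin)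
        ultimately show ?thesis unfolding m by force
      qed
      show "(\<exists>as. length as = length ts \<and> set as \<subseteq> univ B \<and> map (upds \<beta> ts as) ts \<in> rels B i \<and>
         (\<exists>p \<in> set ts. upds \<beta> ts as p = upds \<beta> ts as x) \<and> (\<exists>p \<in> set ts. upds \<beta> ts as p = upds \<beta> ts as y)) \<longleftrightarrow>
        (\<exists>t \<in> rels B i. \<beta> x \<in> set t \<and> \<beta> y \<in> set t)" (is "?l \<longleftrightarrow> ?r")
      proof
        assume ?l
        then obtain as where as: "length as = length ts" "map (upds \<beta> ts as) ts \<in> rels B i \<and>
         (\<exists>p \<in> set ts. upds \<beta> ts as p = upds \<beta> ts as x) \<and> (\<exists>p \<in> set ts. upds \<beta> ts as p = upds \<beta> ts as y)"
          by blast
        from as(2) show ?r unfolding *[OF as(1)] by blast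
      next
        assume ?r
        then obtain t where t: "t \<in> rels B i" "\<beta> x \<in> set t \<and> \<beta> y \<in> set t" by blast
        then have l: "length t = length ts" "set t \<subseteq> univ B" using rels_univ[OF B t(1)] ts(1) by auto
        from *[OF l(1)] show ?l using t l by (intro exI[of _ t]) blast
      qed
    qed auto
  qed
  then have "definable \<sigma> {x, y} (\<lambda>B \<beta>. \<exists>i \<in> {..<length \<sigma>}. \<exists>t \<in> rels B i. \<beta> x \<in> set t \<and> \<beta> y \<in> set t)"
    by (intro definable_bex) auto
  then show ?thesis
  proof (rule definable_cong)
    fix B :: "nat struct" and \<beta> :: "nat \<Rightarrow> nat"
    assume B: "is_struct \<sigma> B"
    show "(\<exists>i \<in> {..<length \<sigma>}. \<exists>t \<in> rels B i. \<beta> x \<in> set t \<and> \<beta> y \<in> set t) \<longleftrightarrow>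
      (\<exists>i. \<exists>t \<in> rels B i. \<beta> x \<in> set t \<and> \<beta> y \<in> set t)"
      using rels_univ(2)[OF B] by blast
  qed simp
qed

lemma definable_nbhd: "definable \<sigma> (insert x (set zs)) (\<lambda>B \<beta>. \<beta> x \<in> nbhd B s (map \<beta> zs))"
proof (induction s arbitrary: x)
  case 0
  have "definable \<sigma> (insert x (set zs)) (\<lambda>B \<beta>. \<exists>z \<in> set zs. \<beta> z = \<beta> x)"
    by (intro definable_bex definable_eq) auto
  then show ?case
  proof (rule definable_cong)
    fix B :: "nat struct" and \<beta> :: "nat \<Rightarrow> nat"
    assume "\<beta> ` insert x (set zs) \<subseteq> univ B"
    then have "nbhd B 0 (map \<beta> zs) = set (map \<beta> zs)" by (intro nbhd_0) auto
    then show "(\<exists>z \<in> set zs. \<beta> z = \<beta> x) \<longleftrightarrow> \<beta> x \<in> nbhd B 0 (map \<beta> zs)"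
      by (simp add: image_iff) metis
  qed simp
next
  case (Suc s)
  obtain ys :: "nat list" where "length ys = 1" "distinct ys" "set ys \<inter> insert x (set zs) = {}"
    by (rule fresh_list[of "insert x (set zs)" 1]) auto
  then obtain y where y: "x \<noteq> y" "y \<notin> set zs" by (cases ys) auto
  let ?V = "insert y (insert x (set zs))"
  have "definable \<sigma> ?V (\<lambda>B \<beta>. \<beta> y \<in> nbhd B s (map \<beta> zs) \<and> (\<exists>i. \<exists>t \<in> rels B i. \<beta> y \<in> set t \<and> \<beta> x \<in> set t))"
    by (intro definable_conj definable_mono[OF Suc.IH] definable_mono[OF definable_adj]) auto
  from definable_disj[OF definable_ex[OF this] Suc.IH[of x]]
  show ?case
  proof (rule definable_cong)
    fix B :: "nat struct" and \<beta> :: "nat \<Rightarrow> nat"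
    assume B: "is_struct \<sigma> B"
    have m: "map (\<beta>(y := a)) zs = map \<beta> zs" for a using y(2) by auto
    \<comment> \<open>This weaker adjacency agrees with the Gaifman relation here: if
      \<open>\<beta> x\<close> equaled \<open>c\<close>, it would already lie in the smaller ball,
      which is a separate disjunct.\<close>
    have g: "c \<in> nbhd B s (map \<beta> zs) \<Longrightarrow> \<beta> x \<notin> nbhd B s (map \<beta> zs) \<Longrightarrow>
      (\<exists>i. \<exists>t \<in> rels B i. c \<in> set t \<and> \<beta> x \<in> set t) \<longleftrightarrow> (c, \<beta> x) \<in> gaifman B" for c
      by (auto simp: gaifman_def)
    have "c \<in> univ B" if "c \<in> nbhd B s (map \<beta> zs)" for c using that nbhd_univ by fast
    then show "(\<exists>a \<in> univ B. (\<beta>(y := a)) y \<in> nbhd B s (map (\<beta>(y := a)) zs) \<and>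
        (\<exists>i. \<exists>t \<in> rels B i. (\<beta>(y := a)) y \<in> set t \<and> (\<beta>(y := a)) x \<in> set t)) \<or> \<beta> x \<in> nbhd B s (map \<beta> zs) \<longleftrightarrow>
      \<beta> x \<in> nbhd B (Suc s) (map \<beta> zs)"
      unfolding nbhd_Suc[OF B] m using g y(1) by simp blast
  qed auto
qed

text \<open>With the universe of \<open>A\<close> enumerated by \<open>ps\<close>, a bijection is
  the list \<open>as\<close> of its images, and being an isomorphism becomes a finite list of
  conditions on entries of \<open>as\<close>. Tuples of a wrong length need no condition, since no
  relation contains them.\<close>

lemma iso_sphere_iff_enum:
  fixes A B :: "nat struct"
  assumes B: "is_struct \<sigma> B" and A: "is_struct \<sigma> A" and cs: "set cs \<subseteq> univ A"
    and ps: "distinct ps" "set ps = univ A"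
    and idx: "\<And>p. p \<in> set ps \<Longrightarrow> idx p < length ps \<and> ps ! idx p = p"
  shows "iso (A, cs) (sphere B s bs) \<longleftrightarrow>
    (\<exists>as. length as = length ps \<and> set as \<subseteq> univ B \<and> distinct as \<and> set as = nbhd B s bs \<and>
      map (\<lambda>p. as ! idx p) cs = bs \<and>
      (\<forall>i < length \<sigma>. \<forall>t \<in> set (List.n_lists (\<sigma> ! i) ps). t \<in> rels A i \<longleftrightarrow> map (\<lambda>p. as ! idx p) t \<in> rels B i))"
proof -
  have rs: "t \<in> rels (fst (sphere B s bs)) i \<longleftrightarrow> t \<in> rels B i \<and> set t \<subseteq> nbhd B s bs" for t i
    by (auto simp: sphere_def induced_def)
  have ss: "snd (sphere B s bs) = bs" by (simp add: sphere_def)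
  show ?thesis
  proof
    assume "iso (A, cs) (sphere B s bs)"
    then obtain f where f: "bij_betw f (univ A) (nbhd B s bs)" "map f cs = bs"
      "\<And>i t. set t \<subseteq> univ A \<Longrightarrow> t \<in> rels A i \<longleftrightarrow> map f t \<in> rels B i \<and> set (map f t) \<subseteq> nbhd B s bs"
      unfolding iso_def univ_sphere rs ss by auto
    have fp: "map f ps ! idx p = f p" if "p \<in> univ A" for p using idx[of p] that ps by auto
    then have mf: "map (\<lambda>p. map f ps ! idx p) t = map f t" if "set t \<subseteq> univ A" for t using that by auto
    show "\<exists>as. length as = length ps \<and> set as \<subseteq> univ B \<and> distinct as \<and> set as = nbhd B s bs \<and>
      map (\<lambda>p. as ! idx p) cs = bs \<and>
      (\<forall>i < length \<sigma>. \<forall>t \<in> set (List.n_lists (\<sigma> ! i) ps). t \<in> rels A i \<longleftrightarrow> map (\<lambda>p. as ! idx p) t \<in> rels B i)"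
    proof (intro exI conjI allI impI ballI)
      show "set (map f ps) = nbhd B s bs" using f(1) ps by (simp add: bij_betw_def)
      then show "set (map f ps) \<subseteq> univ B" using nbhd_univ[of B s bs] by simp
      show "distinct (map f ps)" using f(1) ps by (simp add: bij_betw_def distinct_map)
      show "map (\<lambda>p. map f ps ! idx p) cs = bs" using mf[OF cs] f(2) by simp
      fix i t assume "t \<in> set (List.n_lists (\<sigma> ! i) ps)"
      then have t: "set t \<subseteq> univ A" using ps by (auto simp: set_n_lists)
      then have "set (map f t) \<subseteq> nbhd B s bs" using f(1) by (auto simp: bij_betw_def)
      then show "t \<in> rels A i \<longleftrightarrow> map (\<lambda>p. map f ps ! idx p) t \<in> rels B i"
        unfolding mf[OF t] using f(3)[OF t] by blast
    qed simp
  next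
    assume "\<exists>as. length as = length ps \<and> set as \<subseteq> univ B \<and> distinct as \<and> set as = nbhd B s bs \<and>
      map (\<lambda>p. as ! idx p) cs = bs \<and>
      (\<forall>i < length \<sigma>. \<forall>t \<in> set (List.n_lists (\<sigma> ! i) ps). t \<in> rels A i \<longleftrightarrow> map (\<lambda>p. as ! idx p) t \<in> rels B i)"
    then obtain as where as: "length as = length ps" "distinct as" "set as = nbhd B s bs"
      "map (\<lambda>p. as ! idx p) cs = bs"
      "\<And>i t. i < length \<sigma> \<Longrightarrow> t \<in> set (List.n_lists (\<sigma> ! i) ps) \<Longrightarrow>
         t \<in> rels A i \<longleftrightarrow> map (\<lambda>p. as ! idx p) t \<in> rels B i" by blast
    let ?f = "\<lambda>p. as ! idx p"
    have mp: "map ?f ps = as"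
    proof (rule nth_equalityI)
      fix i assume i: "i < length (map ?f ps)"
      then have "idx (ps ! i) = i" using idx[of "ps ! i"] ps(1) by (auto simp: nth_eq_iff_index_eq)
      then show "map ?f ps ! i = as ! i" using i by simp
    qed (simp add: as)
    have im: "?f ` univ A = nbhd B s bs" unfolding ps(2)[symmetric] as(3)[symmetric] using mp by (metis list.set_map)
    moreover have "inj_on ?f (univ A)" unfolding ps(2)[symmetric] using mp as(2) by (metis distinct_map)
    ultimately have bij: "bij_betw ?f (univ A) (nbhd B s bs)" by (simp add: bij_betw_def)
    have "t \<in> rels A i \<longleftrightarrow> map ?f t \<in> rels B i \<and> set (map ?f t) \<subseteq> nbhd B s bs" if t: "set t \<subseteq> univ A" for t i
    proof (cases "i < length \<sigma> \<and> length t = \<sigma> ! i")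
      case True
      then have "t \<in> set (List.n_lists (\<sigma> ! i) ps)" using t ps by (simp add: set_n_lists)
      moreover have "set (map ?f t) \<subseteq> nbhd B s bs" using t unfolding im[symmetric] by auto
      ultimately show ?thesis using as(5) True by blast
    next
      case False
      then show ?thesis using rels_univ[OF A, of t i] rels_univ[OF B, of "map ?f t" i] by auto
    qed
    then show "iso (A, cs) (sphere B s bs)"
      unfolding iso_def univ_sphere rs ss fst_conv snd_conv using bij as(4) by blast
  qed
qed

lemma definable_iso_sphere:
  fixes A :: "nat struct"
  assumes A: "is_struct \<sigma> A" and cs: "set cs \<subseteq> univ A" and zs: "distinct zs" "length zs = length cs"
  shows "definable \<sigma> (set zs) (\<lambda>B \<beta>. iso (A, cs) (sphere B s (map \<beta> zs)))"
proof -
  obtain ps where ps: "distinct ps" "set ps = univ A"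
    using finite_distinct_list A by (metis is_struct_def)
  have "\<forall>p. \<exists>i. p \<in> set ps \<longrightarrow> i < length ps \<and> ps ! i = p" by (metis in_set_conv_nth)
  then obtain idx where idx: "\<And>p. p \<in> set ps \<Longrightarrow> idx p < length ps \<and> ps ! idx p = p" by metis
  obtain ys where ys: "length ys = length ps" "distinct ys" "set ys \<inter> set zs = {}"
    using fresh_list[of "set zs" "length ps"] by auto
  obtain ws where "length ws = 1" "distinct ws" "set ws \<inter> (set zs \<union> set ys) = {}"
    by (rule fresh_list[of "set zs \<union> set ys" 1]) auto
  then obtain w where w: "w \<notin> set zs" "w \<notin> set ys" by (cases ws) auto
  let ?V = "set zs \<union> set ys" and ?m = "length ps"
  have yi: "ys ! idx p \<in> ?V" if "p \<in> univ A" for p using idx[of p] that ys ps by simp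
  have yi': "ys ! i \<in> ?V" if "i < ?m" for i using that ys by simp
  have csA: "cs ! j \<in> univ A" if "j < length cs" for j using that cs nth_mem by blast
  \<comment> \<open>The variables \<open>ys\<close> guess the images of \<open>ps\<close>: distinct
    (\<open>?dist\<close>), inside the ball (\<open>?sub\<close>), covering it (\<open>?sup\<close>,
    with \<open>w\<close> running over the universe), sending centers to \<open>zs\<close>
    (\<open>?cen\<close>) and respecting the relations of \<open>A\<close>
    (\<open>?rel\<close>).\<close>
  let ?dist = "\<lambda>\<beta>. \<forall>i \<in> {..<?m}. \<forall>j \<in> {..<?m} - {i}. \<not> \<beta> (ys ! i) = \<beta> (ys ! j)"
  let ?sub = "\<lambda>B \<beta>. \<forall>i \<in> {..<?m}. \<beta> (ys ! i) \<in> nbhd B s (map \<beta> zs)"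
  let ?sup = "\<lambda>B \<beta>. \<forall>a \<in> univ B. (\<not> (\<beta>(w := a)) w \<in> nbhd B s (map (\<beta>(w := a)) zs)) \<or>
    (\<exists>i \<in> {..<?m}. (\<beta>(w := a)) w = (\<beta>(w := a)) (ys ! i))"
  let ?cen = "\<lambda>\<beta>. \<forall>j \<in> {..<length cs}. \<beta> (ys ! idx (cs ! j)) = \<beta> (zs ! j)"
  let ?rel = "\<lambda>B \<beta>. \<forall>i \<in> {..<length \<sigma>}. \<forall>t \<in> set (List.n_lists (\<sigma> ! i) ps).
    t \<in> rels A i \<longleftrightarrow> map \<beta> (map (\<lambda>p. ys ! idx p) t) \<in> rels B i"
  have d: "definable \<sigma> ?V (\<lambda>B \<beta>. ?dist \<beta>)"
    using yi' by (intro definable_ball definable_neg definable_eq) auto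
  have sb: "definable \<sigma> ?V ?sub"
    using yi' by (intro definable_ball definable_mono[OF definable_nbhd]) auto
  have sp: "definable \<sigma> ?V ?sup"
    using yi' by (intro definable_all definable_disj definable_neg definable_bex definable_eq definable_mono[OF definable_nbhd]) auto
  have cn: "definable \<sigma> ?V (\<lambda>B \<beta>. ?cen \<beta>)"
    using yi csA zs by (intro definable_ball definable_eq) auto
  have rl: "definable \<sigma> ?V ?rel"
  proof (intro definable_ball)
    fix i t assume i: "i \<in> {..<length \<sigma>}" and t: "t \<in> set (List.n_lists (\<sigma> ! i) ps)"
    have "definable \<sigma> ?V (\<lambda>B \<beta>. map \<beta> (map (\<lambda>p. ys ! idx p) t) \<in> rels B i)"
      using i t yi ps by (intro definable_rel) (auto simp: set_n_lists subset_iff)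
    \<comment> \<open>Whether \<open>t\<close> belongs to \<open>A\<close> is already decided, so
      the equivalence is an atom or a negated atom.\<close>
    from this definable_neg[OF this]
    show "definable \<sigma> ?V (\<lambda>B \<beta>. t \<in> rels A i \<longleftrightarrow> map \<beta> (map (\<lambda>p. ys ! idx p) t) \<in> rels B i)"
      by (cases "t \<in> rels A i") simp_all
  qed auto
  have "definable \<sigma> ?V (\<lambda>B \<beta>. ?dist \<beta> \<and> ?sub B \<beta> \<and> ?sup B \<beta> \<and> ?cen \<beta> \<and> ?rel B \<beta>)"
    by (intro definable_conj d sb sp cn rl)
  from definable_exs[OF this ys(2)] show ?thesis
  proof (rule definable_cong)
    fix B :: "nat struct" and \<beta> :: "nat \<Rightarrow> nat"
    assume B: "is_struct \<sigma> B" and \<beta>: "\<beta> ` set zs \<subseteq> univ B"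
    let ?bs = "map \<beta> zs"
    have "?dist (upds \<beta> ys as) \<and> ?sub B (upds \<beta> ys as) \<and> ?sup B (upds \<beta> ys as) \<and> ?cen (upds \<beta> ys as) \<and>
        ?rel B (upds \<beta> ys as) \<longleftrightarrow>
      distinct as \<and> set as = nbhd B s ?bs \<and> map (\<lambda>p. as ! idx p) cs = ?bs \<and>
      (\<forall>i < length \<sigma>. \<forall>t \<in> set (List.n_lists (\<sigma> ! i) ps). t \<in> rels A i \<longleftrightarrow> map (\<lambda>p. as ! idx p) t \<in> rels B i)"
      if as: "length as = length ys" "set as \<subseteq> univ B" for as
    proof -
      let ?\<gamma> = "upds \<beta> ys as"
      have gy: "?\<gamma> (ys ! i) = as ! i" if "i < ?m" for i
        using map_upds_self[OF ys(2) as(1), of \<beta>] that ys(1) by (metis nth_map)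
      have gz: "?\<gamma> z = \<beta> z" if "z \<in> set zs" for z
        using ys(3) as(1) that by (intro upds_notin) auto
      have mz: "map ?\<gamma> zs = ?bs" using gz by simp
      have mzw: "map (?\<gamma>(w := a)) zs = ?bs" for a using gz w(1) by auto
      have yw: "(?\<gamma>(w := a)) (ys ! i) = as ! i" if "i < ?m" for i a
        using gy[OF that] w(2) that ys(1) nth_mem[of i ys] by auto
      have 1: "?dist ?\<gamma> \<longleftrightarrow> distinct as" using gy as(1) ys(1) by (auto simp: distinct_conv_nth)
      have sas: "set as = (\<lambda>i. as ! i) ` {..<?m}" using as(1) ys(1) by (auto simp: in_set_conv_nth)
      have 2: "?sub B ?\<gamma> \<longleftrightarrow> set as \<subseteq> nbhd B s ?bs"
        unfolding mz sas using gy by auto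
      have 3: "?sup B ?\<gamma> \<longleftrightarrow> nbhd B s ?bs \<subseteq> set as"
      proof -
        have "?sup B ?\<gamma> \<longleftrightarrow> (\<forall>a \<in> univ B. a \<notin> nbhd B s ?bs \<or> (\<exists>i \<in> {..<?m}. a = as ! i))"
          unfolding mzw using yw by auto
        also have "\<dots> \<longleftrightarrow> nbhd B s ?bs \<subseteq> set as"
          unfolding sas using nbhd_univ[of B s ?bs] by blast
        finally show ?thesis .
      qed
      have idxm: "idx p < ?m" if "p \<in> univ A" for p using idx[of p] that ps by simp
      have gi: "?\<gamma> (ys ! idx p) = as ! idx p" if "p \<in> univ A" for p using gy idxm[OF that] by simp
      have 4: "?cen ?\<gamma> \<longleftrightarrow> map (\<lambda>p. as ! idx p) cs = ?bs"
        using gi csA gz zs by (auto simp: list_eq_iff_nth_eq)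
      have 5: "map ?\<gamma> (map (\<lambda>p. ys ! idx p) t) = map (\<lambda>p. as ! idx p) t" if "t \<in> set (List.n_lists n ps)" for t n
        using that gi ps by (auto simp: set_n_lists)
      have 5: "?rel B ?\<gamma> \<longleftrightarrow> (\<forall>i < length \<sigma>. \<forall>t \<in> set (List.n_lists (\<sigma> ! i) ps).
          t \<in> rels A i \<longleftrightarrow> map (\<lambda>p. as ! idx p) t \<in> rels B i)"
      proof (rule iffI; intro allI impI ballI)
        fix i t assume "?rel B ?\<gamma>" "i < length \<sigma>" and t: "t \<in> set (List.n_lists (\<sigma> ! i) ps)"
        then have "t \<in> rels A i \<longleftrightarrow> map ?\<gamma> (map (\<lambda>p. ys ! idx p) t) \<in> rels B i" by blast
        then show "t \<in> rels A i \<longleftrightarrow> map (\<lambda>p. as ! idx p) t \<in> rels B i" by (simp only: 5[OF t])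
      next
        fix i t
        assume *: "\<forall>i < length \<sigma>. \<forall>t \<in> set (List.n_lists (\<sigma> ! i) ps).
          t \<in> rels A i \<longleftrightarrow> map (\<lambda>p. as ! idx p) t \<in> rels B i"
          "i \<in> {..<length \<sigma>}" and t: "t \<in> set (List.n_lists (\<sigma> ! i) ps)"
        then show "t \<in> rels A i \<longleftrightarrow> map ?\<gamma> (map (\<lambda>p. ys ! idx p) t) \<in> rels B i" unfolding 5[OF t] by blast
      qed
      show ?thesis unfolding 1 2 3 4 5 by blast
    qed
    note main = this[unfolded ys(1)]
    show "(\<exists>as. length as = length ys \<and> set as \<subseteq> univ B \<and> ?dist (upds \<beta> ys as) \<and> ?sub B (upds \<beta> ys as) \<and>
        ?sup B (upds \<beta> ys as) \<and> ?cen (upds \<beta> ys as) \<and> ?rel B (upds \<beta> ys as)) \<longleftrightarrow>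
      iso (A, cs) (sphere B s ?bs)"
      unfolding ys(1)
      apply (rule trans[OF ex_cong1 iso_sphere_iff_enum[OF B A cs ps idx, symmetric]])
      subgoal for as using main[of as] by argo
      by assumption
  qed simp
qed

lemma sphere_formula_exists:
  assumes \<tau>: "is_type \<sigma> s \<tau>" and zs: "distinct zs" "length zs = length (snd \<tau>)"
  shows "\<exists>\<chi>. sphere_formula \<sigma> s \<tau> zs \<chi>"
proof -
  have cs: "set (snd \<tau>) \<subseteq> univ (fst \<tau>)" using \<tau> unfolding is_type_def by blast
  have "definable \<sigma> (set zs) (\<lambda>B \<beta>. iso \<tau> (sphere B s (map \<beta> zs)))"
    using definable_iso_sphere[OF _ cs zs, of \<sigma> s] \<tau> unfolding is_type_def by simp
  then obtain \<chi> where \<chi>: "fo_wf \<sigma> \<chi>" "fo_fv \<chi> \<subseteq> set zs"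
    "\<forall>(B :: nat struct) \<beta>. is_struct \<sigma> B \<longrightarrow> univ B \<noteq> {} \<longrightarrow> \<beta> ` set zs \<subseteq> univ B \<longrightarrow>
      (fo_sat B \<chi> \<beta> \<longleftrightarrow> iso \<tau> (sphere B s (map \<beta> zs)))"
    unfolding definable_def by (elim exE conjE) (rule that)
  have "fo_sat B \<chi> (asg zs bs) \<longleftrightarrow> iso (sphere B s bs) \<tau>"
    if B: "is_struct \<sigma> B" "univ B \<noteq> {}" and bs: "length bs = length zs" "set bs \<subseteq> univ B" for B :: "nat struct" and bs
  proof -
    have m: "map (asg zs bs) zs = bs" using map_upds_self[OF zs(1) bs(1)] .
    then have "asg zs bs ` set zs \<subseteq> univ B" using bs(2) by (metis list.set_map)
    from \<chi>(3)[rule_format, OF B this] have "fo_sat B \<chi> (asg zs bs) \<longleftrightarrow> iso \<tau> (sphere B s bs)" unfolding m .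
    moreover have "set (snd (sphere B s bs)) \<subseteq> univ (fst (sphere B s bs))"
      using nbhd_center[OF bs(2)] unfolding univ_sphere by (simp add: sphere_def)
    ultimately show ?thesis using iso_sym cs by blast
  qed
  then show ?thesis using \<tau> zs \<chi>(1,2) unfolding sphere_formula_def by blast
qed

text \<open>Passing to an induced substructure could increase distances. Balls around the centers up
  to radius \<open>s\<close> are safe: an edge from a point at distance at most \<open>j < s\<close>
  is witnessed by a tuple in the ball of radius \<open>Suc j\<close>, which survives.\<close>

lemma is_type_sphere:
  assumes B: "is_struct \<sigma> B" and a: "set a \<subseteq> univ B"
  shows "is_type \<sigma> s (sphere B s a)"
proof -
  let ?I = "induced B (nbhd B s a)"
  have uI: "univ ?I = nbhd B s a" using univ_sphere[of B s a] by (simp add: sphere_def)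
  have I: "is_struct \<sigma> ?I"
    using B finite_nbhd[OF B, of s a] unfolding is_struct_def uI
    by (auto simp: induced_def is_struct_def)
  have "nbhd ?I j a = nbhd B j a" if "j \<le> s" for j
    using that
  proof (induction j)
    case 0
    then show ?case using nbhd_0[of a ?I] nbhd_0[OF a] uI nbhd_center[OF a, of s] by simp
  next
    case (Suc j)
    have "(c, b) \<in> gaifman ?I \<longleftrightarrow> (c, b) \<in> gaifman B" if c: "c \<in> nbhd B j a" for c b
    proof
      assume "(c, b) \<in> gaifman B"
      then obtain i t where t: "t \<in> rels B i" "c \<in> set t" "b \<in> set t" "c \<noteq> b" by (auto simp: gaifman_def)
      have "set t \<subseteq> nbhd B s a"
        using nbhd_tuple[OF B t(1,2) c] nbhd_mono[OF Suc.prems, of a a B] by auto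
      then have "t \<in> rels ?I i" using t by (simp add: induced_def)
      then show "(c, b) \<in> gaifman ?I" using t by (auto simp: gaifman_def)
    qed (auto simp: gaifman_def induced_def)
    then show ?case using Suc unfolding nbhd_Suc[OF I] nbhd_Suc[OF B] by auto
  qed
  from this[of s] have "nbhd ?I s a = nbhd B s a" by simp
  then show ?thesis
    using I nbhd_center[OF a, of s] uI by (simp add: is_type_def sphere_def)
qed

section \<open>Finitely many queries determine a sphere\<close>

text \<open>An index out of range stays at \<open>a\<close>. In a structure of degree at most \<open>d\<close> the words of length exactly
  \<open>s\<close> over \<open>{0..d}\<close> therefore lead to the whole \<open>s\<close>-neighborhood, and \<open>d\<close> itself always stays.\<close>

definition nxt :: "(nat \<Rightarrow> nat list) \<Rightarrow> nat \<Rightarrow> nat \<Rightarrow> nat" where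
  "nxt N a j = (if j < length (N a) then N a ! j else a)"

definition walk :: "(nat \<Rightarrow> nat list) \<Rightarrow> nat \<Rightarrow> nat list \<Rightarrow> nat" where
  "walk N a js = foldl (nxt N) a js"

definition words :: "nat \<Rightarrow> nat \<Rightarrow> nat list list" where
  "words d s = List.n_lists s [0..<Suc d]"

definition addrs :: "nat \<Rightarrow> nat \<Rightarrow> nat \<Rightarrow> (nat \<times> nat list) list" where
  "addrs d s m = List.product [0..<m] (words d s)"

definition elems :: "(nat \<Rightarrow> nat list) \<Rightarrow> nat \<Rightarrow> nat \<Rightarrow> nat list \<Rightarrow> nat list" where
  "elems N d s as = map (\<lambda>(p, js). walk N (as ! p) js) (addrs d s (length as))"

datatype atom = AEq nat nat | ARel nat "nat list"

primrec holds :: "(nat \<Rightarrow> nat list \<Rightarrow> bool) \<Rightarrow> nat list \<Rightarrow> atom \<Rightarrow> bool" where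
  "holds R es (AEq i j) = (es ! i = es ! j)"
| "holds R es (ARel i is) = R i (map ((!) es) is)"

definition atoms :: "signature \<Rightarrow> nat \<Rightarrow> atom list" where
  "atoms \<sigma> W = map (\<lambda>(i, j). AEq i j) (List.product [0..<W] [0..<W]) @
     concat (map (\<lambda>i. map (ARel i) (List.n_lists (\<sigma> ! i) [0..<W])) [0..<length \<sigma>])"

text \<open>The pattern depends on the order in which \<open>N\<close> lists neighbors, so isomorphic spheres may have
  different patterns; only the converse holds.\<close>

definition pattern ::
  "signature \<Rightarrow> nat \<Rightarrow> nat \<Rightarrow> (nat \<Rightarrow> nat list \<Rightarrow> bool) \<Rightarrow> (nat \<Rightarrow> nat list) \<Rightarrow> nat list \<Rightarrow> bool list" where
  "pattern \<sigma> d s R N as = map (holds R (elems N d s as)) (atoms \<sigma> (length (addrs d s (length as))))"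

definition admissible ::
  "signature \<Rightarrow> nat \<Rightarrow> nat struct \<Rightarrow> (nat \<Rightarrow> nat list \<Rightarrow> bool) \<Rightarrow> (nat \<Rightarrow> nat list) \<Rightarrow> bool" where
  "admissible \<sigma> d B R N \<longleftrightarrow> is_struct \<sigma> B \<and> univ B \<noteq> {} \<and> degree B \<le> d \<and> local_access B R N"

lemma admissible_N:
  assumes "admissible \<sigma> d B R N"
  shows "set (N a) = nbrs B a" "length (N a) \<le> d"
proof -
  have d: "distinct (N a)" and N: "set (N a) = nbrs B a"
    using assms by (auto simp: admissible_def local_access_def)
  show "set (N a) = nbrs B a" by (rule N)
  have B: "is_struct \<sigma> B" "degree B \<le> d" using assms by (auto simp: admissible_def)
  show "length (N a) \<le> d"
  proof (cases "a \<in> univ B")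
    case True
    have "finite (univ B)" using B by (simp add: is_struct_def)
    then have "card (nbrs B a) \<le> degree B" unfolding degree_def using True by (intro Max_ge) auto
    then show ?thesis using d N B(2) distinct_card by fastforce
  next
    case False
    then have "nbrs B a = {}" using gaifman_univ(1)[OF B(1)] by (auto simp: nbrs_def)
    then show ?thesis using N by simp
  qed
qed

lemma walk_snoc: "walk N a (js @ [j]) = nxt N (walk N a js) j"
  by (simp add: walk_def)

lemma set_words: "js \<in> set (words d s) \<longleftrightarrow> length js = s \<and> (\<forall>j \<in> set js. j \<le> d)"
  unfolding words_def set_n_lists by (auto simp: subset_iff less_Suc_eq_le)

text \<open>One step from \<open>c\<close> reaches exactly \<open>c\<close> and its neighbors: a
  neighbor by its index in \<open>N c\<close>, and \<open>c\<close> by index \<open>d\<close>, which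
  the degree bound puts out of range. Iterating this matches \<open>nbhd_Suc\<close>.\<close>

lemma walk_image:
  assumes "admissible \<sigma> d B R N" "a \<in> univ B"
  shows "walk N a ` set (words d s) = nbhd B s [a]"
proof (induction s)
  case 0
  then show ?case using nbhd_0[of "[a]" B] assms(2) by (auto simp: words_def walk_def)
next
  case (Suc s)
  have B: "is_struct \<sigma> B" using assms by (simp add: admissible_def)
  have n: "nxt N c ` {..d} = insert c (nbrs B c)" for c
  proof (intro equalityI subsetI)
    fix x assume "x \<in> insert c (nbrs B c)"
    then consider "x = c" | j where "j < length (N c)" "x = N c ! j"
      using admissible_N(1)[OF assms(1), of c] by (metis in_set_conv_nth insertE)
    then show "x \<in> nxt N c ` {..d}"
    proof cases
      case 1
      then show ?thesis using admissible_N(2)[OF assms(1), of c]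
        by (intro image_eqI[of _ _ d]) (auto simp: nxt_def)
    next
      case 2
      then show ?thesis using admissible_N(2)[OF assms(1), of c]
        by (intro image_eqI[of _ _ j]) (auto simp: nxt_def)
    qed
  next
    fix x assume "x \<in> nxt N c ` {..d}"
    then obtain j where j: "x = nxt N c j" by blast
    have "N c ! j \<in> nbrs B c" if "j < length (N c)"
      using nth_mem[OF that] admissible_N(1)[OF assms(1), of c] by simp
    then show "x \<in> insert c (nbrs B c)" using j by (simp add: nxt_def)
  qed
  have "walk N a ` set (words d (Suc s)) = (\<Union>js \<in> set (words d s). nxt N (walk N a js) ` {..d})"
  proof (intro equalityI subsetI)
    fix x assume "x \<in> walk N a ` set (words d (Suc s))"
    then obtain js where js: "js \<in> set (words d (Suc s))" "x = walk N a js" by blast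
    then have "js \<noteq> []" by (auto simp: set_words)
    then have "js = butlast js @ [last js]" "butlast js \<in> set (words d s)" "last js \<le> d"
      using js(1) by (auto simp: set_words dest: in_set_butlastD)
    then show "x \<in> (\<Union>js \<in> set (words d s). nxt N (walk N a js) ` {..d})"
      using js(2) walk_snoc[of N a "butlast js" "last js"] by auto
  next
    fix x assume "x \<in> (\<Union>js \<in> set (words d s). nxt N (walk N a js) ` {..d})"
    then obtain js j where js: "js \<in> set (words d s)" "j \<le> d" "x = nxt N (walk N a js) j" by blast
    then have "js @ [j] \<in> set (words d (Suc s))" by (auto simp: set_words)
    then show "x \<in> walk N a ` set (words d (Suc s))" using js(3) walk_snoc by (metis image_eqI)
  qed
  also have "\<dots> = (\<Union>c \<in> nbhd B s [a]. insert c (nbrs B c))" unfolding n Suc[symmetric] by simp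
  also have "\<dots> = nbhd B (Suc s) [a]" unfolding nbhd_Suc[OF B] by (auto simp: nbrs_def)
  finally show ?case .
qed

lemma set_elems:
  assumes "admissible \<sigma> d B R N" "set as \<subseteq> univ B"
  shows "set (elems N d s as) = nbhd B s as"
proof -
  have "set (elems N d s as) = (\<Union>a \<in> set as. walk N a ` set (words d s))"
    unfolding elems_def addrs_def by (fastforce simp: in_set_conv_nth image_iff)
  also have "\<dots> = (\<Union>a \<in> set as. nbhd B s [a])"
    using walk_image[OF assms(1)] assms(2) by (intro SUP_cong) auto
  also have "\<dots> = nbhd B s as" using nbhd_iff_single[of _ B s as] by blast
  finally show ?thesis .
qed

lemma walk_stay:
  assumes "admissible \<sigma> d B R N"
  shows "walk N a (replicate s d) = a"
proof (induction s)
  case (Suc s)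
  then show ?case using admissible_N(2)[OF assms, of a] walk_snoc[of N a "replicate s d" d]
    by (simp add: replicate_append_same[symmetric] nxt_def del: replicate.simps replicate_append_same)
       (simp add: replicate_append_same)
qed (simp add: walk_def)

lemma elems_center:
  assumes "admissible \<sigma> d B R N" "i < length (addrs d s (length as))" "addrs d s (length as) ! i = (p, replicate s d)"
  shows "elems N d s as ! i = as ! p"
  using assms(2,3) walk_stay[OF assms(1)] by (simp add: elems_def)

lemma pattern_eqD:
  assumes "pattern \<sigma> d s R N as = pattern \<sigma> d s R' N' as'" and l: "length as' = length as"
  defines "W \<equiv> length (addrs d s (length as))"
  shows "\<And>i j. i < W \<Longrightarrow> j < W \<Longrightarrow> elems N d s as ! i = elems N d s as ! j \<longleftrightarrow> elems N' d s as' ! i = elems N' d s as' ! j"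
    and "\<And>i is. i < length \<sigma> \<Longrightarrow> length is = \<sigma> ! i \<Longrightarrow> set is \<subseteq> {..<W} \<Longrightarrow>
      R i (map ((!) (elems N d s as)) is) \<longleftrightarrow> R' i (map ((!) (elems N' d s as')) is)"
proof -
  have *: "holds R (elems N d s as) a \<longleftrightarrow> holds R' (elems N' d s as') a" if "a \<in> set (atoms \<sigma> W)" for a
    using assms(1) that by (simp add: pattern_def l W_def)
  show "elems N d s as ! i = elems N d s as ! j \<longleftrightarrow> elems N' d s as' ! i = elems N' d s as' ! j"
    if "i < W" "j < W" for i j
  proof -
    have "AEq i j \<in> set (atoms \<sigma> W)" using that by (force simp: atoms_def)
    from *[OF this] show ?thesis by simp
  qed
  show "R i (map ((!) (elems N d s as)) is) \<longleftrightarrow> R' i (map ((!) (elems N' d s as')) is)"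
    if "i < length \<sigma>" "length is = \<sigma> ! i" "set is \<subseteq> {..<W}" for i "is"
  proof -
    have "is \<in> set (List.n_lists (\<sigma> ! i) [0..<W])" using that by (auto simp: set_n_lists)
    then have "ARel i is \<in> set (atoms \<sigma> W)" using that(1) by (auto simp: atoms_def)
    from *[OF this] show ?thesis by simp
  qed
qed

text \<open>The isomorphism sends the element at an address to the element at the same address.
  Equality atoms make it well defined and injective, relation atoms make it preserve relations, and
  the word \<open>replicate s d\<close> takes care of the centers. The two structures may
  differ.\<close>

lemma pattern_iso:
  assumes B: "admissible \<sigma> d B R N" "set as \<subseteq> univ B"
    and B': "admissible \<sigma> d B' R' N'" "set as' \<subseteq> univ B'"
    and l: "length as' = length as" and p: "pattern \<sigma> d s R N as = pattern \<sigma> d s R' N' as'"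
  shows "iso (sphere B s as) (sphere B' s as')"
proof -
  let ?e = "elems N d s as" and ?e' = "elems N' d s as'"
  define W where "W = length (addrs d s (length as))"
  have le: "length ?e = W" "length ?e' = W" by (simp_all add: elems_def W_def l)
  note se = set_elems[OF B, of s] set_elems[OF B', of s]
  note eq = pattern_eqD(1)[OF p l, folded W_def] and rel = pattern_eqD(2)[OF p l, folded W_def]
  have st: "is_struct \<sigma> B" "is_struct \<sigma> B'" using B B' by (simp_all add: admissible_def)
  have R: "R i t \<longleftrightarrow> t \<in> rels B i" "R' i t \<longleftrightarrow> t \<in> rels B' i" for i t
    using B(1) B'(1) by (auto simp: admissible_def local_access_def)
  have "\<forall>x. \<exists>i. x \<in> set ?e \<longrightarrow> i < W \<and> ?e ! i = x" by (metis in_set_conv_nth le(1))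
  then obtain ix where ix: "\<And>x. x \<in> set ?e \<Longrightarrow> ix x < W \<and> ?e ! ix x = x" by metis
  let ?f = "\<lambda>x. ?e' ! ix x"
  have f: "?f (?e ! i) = ?e' ! i" if "i < W" for i
    using eq[of "ix (?e ! i)" i] ix[of "?e ! i"] that le by simp
  have inj: "inj_on ?f (set ?e)"
  proof (rule inj_onI)
    fix x y assume "x \<in> set ?e" "y \<in> set ?e" "?f x = ?f y"
    then show "x = y" using eq[of "ix x" "ix y"] ix by metis
  qed
  have "?f ` set ?e = set ?e'"
  proof (intro equalityI subsetI)
    fix y assume "y \<in> ?f ` set ?e"
    then show "y \<in> set ?e'" using ix le by auto
  next
    fix y assume "y \<in> set ?e'"
    then obtain i where "i < W" "y = ?e' ! i" using le by (auto simp: in_set_conv_nth)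
    then show "y \<in> ?f ` set ?e" using f[of i] le by (metis image_eqI nth_mem)
  qed
  then have bij: "bij_betw ?f (nbhd B s as) (nbhd B' s as')" using inj unfolding se bij_betw_def by blast
  have "?f (as ! p) = as' ! p" if p: "p < length as" for p
  proof -
    have "(p, replicate s d) \<in> set (addrs d s (length as))"
      using p by (auto simp: addrs_def set_words)
    then obtain i where i: "i < W" "addrs d s (length as) ! i = (p, replicate s d)"
      unfolding W_def by (auto simp: in_set_conv_nth)
    have "?e ! i = as ! p" using elems_center[OF B(1)] i W_def by blast
    moreover have "?e' ! i = as' ! p" using elems_center[OF B'(1), of i s as' p] i W_def l by simp
    ultimately show ?thesis using f[OF i(1)] by simp
  qed
  then have cen: "map ?f as = as'" using l by (intro nth_equalityI) auto
  have im: "set (map ?f t) \<subseteq> nbhd B' s as'" if "set t \<subseteq> nbhd B s as" for t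
    using that bij by (auto simp: bij_betw_def)
  have rr: "t \<in> rels B i \<longleftrightarrow> map ?f t \<in> rels B' i" if t: "set t \<subseteq> nbhd B s as" for t i
  proof (cases "i < length \<sigma> \<and> length t = \<sigma> ! i")
    case True
    have t': "set t \<subseteq> set ?e" using t se by simp
    have s: "set (map ix t) \<subseteq> {..<W}" using ix t' by auto
    have m: "map ((!) ?e) (map ix t) = t" "map ((!) ?e') (map ix t) = map ?f t"
      using ix t' by (auto intro!: map_idI)
    have "length (map ix t) = \<sigma> ! i" using True by simp
    from rel[OF conjunct1[OF True] this s] show ?thesis unfolding m R .
  next
    case False
    then show ?thesis using rels_univ[OF st(1), of t i] rels_univ[OF st(2), of "map ?f t" i] by auto
  qed
  have rs: "t \<in> rels (fst (sphere C s cs)) i \<longleftrightarrow> t \<in> rels C i \<and> set t \<subseteq> nbhd C s cs" for C cs t i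
    by (auto simp: sphere_def induced_def)
  have ss: "snd (sphere C s cs) = cs" for C cs by (simp add: sphere_def)
  show ?thesis
    unfolding iso_def univ_sphere rs ss using bij cen rr im by blast
qed

lemma length_pattern: "length (pattern \<sigma> d s R N as) = length (atoms \<sigma> (length (addrs d s (length as))))"
  by (simp add: pattern_def)

section \<open>Representatives of sphere types and the family of candidate formulas\<close>

definition realizes where
  "realizes \<sigma> d s m \<pi> \<tau> \<longleftrightarrow> (\<exists>B R N as. admissible \<sigma> d B R N \<and> length as = m \<and> set as \<subseteq> univ B \<and>
     \<pi> = pattern \<sigma> d s R N as \<and> \<tau> = sphere B s as)"

text \<open>All spheres showing one pattern are isomorphic by \<open>pattern_iso\<close>, so an
  arbitrary choice among them is harmless.\<close>

definition pattern_type where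
  "pattern_type \<sigma> d s m \<pi> = (SOME \<tau>. realizes \<sigma> d s m \<pi> \<tau>)"

definition patterns where
  "patterns \<sigma> d s m = {\<pi>. \<exists>\<tau>. realizes \<sigma> d s m \<pi> \<tau>}"

lemma pattern_type_realizes: "\<pi> \<in> patterns \<sigma> d s m \<Longrightarrow> realizes \<sigma> d s m \<pi> (pattern_type \<sigma> d s m \<pi>)"
  unfolding patterns_def pattern_type_def by (auto intro: someI_ex)

lemma pattern_in_patterns:
  "admissible \<sigma> d B R N \<Longrightarrow> length as = m \<Longrightarrow> set as \<subseteq> univ B \<Longrightarrow> pattern \<sigma> d s R N as \<in> patterns \<sigma> d s m"
  unfolding patterns_def realizes_def by blast

lemma iso_pattern_type:
  assumes "admissible \<sigma> d B R N" "length as = m" "set as \<subseteq> univ B"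
  shows "iso (sphere B s as) (pattern_type \<sigma> d s m (pattern \<sigma> d s R N as))"
  using pattern_type_realizes[OF pattern_in_patterns[OF assms, of s]] pattern_iso[OF assms(1,3)] assms(2)
  unfolding realizes_def by metis

lemma finite_patterns: "finite (patterns \<sigma> d s m)"
proof (rule finite_subset)
  show "patterns \<sigma> d s m \<subseteq> {\<pi>. set \<pi> \<subseteq> UNIV \<and> length \<pi> = length (atoms \<sigma> (length (addrs d s m)))}"
    by (auto simp: patterns_def realizes_def length_pattern)
qed (intro finite_lists_length_eq finite)

text \<open>Supplies at least one sphere formula, from which a contradiction is built for the empty
  union of types: a Boolean combination has no constants of its own.\<close>

lemma patterns_nonempty: "patterns \<sigma> d s m \<noteq> {}"
proof -
  let ?B = "\<lparr>univ = {0 :: nat}, rels = \<lambda>_. {}\<rparr>"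
  have "gaifman ?B = {}" by (simp add: gaifman_def)
  then have "nbrs ?B a = {}" for a by (simp add: nbrs_def)
  then have "admissible \<sigma> d ?B (\<lambda>_ _. False) (\<lambda>_. [])"
    by (simp add: admissible_def is_struct_def local_access_def degree_def)
  from pattern_in_patterns[OF this, of "replicate m 0" m s] show ?thesis
    using set_replicate_conv_if[of m "0 :: nat"] by (auto split: if_splits simp del: set_replicate)
qed

lemma realizes_type: "realizes \<sigma> d s m \<pi> \<tau> \<Longrightarrow> is_type \<sigma> s \<tau> \<and> length (snd \<tau>) = m"
  unfolding realizes_def admissible_def using is_type_sphere by (fastforce simp: sphere_def)

lemma sphere_comb_types:
  assumes S: "S \<subseteq> patterns \<sigma> d s m" and "s < K"
  shows "\<exists>\<phi>. sphere_comb \<sigma> K {0..<m} \<phi> \<and> (\<forall>(B :: nat struct) as. is_struct \<sigma> B \<longrightarrow> univ B \<noteq> {} \<longrightarrow>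
    length as = m \<longrightarrow> set as \<subseteq> univ B \<longrightarrow>
    (fo_sat B \<phi> (asg [0..<m] as) \<longleftrightarrow> (\<exists>\<pi> \<in> S. iso (sphere B s as) (pattern_type \<sigma> d s m \<pi>))))"
proof -
  have base: "\<exists>\<chi>. sphere_comb \<sigma> K {0..<m} \<chi> \<and> (\<forall>(B :: nat struct) as. is_struct \<sigma> B \<longrightarrow> univ B \<noteq> {} \<longrightarrow>
      length as = m \<longrightarrow> set as \<subseteq> univ B \<longrightarrow>
      (fo_sat B \<chi> (asg [0..<m] as) \<longleftrightarrow> iso (sphere B s as) (pattern_type \<sigma> d s m \<pi>)))" if "\<pi> \<in> patterns \<sigma> d s m" for \<pi>
  proof -
    have "is_type \<sigma> s (pattern_type \<sigma> d s m \<pi>)" "length (snd (pattern_type \<sigma> d s m \<pi>)) = m"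
      using realizes_type[OF pattern_type_realizes[OF that]] by auto
    then obtain \<chi> where \<chi>: "sphere_formula \<sigma> s (pattern_type \<sigma> d s m \<pi>) [0..<m] \<chi>"
      using sphere_formula_exists[of \<sigma> s "pattern_type \<sigma> d s m \<pi>" "[0..<m]"] by auto
    then show ?thesis using sphere_comb.sphere[OF \<chi> \<open>s < K\<close>, of "{0..<m}"]
      unfolding sphere_formula_def by (intro exI[of _ \<chi>]) auto
  qed
  have "finite S" using S finite_patterns finite_subset by blast
  then show ?thesis using S
  proof (induction rule: finite_induct)
    case empty
    obtain \<pi> where "\<pi> \<in> patterns \<sigma> d s m" using patterns_nonempty by blast
    then obtain \<chi> where "sphere_comb \<sigma> K {0..<m} \<chi>" using base by blast
    then show ?case by (intro exI[of _ "FNeg (FDisj \<chi> (FNeg \<chi>))"]) (auto intro: sphere_comb.intros(2,3))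
  next
    case (insert \<pi> S)
    then obtain \<phi> where \<phi>: "sphere_comb \<sigma> K {0..<m} \<phi>"
      "\<forall>(B :: nat struct) as. is_struct \<sigma> B \<longrightarrow> univ B \<noteq> {} \<longrightarrow> length as = m \<longrightarrow> set as \<subseteq> univ B \<longrightarrow>
        (fo_sat B \<phi> (asg [0..<m] as) \<longleftrightarrow> (\<exists>\<pi> \<in> S. iso (sphere B s as) (pattern_type \<sigma> d s m \<pi>)))" by auto
    obtain \<chi> where \<chi>: "sphere_comb \<sigma> K {0..<m} \<chi>"
      "\<forall>(B :: nat struct) as. is_struct \<sigma> B \<longrightarrow> univ B \<noteq> {} \<longrightarrow> length as = m \<longrightarrow> set as \<subseteq> univ B \<longrightarrow>
        (fo_sat B \<chi> (asg [0..<m] as) \<longleftrightarrow> iso (sphere B s as) (pattern_type \<sigma> d s m \<pi>))"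
      using base[of \<pi>] insert.prems by auto
    show ?case
      using \<phi> \<chi> by (intro exI[of _ "FDisj \<chi> \<phi>"]) (auto intro: sphere_comb.disj)
  qed
qed

text \<open>Double negations give the formulas of a finite family encodings of pairwise different lengths, so
  that the evaluator can recognize the formula by the length of its input.\<close>

lemma sphere_comb_pad:
  "\<exists>\<phi>'. L < length (enc_fo \<phi>') \<and> (sphere_comb \<sigma> K V \<phi> \<longrightarrow> sphere_comb \<sigma> K V \<phi>') \<and>
    (\<forall>(B :: 'a struct) \<beta>. fo_sat B \<phi>' \<beta> = fo_sat B \<phi> \<beta>)"
proof (induction L)
  case 0
  then show ?case by (intro exI[of _ "FNeg (FNeg \<phi>)"]) (auto intro: sphere_comb.neg)
next
  case (Suc L)
  then obtain \<phi>' where "L < length (enc_fo \<phi>')" "sphere_comb \<sigma> K V \<phi> \<longrightarrow> sphere_comb \<sigma> K V \<phi>'"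
    "\<forall>(B :: 'a struct) \<beta>. fo_sat B \<phi>' \<beta> = fo_sat B \<phi> \<beta>" by blast
  then show ?case by (intro exI[of _ "FNeg (FNeg \<phi>')"]) (auto intro: sphere_comb.neg)
qed

text \<open>Couples a formula with a function deciding it from the pattern: the programs work with
  \<open>g\<close>, the specification speaks of \<open>\<phi>\<close>.\<close>

definition evals where
  "evals \<sigma> d s m K \<phi> g \<longleftrightarrow> sphere_comb \<sigma> K {0..<m} \<phi> \<and>
    (\<forall>B R N as. admissible \<sigma> d B R N \<longrightarrow> length as = m \<longrightarrow> set as \<subseteq> univ B \<longrightarrow>
      (fo_sat B \<phi> (asg [0..<m] as) \<longleftrightarrow> g (pattern \<sigma> d s R N as)))"

text \<open>Membership of \<open>\<pi>'\<close> in \<open>S\<close> would be too strict: a sphere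
  whose type is in the union may show a pattern outside \<open>S\<close>. Hence representatives are
  compared up to isomorphism.\<close>

definition type_test where
  "type_test \<sigma> d s m S = (\<lambda>\<pi>'. \<exists>\<pi> \<in> S. iso (pattern_type \<sigma> d s m \<pi>') (pattern_type \<sigma> d s m \<pi>))"

lemma evals_type_test:
  assumes S: "S \<subseteq> patterns \<sigma> d s m" and "s < K"
  shows "\<exists>\<phi>. L < length (enc_fo \<phi>) \<and> evals \<sigma> d s m K \<phi> (type_test \<sigma> d s m S)"
proof -
  obtain \<phi> where \<phi>: "sphere_comb \<sigma> K {0..<m} \<phi>"
    "\<And>(B :: nat struct) as. is_struct \<sigma> B \<Longrightarrow> univ B \<noteq> {} \<Longrightarrow> length as = m \<Longrightarrow> set as \<subseteq> univ B \<Longrightarrow>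
      fo_sat B \<phi> (asg [0..<m] as) \<longleftrightarrow> (\<exists>\<pi> \<in> S. iso (sphere B s as) (pattern_type \<sigma> d s m \<pi>))"
    using sphere_comb_types[OF assms] by blast
  obtain \<phi>' where \<phi>': "L < length (enc_fo \<phi>')" "sphere_comb \<sigma> K {0..<m} \<phi>'"
    "\<And>(B :: nat struct) \<beta>. fo_sat B \<phi>' \<beta> = fo_sat B \<phi> \<beta>"
    using sphere_comb_pad[of L \<sigma> K "{0..<m}" \<phi>] \<phi>(1) by blast
  have "fo_sat B \<phi>' (asg [0..<m] as) \<longleftrightarrow> type_test \<sigma> d s m S (pattern \<sigma> d s R N as)"
    if B: "admissible \<sigma> d B R N" and as: "length as = m" "set as \<subseteq> univ B" for B R N as
  proof -
    let ?\<pi> = "pattern \<sigma> d s R N as"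
    have i: "iso (sphere B s as) (pattern_type \<sigma> d s m ?\<pi>)" using iso_pattern_type[OF B as] .
    have i': "iso (pattern_type \<sigma> d s m ?\<pi>) (sphere B s as)"
    proof (rule iso_sym[OF i])
      show "set (snd (sphere B s as)) \<subseteq> univ (fst (sphere B s as))"
        using nbhd_center[OF as(2), of s] unfolding univ_sphere by (simp add: sphere_def)
    qed
    have "is_struct \<sigma> B" "univ B \<noteq> {}" using B by (auto simp: admissible_def)
    from \<phi>(2)[OF this as] show ?thesis
      unfolding \<phi>'(3) type_test_def using iso_trans[OF i] iso_trans[OF i'] by blast
  qed
  then show ?thesis using \<phi>' unfolding evals_def by blast
qed

text \<open>Every new formula is padded beyond the sum of all earlier lengths, which keeps the
  lengths distinct.\<close>

lemma formula_family:
  assumes "s < K"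
  obtains \<Phi> where "\<Phi> \<noteq> []" "distinct (map (\<lambda>(\<phi>, g). length (enc_fo \<phi>)) \<Phi>)"
    "\<And>\<phi> g. (\<phi>, g) \<in> set \<Phi> \<Longrightarrow> evals \<sigma> d s m K \<phi> g"
    "\<And>S. S \<subseteq> patterns \<sigma> d s m \<Longrightarrow> \<exists>\<phi>. (\<phi>, type_test \<sigma> d s m S) \<in> set \<Phi>"
proof -
  have *: "finite F \<Longrightarrow> F \<subseteq> Pow (patterns \<sigma> d s m) \<Longrightarrow>
    \<exists>\<Phi>. distinct (map (\<lambda>(\<phi>, g). length (enc_fo \<phi>)) \<Phi>) \<and>
      (\<forall>(\<phi>, g) \<in> set \<Phi>. evals \<sigma> d s m K \<phi> g) \<and>
      (\<forall>S \<in> F. \<exists>\<phi>. (\<phi>, type_test \<sigma> d s m S) \<in> set \<Phi>)" for F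
  proof (induction rule: finite_induct)
    case empty
    then show ?case by (intro exI[of _ "[]"]) auto
  next
    case (insert S F)
    then obtain \<Phi> where \<Phi>: "distinct (map (\<lambda>(\<phi>, g). length (enc_fo \<phi>)) \<Phi>)"
      "\<forall>(\<phi>, g) \<in> set \<Phi>. evals \<sigma> d s m K \<phi> g"
      "\<forall>S \<in> F. \<exists>\<phi>. (\<phi>, type_test \<sigma> d s m S) \<in> set \<Phi>" by auto
    let ?ls = "map (\<lambda>(\<phi>, g). length (enc_fo \<phi>)) \<Phi>"
    obtain \<phi> where \<phi>: "sum_list ?ls < length (enc_fo \<phi>)" "evals \<sigma> d s m K \<phi> (type_test \<sigma> d s m S)"
      using evals_type_test[of S \<sigma> d s m K "sum_list ?ls"] insert.prems assms by auto
    have "length (enc_fo \<phi>) \<notin> set ?ls"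
    proof
      assume "length (enc_fo \<phi>) \<in> set ?ls"
      from member_le_sum_list[OF this] show False using \<phi>(1) by linarith
    qed
    then show ?case using \<Phi> \<phi>
      by (intro exI[of _ "(\<phi>, type_test \<sigma> d s m S) # \<Phi>"]) auto
  qed
  obtain \<Phi> where \<Phi>: "distinct (map (\<lambda>(\<phi>, g). length (enc_fo \<phi>)) \<Phi>)"
      "\<forall>(\<phi>, g) \<in> set \<Phi>. evals \<sigma> d s m K \<phi> g"
      "\<forall>S \<in> Pow (patterns \<sigma> d s m). \<exists>\<phi>. (\<phi>, type_test \<sigma> d s m S) \<in> set \<Phi>"
    using *[of "Pow (patterns \<sigma> d s m)"] finite_patterns by auto
  show ?thesis
  proof (rule that)
    show "\<Phi> \<noteq> []" using \<Phi>(3) by fastforce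
  qed (use \<Phi> in auto)
qed

text \<open>A labeling of the instances that respects isomorphism of their spheres is a union of
  types on them, so the patterns of the positive instances reproduce it without error.\<close>

lemma type_test_complete:
  assumes B: "admissible \<sigma> d B R N"
    and us: "\<And>u. u \<in> U \<Longrightarrow> length (u @ v) = m \<and> set (u @ v) \<subseteq> univ B"
    and X: "\<And>u u'. u \<in> U \<Longrightarrow> u' \<in> U \<Longrightarrow> iso (sphere B s (u @ v)) (sphere B s (u' @ v)) \<Longrightarrow> X u = X u'"
    and u: "u \<in> U"
  shows "type_test \<sigma> d s m {pattern \<sigma> d s R N (u @ v) | u. u \<in> U \<and> X u} (pattern \<sigma> d s R N (u @ v)) \<longleftrightarrow> X u"
proof -
  have i: "iso (sphere B s (u @ v)) (pattern_type \<sigma> d s m (pattern \<sigma> d s R N (u @ v)))"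
    and i': "iso (pattern_type \<sigma> d s m (pattern \<sigma> d s R N (u @ v))) (sphere B s (u @ v))" if "u \<in> U" for u
  proof -
    show i: "iso (sphere B s (u @ v)) (pattern_type \<sigma> d s m (pattern \<sigma> d s R N (u @ v)))"
      using iso_pattern_type[OF B] us[OF that] by blast
    show "iso (pattern_type \<sigma> d s m (pattern \<sigma> d s R N (u @ v))) (sphere B s (u @ v))"
      using nbhd_center[of "u @ v" B s] us[OF that] by (intro iso_sym[OF i]) (simp add: sphere_def induced_def)
  qed
  show ?thesis
  proof
    assume "X u"
    then show "type_test \<sigma> d s m {pattern \<sigma> d s R N (u @ v) | u. u \<in> U \<and> X u} (pattern \<sigma> d s R N (u @ v))"
      unfolding type_test_def using u iso_refl by blast
  next
    assume "type_test \<sigma> d s m {pattern \<sigma> d s R N (u @ v) | u. u \<in> U \<and> X u} (pattern \<sigma> d s R N (u @ v))"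
    then obtain u' where u': "u' \<in> U" "X u'"
      "iso (pattern_type \<sigma> d s m (pattern \<sigma> d s R N (u @ v))) (pattern_type \<sigma> d s m (pattern \<sigma> d s R N (u' @ v)))"
      unfolding type_test_def by blast
    have "iso (sphere B s (u @ v)) (sphere B s (u' @ v))"
      using iso_trans[OF iso_trans[OF i[OF u] u'(3)] i'[OF u'(1)]] .
    then show "X u" using X[OF u u'(1)] u'(2) by simp
  qed
qed

section \<open>Unit steps and logarithmic cost\<close>

text \<open>Unit-cost counterpart of \<open>exec\<close>: program proofs count steps without looking
  at the size of numbers, and \<open>steps_exec\<close> converts the result to logarithmic
  cost.\<close>

inductive steps ::
  "(nat \<Rightarrow> nat list \<Rightarrow> bool) \<Rightarrow> (nat \<Rightarrow> nat list) \<Rightarrow> prog \<Rightarrow> state \<Rightarrow> nat \<Rightarrow> state \<Rightarrow> bool"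
  for R :: "nat \<Rightarrow> nat list \<Rightarrow> bool" and N :: "nat \<Rightarrow> nat list" where
  basic: "steps R N (Basic i) s 1 (effect R N i s)"
| seq: "steps R N c s k s' \<Longrightarrow> steps R N c' s' k' s'' \<Longrightarrow> steps R N (Seq c c') s (k + k') s''"
| if_true: "fst s a \<noteq> 0 \<Longrightarrow> steps R N c s k s' \<Longrightarrow> steps R N (IfNZ a c c') s (Suc k) s'"
| if_false: "fst s a = 0 \<Longrightarrow> steps R N c' s k s' \<Longrightarrow> steps R N (IfNZ a c c') s (Suc k) s'"
| while_true: "fst s a \<noteq> 0 \<Longrightarrow> steps R N c s k s' \<Longrightarrow> steps R N (WhileNZ a c) s' k' s'' \<Longrightarrow>
    steps R N (WhileNZ a c) s (Suc (k + k')) s''"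
| while_false: "fst s a = 0 \<Longrightarrow> steps R N (WhileNZ a c) s 1 s"

text \<open>For \<open>Const\<close> this bounds the number written, for \<open>AskRel\<close> the
  number of operands read. Both are fixed by the program text, so one bound serves both
  purposes.\<close>

primrec iconst :: "instr \<Rightarrow> nat" where
  "iconst (Const a c) = c"
| "iconst (Add a b c) = 0"
| "iconst (Sub a b c) = 0"
| "iconst (Load a b) = 0"
| "iconst (Store a b) = 0"
| "iconst (AskRel a i bs) = length bs"
| "iconst (AskNbrs a b) = 0"

primrec pconst :: "prog \<Rightarrow> nat" where
  "pconst (Basic i) = iconst i"
| "pconst (Seq c c') = max (pconst c) (pconst c')"
| "pconst (IfNZ a c c') = max (pconst c) (pconst c')"
| "pconst (WhileNZ a c) = pconst c"

definition bnd :: "nat \<Rightarrow> state \<Rightarrow> bool" where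
  "bnd X s \<longleftrightarrow> (\<forall>a. fst s a \<le> X \<and> snd s a \<le> X)"

lemma bits_mono: "x \<le> y \<Longrightarrow> bits x \<le> bits y"
  by (simp add: bits_def floorlog_mono)

lemma effect_bnd:
  assumes "bnd X s" "iconst i \<le> X" "1 \<le> X" "\<And>a. length (N a) \<le> X" "\<And>a x. x \<in> set (N a) \<Longrightarrow> x \<le> X"
  shows "bnd (2 * X) (effect R N i s)"
proof -
  obtain r m where s: "s = (r, m)" by (cases s)
  have r: "r a \<le> X" "r a \<le> 2 * X" and m: "m a \<le> X" "m a \<le> 2 * X" for a
    using assms(1)[unfolded bnd_def s, rule_format, of a] by auto
  show ?thesis
  proof (cases i)
    case (AskNbrs a b)
    have "put_list (r b) (N (r a)) m q \<le> 2 * X" for q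
    proof -
      have "N (r a) ! (q - r b - 1) \<le> X" if "r b < q" "q \<le> r b + length (N (r a))"
        using that by (intro assms(5)[of _ "r a"] nth_mem) linarith
      then show ?thesis using assms(4)[of "r a"] m[of q] by (auto simp: put_list_def)
    qed
    then show ?thesis using r by (simp add: s AskNbrs bnd_def)
  qed (use assms(2,3) r m add_mono[OF r(1) r(1)] in
      \<open>auto simp: s bnd_def mult_2 of_bool_def intro: le_trans[OF diff_le_self] trans_le_add1\<close>)
qed

text \<open>Origin of the factor: at most three single numbers, two for each entry of a neighbor
  list (its address and its value), and one for each operand of a relation query. Addresses of list
  entries may exceed \<open>X\<close>, but not \<open>2 * X\<close>.\<close>

lemma cost_le:
  assumes "bnd X s" "iconst i \<le> C" "C \<le> X" "1 \<le> X" "\<And>a. length (N a) \<le> D" "D \<le> X"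
    "\<And>a x. x \<in> set (N a) \<Longrightarrow> x \<le> X"
  shows "cost N i s \<le> (3 + 2 * D + C) * bits (2 * X)"
proof -
  obtain r m where s: "s = (r, m)" by (cases s)
  let ?b = "bits (2 * X)"
  have r: "bits (r a) \<le> ?b" and m: "bits (m a) \<le> ?b" for a
    using assms(1)[unfolded bnd_def s, rule_format, of a] by (auto intro!: bits_mono)
  have b1: "1 \<le> ?b" by (simp add: bits_def)
  have small: "x \<le> (3 + 2 * D + C) * ?b" if "x \<le> ?b + ?b + ?b" for x
  proof -
    have "3 * ?b \<le> (3 + 2 * D + C) * ?b" by (intro mult_le_mono1) simp
    then show ?thesis using that by linarith
  qed
  show ?thesis
  proof (cases i)
    case (Const a c)
    then have "bits c \<le> ?b" using assms(2,3) by (intro bits_mono) simp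
    then show ?thesis unfolding s Const by (intro small) simp
  next
    case (AskRel a i bs)
    have "(\<Sum>b\<leftarrow>bs. bits (r b)) \<le> length bs * ?b"
    proof (induction bs)
      case (Cons x xs)
      then show ?case using r[of x] by simp
    qed simp
    also have "\<dots> \<le> C * ?b" using assms(2) AskRel by (intro mult_le_mono1) simp
    finally have "cost N (AskRel a i bs) s \<le> ?b + C * ?b" using b1 by (simp add: s)
    also have "\<dots> \<le> (3 + 2 * D + C) * ?b" by (simp add: algebra_simps)
    finally show ?thesis unfolding AskRel .
  next
    case (AskNbrs a b)
    let ?n = "length (N (r a))"
    have n: "?n \<le> D" using assms(5) .
    have "bits ?n \<le> ?b" using n assms(6) by (intro bits_mono) linarith
    moreover have "(\<Sum>j<?n. bits (r b + 1 + j) + bits (N (r a) ! j)) \<le> (\<Sum>j<?n. ?b + ?b)"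
    proof (intro sum_mono add_mono bits_mono)
      fix j assume j: "j \<in> {..<?n}"
      have "r b \<le> X" using assms(1)[unfolded bnd_def s] by simp
      then show "r b + 1 + j \<le> 2 * X" using j n assms(6) by auto
      show "N (r a) ! j \<le> 2 * X" using assms(7)[of "N (r a) ! j" "r a"] j nth_mem[of j "N (r a)"] by force
    qed
    moreover have "(\<Sum>j<?n. ?b + ?b) \<le> 2 * D * ?b"
    proof -
      have "(\<Sum>j<?n. ?b + ?b) = ?n * (2 * ?b)" by simp
      also have "\<dots> \<le> D * (2 * ?b)" by (rule mult_le_mono1[OF n])
      finally show ?thesis by (simp only: ac_simps)
    qed
    ultimately have "cost N (AskNbrs a b) s \<le> 3 * ?b + 2 * D * ?b"
      using r[of a] r[of b] by (simp add: s)
    also have "\<dots> \<le> (3 + 2 * D + C) * ?b" by (simp add: algebra_simps)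
    finally show ?thesis unfolding AskNbrs .
  qed (use add_mono[OF r r] add_mono[OF r m] in \<open>auto simp: s intro!: small[OF trans_le_add1]\<close>)
qed

text \<open>A step at most doubles the largest number in the state, so after \<open>k\<close> steps all numbers are at most
  \<open>k\<close> bits longer than at the start.\<close>

lemma steps_exec:
  assumes "steps R N c s k s'" "bnd X s" "pconst c \<le> C" "C \<le> X" "1 \<le> X" "\<And>a. length (N a) \<le> D" "D \<le> X"
    "\<And>a x. x \<in> set (N a) \<Longrightarrow> x \<le> X"
  shows "\<exists>t. exec R N c s t s' \<and> bnd (2 ^ k * X) s' \<and> t \<le> k * ((3 + 2 * D + C) * bits (2 ^ k * X))"
  using assms
proof (induction arbitrary: X rule: steps.induct)
  case (basic i s)
  have "bnd (2 * X) (effect R N i s)" using basic by (intro effect_bnd) (auto intro: le_trans)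
  moreover have "cost N i s \<le> (3 + 2 * D + C) * bits (2 * X)"
    using basic by (intro cost_le) auto
  ultimately show ?case using exec.basic[of R N i s] by auto
next
  case (seq c s k s' c' k' s'')
  let ?A = "3 + 2 * D + C"
  obtain t where t: "exec R N c s t s'" "bnd (2 ^ k * X) s'" "t \<le> k * (?A * bits (2 ^ k * X))"
    using seq.IH(1)[OF seq.prems(1)] seq.prems by auto
  have X: "X \<le> 2 ^ k * X" by simp
  obtain t' where t': "exec R N c' s' t' s''" "bnd (2 ^ k' * (2 ^ k * X)) s''"
    "t' \<le> k' * (?A * bits (2 ^ k' * (2 ^ k * X)))"
    using seq.IH(2)[OF t(2)] seq.prems le_trans[OF _ X] by auto
  have e: "2 ^ k' * (2 ^ k * X) = 2 ^ (k + k') * X" by (simp add: power_add)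
  have "bits (2 ^ k * X) \<le> bits (2 ^ (k + k') * X)" by (intro bits_mono mult_le_mono1) simp
  then have "t \<le> k * (?A * bits (2 ^ (k + k') * X))" using t(3) by (meson le_trans mult_le_mono2)
  then have "t + t' \<le> (k + k') * (?A * bits (2 ^ (k + k') * X))"
    using t'(3) unfolding e by (simp add: add_mult_distrib)
  then show ?case using exec.seq[OF t(1) t'(1)] t'(2) unfolding e by blast
next
  case (if_true s a c k s' c')
  let ?A = "3 + 2 * D + C"
  obtain t where t: "exec R N c s t s'" "bnd (2 ^ k * X) s'" "t \<le> k * (?A * bits (2 ^ k * X))"
    using if_true.IH[OF if_true.prems(1)] if_true.prems by auto
  have mono: "2 ^ k * X \<le> 2 ^ Suc k * X" by simp
  have "fst s a \<le> X" using if_true.prems(1) by (simp add: bnd_def)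
  also have "X \<le> 2 ^ Suc k * X" by simp
  finally have "bits (fst s a) \<le> bits (2 ^ Suc k * X)" by (rule bits_mono)
  also have "\<dots> \<le> ?A * bits (2 ^ Suc k * X)" by simp
  finally have 1: "bits (fst s a) \<le> ?A * bits (2 ^ Suc k * X)" .
  have "t \<le> k * (?A * bits (2 ^ Suc k * X))"
    using t(3) bits_mono[OF mono] by (meson le_trans mult_le_mono2)
  then have "bits (fst s a) + t \<le> Suc k * (?A * bits (2 ^ Suc k * X))" using 1 by simp
  moreover have "bnd (2 ^ Suc k * X) s'" using t(2) mono unfolding bnd_def by (meson le_trans)
  ultimately show ?case using exec.if_true[OF if_true.hyps(1) t(1)] by blast
next
  case (if_false s a c' k s' c)
  let ?A = "3 + 2 * D + C"
  obtain t where t: "exec R N c' s t s'" "bnd (2 ^ k * X) s'" "t \<le> k * (?A * bits (2 ^ k * X))"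
    using if_false.IH[OF if_false.prems(1)] if_false.prems by auto
  have mono: "2 ^ k * X \<le> 2 ^ Suc k * X" by simp
  have "bits (fst s a) \<le> ?A * bits (2 ^ Suc k * X)"
    using if_false.hyps(1) by (simp add: bits_def floorlog_def)
  moreover have "t \<le> k * (?A * bits (2 ^ Suc k * X))"
    using t(3) bits_mono[OF mono] by (meson le_trans mult_le_mono2)
  ultimately have "bits (fst s a) + t \<le> Suc k * (?A * bits (2 ^ Suc k * X))" by simp
  moreover have "bnd (2 ^ Suc k * X) s'" using t(2) mono unfolding bnd_def by (meson le_trans)
  ultimately show ?case using exec.if_false[OF if_false.hyps(1) t(1)] by blast
next
  case (while_true s a c k s' k' s'')
  let ?A = "3 + 2 * D + C" and ?Y = "2 ^ Suc (k + k') * X"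
  obtain t where t: "exec R N c s t s'" "bnd (2 ^ k * X) s'" "t \<le> k * (?A * bits (2 ^ k * X))"
    using while_true.IH(1)[OF while_true.prems(1)] while_true.prems by auto
  have X: "X \<le> 2 ^ k * X" by simp
  obtain t' where t': "exec R N (WhileNZ a c) s' t' s''" "bnd (2 ^ k' * (2 ^ k * X)) s''"
    "t' \<le> k' * (?A * bits (2 ^ k' * (2 ^ k * X)))"
    using while_true.IH(2)[OF t(2)] while_true.prems le_trans[OF _ X] by auto
  have e: "2 ^ k' * (2 ^ k * X) = 2 ^ (k + k') * X" by (simp add: power_add)
  have m1: "2 ^ k * X \<le> ?Y" by (intro mult_le_mono1 power_increasing) auto
  have m2: "2 ^ (k + k') * X \<le> ?Y" by simp
  have "bits (fst s a) \<le> bits ?Y"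
    using while_true.prems(1) X m1 unfolding bnd_def by (meson bits_mono le_trans)
  also have "\<dots> \<le> ?A * bits ?Y" by simp
  finally have 1: "bits (fst s a) \<le> ?A * bits ?Y" .
  have 2: "t \<le> k * (?A * bits ?Y)" using t(3) bits_mono[OF m1] by (meson le_trans mult_le_mono2)
  have 3: "t' \<le> k' * (?A * bits ?Y)"
    using t'(3) bits_mono[OF m2] unfolding e by (meson le_trans mult_le_mono2)
  have "bits (fst s a) + t + t' \<le> ?A * bits ?Y + k * (?A * bits ?Y) + k' * (?A * bits ?Y)"
    using 1 2 3 by linarith
  also have "\<dots> = Suc (k + k') * (?A * bits ?Y)" by (simp add: algebra_simps)
  finally have "bits (fst s a) + t + t' \<le> Suc (k + k') * (?A * bits ?Y)" .
  moreover have "bnd ?Y s''" using t'(2) m2 unfolding e bnd_def by (meson le_trans)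
  ultimately show ?case using exec.while_true[OF while_true.hyps(1) t(1) t'(1)] by blast
next
  case (while_false s a c)
  have "bits (fst s a) \<le> 1 * ((3 + 2 * D + C) * bits (2 ^ 1 * X))"
    using while_false.hyps by (simp add: bits_def floorlog_def)
  moreover have "bnd (2 ^ 1 * X) s" using while_false.prems(1) by (auto simp: bnd_def intro: le_trans[of _ X])
  ultimately show ?case using exec.while_false[OF while_false.hyps] by blast
qed

text \<open>Here \<open>t\<close> bounds the number of iterations of every loop.\<close>

primrec pcost :: "nat \<Rightarrow> prog \<Rightarrow> nat" where
  "pcost t (Basic i) = 1"
| "pcost t (Seq c c') = pcost t c + pcost t c'"
| "pcost t (IfNZ a c c') = Suc (pcost t c + pcost t c')"
| "pcost t (WhileNZ a c) = Suc (t * Suc (pcost t c))"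

primrec psize :: "prog \<Rightarrow> nat" where
  "psize (Basic i) = 1"
| "psize (Seq c c') = psize c + psize c'"
| "psize (IfNZ a c c') = Suc (psize c + psize c')"
| "psize (WhileNZ a c) = Suc (psize c)"

lemma psize_pos: "1 \<le> psize c"
  by (induction c) auto

text \<open>Loops are nested at most as deep as the program is long, so the size serves as exponent;
  the base \<open>t + 2\<close> absorbs the added units.\<close>

lemma pcost_le: "pcost t c \<le> psize c * (t + 2) ^ psize c"
proof (induction c)
  case (Seq c c')
  have "pcost t c \<le> psize c * (t + 2) ^ (psize c + psize c')"
    by (rule le_trans[OF Seq(1)]) (intro mult_le_mono2 power_increasing; simp)
  moreover have "pcost t c' \<le> psize c' * (t + 2) ^ (psize c + psize c')"
    by (rule le_trans[OF Seq(2)]) (intro mult_le_mono2 power_increasing; simp)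
  ultimately show ?case by (simp add: add_mult_distrib)
next
  case (IfNZ a c c')
  let ?p = "(t + 2) ^ Suc (psize c + psize c')"
  have "pcost t c \<le> psize c * ?p"
    by (rule le_trans[OF IfNZ(1)]) (intro mult_le_mono2 power_increasing; simp)
  moreover have "pcost t c' \<le> psize c' * ?p"
    by (rule le_trans[OF IfNZ(2)]) (intro mult_le_mono2 power_increasing; simp)
  moreover have "1 \<le> ?p" by (rule one_le_power) simp
  ultimately have "Suc (pcost t c + pcost t c') \<le> ?p + psize c * ?p + psize c' * ?p" by linarith
  then show ?case by (simp add: add_mult_distrib)
next
  case (WhileNZ a c)
  let ?z = "t + 2" and ?s = "psize c"
  have "Suc (t * Suc (pcost t c)) \<le> ?z + t * (?s * ?z ^ ?s)"
  proof -
    have "Suc (t * Suc (pcost t c)) = 1 + t + t * pcost t c" by simp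
    moreover have "t * pcost t c \<le> t * (?s * ?z ^ ?s)" by (rule mult_le_mono2[OF WhileNZ])
    ultimately show ?thesis by linarith
  qed
  also have "\<dots> \<le> ?z ^ Suc ?s + ?z * (?s * ?z ^ ?s)"
    using power_increasing[of 1 "Suc ?s" ?z] by (intro add_mono mult_le_mono1) auto
  also have "\<dots> = Suc ?s * ?z ^ Suc ?s" by (simp add: algebra_simps)
  finally show ?case by simp
qed simp

text \<open>Total correctness within the step budget \<open>pcost t c\<close>. As \<open>t\<close>
  bounds the iterations of each loop, proofs about programs never have to mention step
  counts.\<close>

definition wp ::
  "(nat \<Rightarrow> nat list \<Rightarrow> bool) \<Rightarrow> (nat \<Rightarrow> nat list) \<Rightarrow> nat \<Rightarrow> prog \<Rightarrow> (state \<Rightarrow> bool) \<Rightarrow> state \<Rightarrow> bool" where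
  "wp R N t c Q s \<longleftrightarrow> (\<exists>k s'. steps R N c s k s' \<and> k \<le> pcost t c \<and> Q s')"

lemma wp_Basic: "Q (effect R N i s) \<Longrightarrow> wp R N t (Basic i) Q s"
  using steps.basic[of R N i s] unfolding wp_def by (intro exI[of _ 1] exI[of _ "effect R N i s"]) simp

lemma wp_Seq: "wp R N t c (wp R N t c' Q) s \<Longrightarrow> wp R N t (Seq c c') Q s"
  unfolding wp_def pcost.simps by (blast intro: steps.seq add_mono)

lemma wp_If:
  "(fst s a \<noteq> 0 \<Longrightarrow> wp R N t c Q s) \<Longrightarrow> (fst s a = 0 \<Longrightarrow> wp R N t c' Q s) \<Longrightarrow> wp R N t (IfNZ a c c') Q s"
proof (cases "fst s a = 0")
  case True
  moreover assume "fst s a = 0 \<Longrightarrow> wp R N t c' Q s"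
  ultimately obtain k s' where "steps R N c' s k s'" "k \<le> pcost t c'" "Q s'" unfolding wp_def by blast
  then show ?thesis using steps.if_false[OF True, of R N c' k s' c]
    unfolding wp_def by (intro exI[of _ "Suc k"] exI[of _ s']) simp
next
  case False
  moreover assume "fst s a \<noteq> 0 \<Longrightarrow> wp R N t c Q s"
  ultimately obtain k s' where "steps R N c s k s'" "k \<le> pcost t c" "Q s'" unfolding wp_def by blast
  then show ?thesis using steps.if_true[OF False, of R N c k s' c']
    unfolding wp_def by (intro exI[of _ "Suc k"] exI[of _ s']) simp
qed

lemma wp_mono: "wp R N t c Q s \<Longrightarrow> (\<And>s'. Q s' \<Longrightarrow> Q' s') \<Longrightarrow> wp R N t c Q' s"
  unfolding wp_def by blast

text \<open>The index of \<open>I\<close> is the number of iterations still to be done, so one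
  invariant yields termination and the budget.\<close>

lemma wp_While:
  assumes step: "\<And>j s. j < n \<Longrightarrow> I (Suc j) s \<Longrightarrow> fst s a \<noteq> 0 \<and> wp R N t c (I j) s"
    and stop: "\<And>s. I 0 s \<Longrightarrow> fst s a = 0" and "I n s" "n \<le> t"
  shows "wp R N t (WhileNZ a c) (I 0) s"
proof -
  have "j \<le> n \<Longrightarrow> I j s \<Longrightarrow> \<exists>k s'. steps R N (WhileNZ a c) s k s' \<and> k \<le> Suc (j * Suc (pcost t c)) \<and> I 0 s'" for j s
  proof (induction j arbitrary: s)
    case 0
    then have "fst s a = 0" using stop by simp
    from steps.while_false[OF this, of R N c] show ?case using 0 by (intro exI[of _ 1] exI[of _ s]) simp
  next
    case (Suc j)
    then obtain k s' where s': "fst s a \<noteq> 0" "steps R N c s k s'" "k \<le> pcost t c" "I j s'"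
      using step[of j s] unfolding wp_def by (metis Suc_le_lessD)
    obtain k' s'' where s'': "steps R N (WhileNZ a c) s' k' s''" "k' \<le> Suc (j * Suc (pcost t c))" "I 0 s''"
      using Suc.IH[OF Suc_leD[OF Suc.prems(1)] s'(4)] by blast
    have "Suc (k + k') \<le> Suc (Suc j * Suc (pcost t c))" using s'(3) s''(2) by simp
    then show ?case using steps.while_true[OF s'(1,2) s''(1)] s''(3) by blast
  qed
  from this[OF le_refl \<open>I n s\<close>] obtain k s' where
    "steps R N (WhileNZ a c) s k s'" "k \<le> Suc (n * Suc (pcost t c))" "I 0 s'" by blast
  moreover have "n * Suc (pcost t c) \<le> t * Suc (pcost t c)" using \<open>n \<le> t\<close> by (rule mult_le_mono1)
  ultimately show ?thesis unfolding wp_def by (metis Suc_le_mono le_trans pcost.simps(4))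
qed

text \<open>There is no empty program, so the empty sequence clears register 0; this is why the last
  premise of \<open>wp_seqs\<close> speaks of \<open>r(0 := 0)\<close>.\<close>

primrec seqs :: "prog list \<Rightarrow> prog" where
  "seqs [] = Basic (Const 0 0)"
| "seqs (c # cs) = Seq c (seqs cs)"

lemma wp_seqs:
  assumes "\<And>i s. i < length cs \<Longrightarrow> I i s \<Longrightarrow> wp R N t (cs ! i) (I (Suc i)) s" "I 0 s"
    and "\<And>r m. I (length cs) (r, m) \<Longrightarrow> Q (r(0 := 0), m)"
  shows "wp R N t (seqs cs) Q s"
  using assms
proof (induction cs arbitrary: I s)
  case Nil
  obtain r m where "s = (r, m)" by (cases s)
  then show ?case using Nil(2) Nil(3)[of r m] by (auto intro!: wp_Basic simp: fun_upd_def)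
next
  case (Cons c cs)
  have "wp R N t c (I 1) s" using Cons.prems(1)[of 0 s] Cons.prems(2) by simp
  then have "wp R N t c (wp R N t (seqs cs) Q) s"
  proof (rule wp_mono)
    fix s' assume s': "I 1 s'"
    show "wp R N t (seqs cs) Q s'"
    proof (rule Cons.IH[of "\<lambda>i. I (Suc i)"])
      fix i s assume "i < length cs" "I (Suc i) s"
      then show "wp R N t (cs ! i) (I (Suc (Suc i))) s" using Cons.prems(1)[of "Suc i" s] by simp
    qed (use s' Cons.prems(3) in auto)
  qed
  then show ?case by (simp add: wp_Seq)
qed

section \<open>Polynomial running time\<close>

lemma log_product:
  fixes a b c :: real
  shows "0 < a \<Longrightarrow> 0 < b \<Longrightarrow> 0 < c \<Longrightarrow> log 2 (2 ^ K * (a * b * c)) = real K + (log 2 a + log 2 b + log 2 c)"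
  by (simp add: log_mult log_nat_power)

text \<open>After \<open>K\<close> steps numbers have about
  \<open>K + log 2 (n * (t + 1) * C)\<close> bits, and \<open>K\<close> is polynomial in
  \<open>t\<close> alone. Constant factors move into the exponent because the base is at least 2 and
  \<open>c \<le> 2 ^ c\<close>.\<close>

lemma time_poly:
  fixes n t S A C K time :: nat
  assumes K: "K \<le> S * (t + 2) ^ S" and S: "1 \<le> S" and n: "1 \<le> n" and C: "1 \<le> C"
    and time: "time \<le> K * (A * bits (2 ^ K * (n * (t + 1) * C)))"
    and e: "2 * S + 1 + A * S * (S + C + 4) \<le> e"
  shows "real time \<le> (log 2 (real n) + real t + 2) ^ e"
proof -
  define z where "z = log 2 (real n) + real t + 2"
  have ln: "0 \<le> log 2 (real n)" using n by simp
  have z2: "2 \<le> z" "real t + 2 \<le> z" using ln by (auto simp: z_def)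
  have z1: "1 \<le> z" using z2 by simp
  have zp: "1 \<le> z ^ S" "0 \<le> z ^ S" using z1 by (auto intro: one_le_power)
  have "real K \<le> real (S * (t + 2) ^ S)" using K by (simp only: of_nat_le_iff)
  also have "\<dots> = real S * (real t + 2) ^ S" by (simp add: add.commute)
  also have "\<dots> \<le> real S * z ^ S" using z2 by (intro mult_left_mono power_mono) auto
  finally have K': "real K \<le> real S * z ^ S" .
  let ?X = "n * (t + 1) * C"
  have X: "0 < ?X" using n C by simp
  have "real (floorlog 2 (2 ^ K * ?X)) = real_of_int \<lfloor>log 2 (real (2 ^ K * ?X))\<rfloor> + 1"
  proof -
    have "real 1 \<le> real (2 ^ K * ?X)" using X by (intro of_nat_mono) (simp add: Suc_le_eq)
    then have "0 \<le> \<lfloor>log 2 (real (2 ^ K * ?X))\<rfloor>" by simp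
    moreover have "0 < 2 ^ K * ?X" using X by simp
    ultimately show ?thesis unfolding floorlog_def by (simp del: of_nat_mult of_nat_power)
  qed
  also have "\<dots> \<le> log 2 (real (2 ^ K * ?X)) + 1" by simp
  also have "log 2 (real (2 ^ K * ?X)) = real K + (log 2 (real n) + log 2 (real (t + 1)) + log 2 (real C))"
    using log_product[of "real n" "real (t + 1)" "real C" K] n C by (simp add: distrib_left distrib_right)
  also have "log 2 (real (t + 1)) \<le> real t"
  proof -
    have "real (t + 1) \<le> 2 ^ t" by (induction t) auto
    then show ?thesis using log_le_cancel_iff[of 2 "real (t + 1)" "2 ^ t"] by (simp add: log_nat_power)
  qed
  also have "log 2 (real C) \<le> real C"
  proof -
    have "real C \<le> 2 ^ C" using of_nat_less_two_power[of C] by (simp add: less_imp_le)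
    then show ?thesis using C log_le_cancel_iff[of 2 "real C" "2 ^ C"] by (simp add: log_nat_power)
  qed
  finally have fl: "real (floorlog 2 (2 ^ K * ?X)) \<le> real K + z + real C" by (simp add: z_def)
  have "real (bits (2 ^ K * ?X)) \<le> 1 + (real S * z ^ S + z + real C)" using fl K' by (simp add: bits_def)
  also have "\<dots> \<le> (real S + real C + 4) * z ^ Suc S"
  proof -
    have "z \<le> z ^ Suc S" using z1 zp by (simp add: mult_le_cancel_left1)
    moreover have "z ^ S \<le> z ^ Suc S" using z1 by (intro power_increasing) auto
    moreover have "1 \<le> z ^ Suc S" using z1 by (intro one_le_power)
    ultimately have "1 + (real S * z ^ S + z + real C) \<le>
        z ^ Suc S + (real S * z ^ Suc S + z ^ Suc S + real C * z ^ Suc S)"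
      by (intro add_mono mult_left_mono) (auto simp: mult_le_cancel_left1)
    also have "\<dots> \<le> (real S + real C + 4) * z ^ Suc S" using \<open>1 \<le> z ^ Suc S\<close> by (simp add: algebra_simps)
    finally show ?thesis .
  qed
  finally have b: "real (bits (2 ^ K * ?X)) \<le> (real S + real C + 4) * z ^ Suc S" .
  have "real time \<le> real (K * (A * bits (2 ^ K * ?X)))" using time by (simp only: of_nat_le_iff)
  also have "\<dots> = real K * (real A * real (bits (2 ^ K * ?X)))" by simp
  also have "\<dots> \<le> (real S * z ^ S) * (real A * ((real S + real C + 4) * z ^ Suc S))"
    using K' b zp by (intro mult_mono) auto
  also have "\<dots> = real (A * S * (S + C + 4)) * z ^ (2 * S + 1)"
  proof -
    have "z ^ (2 * S + 1) = z ^ S * z ^ Suc S" by (simp only: power_add[symmetric]) (simp add: mult_2)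
    then show ?thesis by (simp del: power_Suc add: algebra_simps)
  qed
  also have "\<dots> \<le> z ^ (A * S * (S + C + 4)) * z ^ (2 * S + 1)"
  proof (intro mult_right_mono)
    have "real (A * S * (S + C + 4)) \<le> 2 ^ (A * S * (S + C + 4))"
      using of_nat_less_two_power[of "A * S * (S + C + 4)"] by (rule less_imp_le)
    also have "\<dots> \<le> z ^ (A * S * (S + C + 4))" using z2 by (intro power_mono) auto
    finally show "real (A * S * (S + C + 4)) \<le> z ^ (A * S * (S + C + 4))" .
  qed (use z1 in simp)
  also have "\<dots> = z ^ (2 * S + 1 + A * S * (S + C + 4))" by (simp add: power_add)
  also have "\<dots> \<le> z ^ e" using z1 e by (intro power_increasing)
  finally show ?thesis unfolding z_def .
qed

text \<open>\<open>X\<close> has to bound the input, the answers of the neighbor oracle and the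
  program constants; its factors are the universe size, the number of examples and a
  constant.\<close>

lemma runs_of_wp:
  assumes w: "wp R N t c (\<lambda>(r, m). get_list 0 m = out) (\<lambda>_. 0, put_list 0 inp (\<lambda>_. 0))"
    and inp: "length inp \<le> X" "\<And>x. x \<in> set inp \<Longrightarrow> x \<le> X"
    and c: "pconst c \<le> C" and X: "X = n * (t + 1) * C'" "C \<le> X" "1 \<le> C'" "1 \<le> n"
    and N: "\<And>a. length (N a) \<le> D" "D \<le> X" "\<And>a x. x \<in> set (N a) \<Longrightarrow> x \<le> X"
    and e: "2 * psize c + 1 + (3 + 2 * D + C) * psize c * (psize c + C' + 4) \<le> e"
  shows "\<exists>time. runs R N c inp time out \<and> real time \<le> (log 2 (real n) + real t + 2) ^ e"
proof -
  let ?s = "(\<lambda>_. 0, put_list 0 inp (\<lambda>_. 0)) :: state"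
  obtain k r m where k: "steps R N c ?s k (r, m)" "k \<le> pcost t c" "get_list 0 m = out"
    using w unfolding wp_def by auto
  have "put_list 0 inp (\<lambda>_. 0) q \<le> X" for q
    using inp nth_mem[of "q - 1" inp] by (auto simp: put_list_def)
  then have "bnd X ?s" by (simp add: bnd_def)
  moreover have "1 \<le> X" using X by simp
  ultimately obtain time where time: "exec R N c ?s time (r, m)"
    "time \<le> k * ((3 + 2 * D + C) * bits (2 ^ k * X))"
    using steps_exec[OF k(1), of X C D] c X(2) N by auto
  have "real time \<le> (log 2 (real n) + real t + 2) ^ e"
    using le_trans[OF k(2) pcost_le] psize_pos X(4,3) time(2)[unfolded X(1)] e by (rule time_poly)
  then show ?thesis unfolding runs_def using time(1) k(3) by blast
qed

section \<open>Program fragments\<close>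

primrec chain :: "instr list \<Rightarrow> prog \<Rightarrow> prog" where
  "chain [] c = c"
| "chain (i # is) c = Seq (Basic i) (chain is c)"

lemma wp_chain: "wp R N t c Q (fold (effect R N) is s) \<Longrightarrow> wp R N t (chain is c) Q s"
proof (induction "is" arbitrary: s)
  case (Cons i "is")
  from Cons.IH[of "effect R N i s"] Cons.prems show ?case by (simp add: wp_Seq wp_Basic)
qed simp

text \<open>Registers 0 and 1 are scratch. Register 2 holds an address behind the input, where neighbor lists
  are written; 3 the start value of the loops; 4 the error count of the current candidate; 5 and 6 the
  least error so far and its formula; 7 the value of the evaluated formula; 8 the label of the current
  example; 9 its offset (for the evaluator, the length of the input). The register families hold the
  offsets of the examples from which the parameters are reached (\<open>rA\<close>), the best parameters so far
  (\<open>rV\<close>), the current instance and parameters (\<open>rB\<close>), and the elements of the sphere (\<open>rE\<close>).\<close>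

definition rA :: "nat \<Rightarrow> nat" where "rA q = 10 + 4 * q"
definition rV :: "nat \<Rightarrow> nat" where "rV q = 11 + 4 * q"
definition rB :: "nat \<Rightarrow> nat" where "rB q = 12 + 4 * q"
definition rE :: "nat \<Rightarrow> nat" where "rE q = 13 + 4 * q"

lemma reg_inj [simp]:
  "rA p = rA q \<longleftrightarrow> p = q" "rV p = rV q \<longleftrightarrow> p = q" "rB p = rB q \<longleftrightarrow> p = q" "rE p = rE q \<longleftrightarrow> p = q"
  by (auto simp: rA_def rV_def rB_def rE_def)

lemma reg_distinct [simp]:
  "rA p \<noteq> rV q" "rA p \<noteq> rB q" "rA p \<noteq> rE q" "rV p \<noteq> rA q" "rV p \<noteq> rB q" "rV p \<noteq> rE q"
  "rB p \<noteq> rA q" "rB p \<noteq> rV q" "rB p \<noteq> rE q" "rE p \<noteq> rA q" "rE p \<noteq> rV q" "rE p \<noteq> rB q"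
  unfolding rA_def rV_def rB_def rE_def by presburger+

lemma reg_ge: "10 \<le> rA q" "10 \<le> rV q" "10 \<le> rB q" "10 \<le> rE q"
  by (auto simp: rA_def rV_def rB_def rE_def)

lemma reg_small [simp]:
  "c < 10 \<Longrightarrow> rA q \<noteq> c" "c < 10 \<Longrightarrow> rV q \<noteq> c" "c < 10 \<Longrightarrow> rB q \<noteq> c" "c < 10 \<Longrightarrow> rE q \<noteq> c"
  "c < 10 \<Longrightarrow> c \<noteq> rA q" "c < 10 \<Longrightarrow> c \<noteq> rV q" "c < 10 \<Longrightarrow> c \<noteq> rB q" "c < 10 \<Longrightarrow> c \<noteq> rE q"
  using reg_ge[of q] by auto

lemma reg_notin_range [simp]:
  "c < 10 \<Longrightarrow> c \<notin> range rE" "c < 10 \<Longrightarrow> c \<notin> range rV" "c < 10 \<Longrightarrow> c \<notin> rB ` S"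
  "rA q \<notin> range rE" "rV q \<notin> range rE" "rB q \<notin> range rE"
  "rA q \<notin> range rV" "rB q \<notin> range rV" "rE q \<notin> range rV"
  "rA q \<notin> rB ` S" "rV q \<notin> rB ` S" "rE q \<notin> rB ` S"
  by (auto simp: image_iff)

definition same :: "nat set \<Rightarrow> (nat \<Rightarrow> nat) \<Rightarrow> (nat \<Rightarrow> nat) \<Rightarrow> bool" where
  "same S r r' \<longleftrightarrow> (\<forall>a. a \<notin> S \<longrightarrow> r' a = r a)"

definition low :: "nat \<Rightarrow> (nat \<Rightarrow> nat) \<Rightarrow> (nat \<Rightarrow> nat) \<Rightarrow> bool" where
  "low L m m' \<longleftrightarrow> (\<forall>q \<le> L. m' q = m q)"

lemma sameD: "same S r r' \<Longrightarrow> a \<notin> S \<Longrightarrow> r' a = r a"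
  by (simp add: same_def)

lemma same_trans: "same S r r' \<Longrightarrow> same S' r' r'' \<Longrightarrow> S \<subseteq> U \<Longrightarrow> S' \<subseteq> U \<Longrightarrow> same U r r''"
  unfolding same_def by (metis subset_iff)

lemma same_refl [simp]: "same S r r"
  by (simp add: same_def)

lemma low_refl [simp]: "low L m m"
  by (simp add: low_def)

lemma low_trans: "low L m m' \<Longrightarrow> low L m' m'' \<Longrightarrow> low L m m''"
  by (simp add: low_def)

definition copyp :: "nat \<Rightarrow> nat \<Rightarrow> prog" where
  "copyp dst src = chain [Const 0 0] (Basic (Add dst src 0))"

lemma wp_copyp:
  assumes "src \<noteq> 0" and "\<And>r'. r' = r(0 := 0, dst := r src) \<Longrightarrow> Q (r', m)"
  shows "wp R N t (copyp dst src) Q (r, m)"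
  unfolding copyp_def using assms by (intro wp_chain) (auto intro!: wp_Basic)

text \<open>The truncated difference of length and \<open>j\<close> is nonzero iff index
  \<open>j\<close> is in range. Entry \<open>j\<close> is \<open>Suc j\<close> cells behind the
  start of the list, since the length comes first. Out of range, \<open>dst\<close> keeps its value
  as in \<open>nxt\<close>.\<close>

definition nbstep :: "nat \<Rightarrow> nat \<Rightarrow> prog" where
  "nbstep dst j = chain [AskNbrs dst 2, Load 0 2, Const 1 j, Sub 0 0 1]
     (IfNZ 0 (chain [Const 1 (Suc j), Add 1 2 1] (Basic (Load dst 1))) (Basic (Const 0 0)))"

text \<open>The list is written behind address \<open>L\<close>, so the cells up to
  \<open>L\<close>, which hold the input, survive.\<close>

lemma wp_nbstep:
  assumes r: "L < r 2" "dst \<notin> {0, 1, 2}"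
    and Q: "\<And>r' m'. r' dst = nxt N (r dst) j \<Longrightarrow> same {0, 1, dst} r r' \<Longrightarrow> low L m m' \<Longrightarrow> Q (r', m')"
  shows "wp R N t (nbstep dst j) Q (r, m)"
proof -
  let ?m = "put_list (r 2) (N (r dst)) m"
  have m: "low L m ?m" using r by (auto simp: low_def put_list_def)
  have l: "?m (r 2) = length (N (r dst))" by (simp add: put_list_def)
  have e: "j < length (N (r dst)) \<Longrightarrow> ?m (r 2 + Suc j) = N (r dst) ! j" by (simp add: put_list_def)
  let ?r = "r(0 := length (N (r dst)) - j, 1 := j)"
  have f: "fold (effect R N) [AskNbrs dst 2, Load 0 2, Const 1 j, Sub 0 0 1] (r, m) = (?r, ?m)"
    by (simp add: l fun_upd_twist)
  have g: "fold (effect R N) [Const 1 (Suc j), Add 1 2 1] (?r, ?m) = (?r(1 := r 2 + Suc j), ?m)"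
    using r(2) by simp
  show ?thesis
    unfolding nbstep_def
  proof (rule wp_chain, unfold f, rule wp_If)
    assume "fst (?r, ?m) 0 \<noteq> 0"
    then have j: "j < length (N (r dst))" by simp
    show "wp R N t (chain [Const 1 (Suc j), Add 1 2 1] (Basic (Load dst 1))) Q (?r, ?m)"
      by (rule wp_chain, unfold g, rule wp_Basic, simp, rule Q)
        (use r j e m in \<open>auto simp: nxt_def same_def\<close>)
  next
    assume "fst (?r, ?m) 0 = 0"
    then have "length (N (r dst)) \<le> j" by simp
    then show "wp R N t (Basic (Const 0 0)) Q (?r, ?m)"
      by (intro wp_Basic, simp, intro Q) (use r m in \<open>auto simp: nxt_def same_def\<close>)
  qed
qed

definition walkp :: "nat \<Rightarrow> nat list \<Rightarrow> prog" where
  "walkp dst js = seqs (map (nbstep dst) js)"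

lemma wp_walkp:
  assumes "L < r 2" "dst \<notin> {0, 1, 2}"
    and "\<And>r' m'. r' dst = walk N (r dst) js \<Longrightarrow> same {0, 1, dst} r r' \<Longrightarrow> low L m m' \<Longrightarrow> Q (r', m')"
  shows "wp R N t (walkp dst js) Q (r, m)"
  using assms
proof (induction js arbitrary: r m)
  case Nil
  then show ?case by (auto simp: walkp_def walk_def same_def intro!: wp_Basic)
next
  case (Cons j js)
  have "wp R N t (nbstep dst j) (wp R N t (walkp dst js) Q) (r, m)"
  proof (rule wp_nbstep[where L = L and r = r, OF Cons.prems(1,2)])
    fix r1 m1 assume 1: "r1 dst = nxt N (r dst) j" "same {0, 1, dst} r r1" "low L m m1"
    show "wp R N t (walkp dst js) Q (r1, m1)"
    proof (rule Cons.IH)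
      show "L < r1 2" using sameD[OF 1(2), of 2] Cons.prems(1,2) by simp
      fix r' m' assume 2: "r' dst = walk N (r1 dst) js" "same {0, 1, dst} r1 r'" "low L m1 m'"
      have "r' dst = walk N (r dst) (j # js)" using 1(1) 2(1) by (simp add: walk_def)
      then show "Q (r', m')"
        using Cons.prems(3) same_trans[OF 1(2) 2(2)] low_trans[OF 1(3) 2(3)] by blast
    qed (rule Cons.prems(2))
  qed
  then show ?case by (simp add: walkp_def wp_Seq)
qed

text \<open>The machine cannot multiply, so example \<open>i\<close> is referred to by its offset \<open>Suc i * Suc k\<close>, held in
  register \<open>a\<close>. Entry \<open>p\<close> of the example is then at address \<open>a + Suc p - k\<close>, with the label as
  entry \<open>k\<close>.\<close>

definition loadex :: "nat \<Rightarrow> nat \<Rightarrow> nat \<Rightarrow> nat \<Rightarrow> prog" where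
  "loadex k a p dst = chain [Const 0 (Suc p), Add 0 a 0, Const 1 k, Sub 0 0 1] (Basic (Load dst 0))"

lemma wp_loadex:
  assumes "a \<notin> {0, 1}" "dst \<notin> {0, 1}"
    and "\<And>r'. r' dst = m (r a + Suc p - k) \<Longrightarrow> same {0, 1, dst} r r' \<Longrightarrow> Q (r', m)"
  shows "wp R N t (loadex k a p dst) Q (r, m)"
  unfolding loadex_def
  by (rule wp_chain, use assms(1,2) in simp, rule wp_Basic, simp, rule assms(3))
    (use assms(1,2) in \<open>auto simp: same_def\<close>)

definition elemsp :: "nat \<Rightarrow> nat \<Rightarrow> nat \<Rightarrow> prog" where
  "elemsp d s m = seqs (map (\<lambda>i. Seq (copyp (rE i) (rB (fst (addrs d s m ! i)))) (walkp (rE i) (snd (addrs d s m ! i))))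
     [0..<length (addrs d s m)])"

lemma wp_elemsp:
  assumes r: "L < r 2" and Q: "\<And>r' m'. (\<And>i. i < length (addrs d s k) \<Longrightarrow> r' (rE i) = elems N d s (map (\<lambda>p. r (rB p)) [0..<k]) ! i) \<Longrightarrow>
      same ({0, 1} \<union> range rE) r r' \<Longrightarrow> low L m m' \<Longrightarrow> Q (r', m')"
  shows "wp R N t (elemsp d s k) Q (r, m)"
proof -
  let ?W = "length (addrs d s k)" and ?e = "elems N d s (map (\<lambda>p. r (rB p)) [0..<k])"
  let ?f = "\<lambda>i. Seq (copyp (rE i) (rB (fst (addrs d s k ! i)))) (walkp (rE i) (snd (addrs d s k ! i)))"
  let ?I = "\<lambda>i (r', m'). (\<forall>i' < i. r' (rE i') = ?e ! i') \<and> same ({0, 1} \<union> range rE) r r' \<and> low L m m'"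
  show ?thesis
    unfolding elemsp_def
  proof (rule wp_seqs[where I = ?I])
    fix i s' assume i: "i < length (map ?f [0..<?W])" and I: "?I i s'"
    obtain r' m' where s': "s' = (r', m')" by (cases s')
    have I': "\<And>i'. i' < i \<Longrightarrow> r' (rE i') = ?e ! i'" "same ({0, 1} \<union> range rE) r r'" "low L m m'"
      using I s' by auto
    obtain p js where pj: "addrs d s k ! i = (p, js)" by (cases "addrs d s k ! i")
    have iW: "i < ?W" using i by simp
    have p: "p < k" using nth_mem[OF iW] pj by (auto simp: addrs_def)
    have ei: "?e ! i = walk N (r (rB p)) js" using iW pj p by (simp add: elems_def)
    have "wp R N t (?f i) (?I (Suc i)) (r', m')"
    proof (intro wp_Seq wp_copyp)
      fix r1 assume r1: "r1 = r'(0 := 0, rE i := r' (rB (fst (addrs d s k ! i))))"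
      show "wp R N t (walkp (rE i) (snd (addrs d s k ! i))) (?I (Suc i)) (r1, m')"
      proof (rule wp_walkp)
        show "L < r1 2" using r1 sameD[OF I'(2), of 2] r by auto
        fix r2 m2 assume 2: "r2 (rE i) = walk N (r1 (rE i)) (snd (addrs d s k ! i))"
          "same {0, 1, rE i} r1 r2" "low L m' m2"
        have "r' (rB p) = r (rB p)" using sameD[OF I'(2), of "rB p"] by auto
        then have "r2 (rE i) = ?e ! i" using 2(1) r1 pj ei by simp
        moreover have "r2 (rE i') = ?e ! i'" if "i' < i" for i'
          using sameD[OF 2(2), of "rE i'"] that r1 I'(1)[OF that] by simp
        ultimately have "\<forall>i' < Suc i. r2 (rE i') = ?e ! i'" by (auto simp: less_Suc_eq)
        moreover have s1: "same {0, rE i} r' r1" using r1 by (simp add: same_def)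
        have s2: "same {0, 1, rE i} r' r2" by (rule same_trans[OF s1 2(2)]) auto
        have "same ({0, 1} \<union> range rE) r r2" by (rule same_trans[OF I'(2) s2]) auto
        ultimately show "?I (Suc i) (r2, m2)" using low_trans[OF I'(3) 2(3)] by simp
      qed simp
    qed simp
    then show "wp R N t (map ?f [0..<?W] ! i) (?I (Suc i)) s'" using i s' by simp
  next
    fix r' m' assume I: "?I (length (map ?f [0..<?W])) (r', m')"
    show "Q (r'(0 := 0), m')" by (rule Q) (use I in \<open>auto simp: same_def\<close>)
  qed simp
qed

text \<open>The sum of the two truncated differences vanishes iff the elements are equal. A nonzero
  value thus means inequality, hence the swapped order of \<open>c'\<close> and
  \<open>c\<close>.\<close>

primrec branch :: "atom \<Rightarrow> prog \<Rightarrow> prog \<Rightarrow> prog" where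
  "branch (AEq i j) c c' = chain [Sub 0 (rE i) (rE j), Sub 1 (rE j) (rE i), Add 0 0 1] (IfNZ 0 c' c)"
| "branch (ARel i is) c c' = chain [AskRel 0 i (map rE is)] (IfNZ 0 c c')"

primrec atom_ok :: "nat \<Rightarrow> atom \<Rightarrow> bool" where
  "atom_ok W (AEq i j) = (i < W \<and> j < W)"
| "atom_ok W (ARel i is) = (\<forall>x \<in> set is. x < W)"

lemma atoms_ok: "a \<in> set (atoms \<sigma> W) \<Longrightarrow> atom_ok W a"
  by (auto simp: atoms_def set_n_lists subset_iff)

lemma wp_branch:
  assumes a: "atom_ok W a" and e: "\<And>i. i < W \<Longrightarrow> r (rE i) = es ! i"
    and c: "\<And>r'. holds R es a \<Longrightarrow> same {0, 1} r r' \<Longrightarrow> wp R N t c Q (r', m)"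
    and c': "\<And>r'. \<not> holds R es a \<Longrightarrow> same {0, 1} r r' \<Longrightarrow> wp R N t c' Q (r', m)"
  shows "wp R N t (branch a c c') Q (r, m)"
proof (cases a)
  case (AEq i j)
  then have ij: "r (rE i) = es ! i" "r (rE j) = es ! j" using a e by auto
  let ?r = "r(0 := es ! i - es ! j + (es ! j - es ! i), 1 := es ! j - es ! i)"
  have s: "same {0, 1} r ?r" by (simp add: same_def)
  have f: "fold (effect R N) [Sub 0 (rE i) (rE j), Sub 1 (rE j) (rE i), Add 0 0 1] (r, m) = (?r, m)"
    by (simp add: ij fun_upd_twist)
  show ?thesis
    unfolding AEq branch.simps
  proof (rule wp_chain, unfold f, rule wp_If)
    assume "fst (?r, m) 0 \<noteq> 0"
    then have "es ! i \<noteq> es ! j" by auto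
    then show "wp R N t c' Q (?r, m)" using c'[OF _ s] AEq by simp
  next
    assume "fst (?r, m) 0 = 0"
    then have "es ! i = es ! j" by auto
    then show "wp R N t c Q (?r, m)" using c[OF _ s] AEq by simp
  qed
next
  case (ARel i "is")
  have m: "map r (map rE is) = map ((!) es) is" using a e ARel by auto
  let ?r = "r(0 := of_bool (R i (map ((!) es) is)))"
  have s: "same {0, 1} r ?r" by (simp add: same_def)
  have f: "fold (effect R N) [AskRel 0 i (map rE is)] (r, m) = (?r, m)"
    by (simp only: fold_simps effect.simps m)
  show ?thesis
    unfolding ARel branch.simps
  proof (rule wp_chain, unfold f, rule wp_If)
    assume "fst (?r, m) 0 \<noteq> 0"
    then show "wp R N t c Q (?r, m)" using c[OF _ s] ARel by (simp split: if_splits)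
  next
    assume "fst (?r, m) 0 = 0"
    then show "wp R N t c' Q (?r, m)" using c'[OF _ s] ARel by (simp split: if_splits)
  qed
qed

text \<open>Answers are remembered in the program position rather than in memory: a leaf knows the
  whole pattern. The tree is exponential in the number of atoms, but that number is fixed, and a run
  follows a single branch.\<close>

primrec dtree :: "atom list \<Rightarrow> bool list \<Rightarrow> (bool list \<Rightarrow> prog) \<Rightarrow> prog" where
  "dtree [] acc F = F acc"
| "dtree (a # as) acc F = branch a (dtree as (acc @ [True]) F) (dtree as (acc @ [False]) F)"

lemma wp_dtree:
  assumes "\<And>a. a \<in> set as \<Longrightarrow> atom_ok W a" "\<And>i. i < W \<Longrightarrow> r (rE i) = es ! i"
    and "\<And>r'. same {0, 1} r r' \<Longrightarrow> wp R N t (F (acc @ map (holds R es) as)) Q (r', m)"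
  shows "wp R N t (dtree as acc F) Q (r, m)"
  using assms
proof (induction as arbitrary: acc r)
  case (Cons a as)
  have ok: "atom_ok W a" using Cons.prems(1) by simp
  have *: "wp R N t (dtree as (acc @ [b]) F) Q (r', m)" if "holds R es a = b" "same {0, 1} r r'" for b r'
  proof (rule Cons.IH)
    show "r' (rE i) = es ! i" if "i < W" for i
      using sameD[OF \<open>same {0, 1} r r'\<close>, of "rE i"] Cons.prems(2)[OF that] by simp
    fix r'' assume "same {0, 1} r' r''"
    from same_trans[OF that(2) this, of "{0, 1}"]
    show "wp R N t (F ((acc @ [b]) @ map (holds R es) as)) Q (r'', m)"
      using Cons.prems(3)[of r''] that(1) by simp
  qed (use Cons.prems(1) in simp)
  show ?case unfolding dtree.simps by (rule wp_branch[OF ok Cons.prems(2)]) (use * in auto)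
qed simp

definition evalp :: "signature \<Rightarrow> nat \<Rightarrow> nat \<Rightarrow> nat \<Rightarrow> (bool list \<Rightarrow> bool) \<Rightarrow> prog" where
  "evalp \<sigma> d s m g = Seq (elemsp d s m)
     (dtree (atoms \<sigma> (length (addrs d s m))) [] (\<lambda>\<pi>. Basic (Const 7 (of_bool (g \<pi>)))))"

lemma wp_evalp:
  assumes r: "L < r 2" and as: "length as = k" "\<And>p. p < k \<Longrightarrow> r (rB p) = as ! p"
    and Q: "\<And>r' m'. r' 7 = of_bool (g (pattern \<sigma> d s R N as)) \<Longrightarrow>
      same ({0, 1, 7} \<union> range rE) r r' \<Longrightarrow> low L m m' \<Longrightarrow> Q (r', m')"
  shows "wp R N t (evalp \<sigma> d s k g) Q (r, m)"
  unfolding evalp_def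
proof (intro wp_Seq wp_elemsp[where L = L and r = r, OF r])
  have a: "map (\<lambda>p. r (rB p)) [0..<k] = as" using as by (intro nth_equalityI) auto
  fix r1 m1 assume 1: "\<And>i. i < length (addrs d s k) \<Longrightarrow> r1 (rE i) = elems N d s (map (\<lambda>p. r (rB p)) [0..<k]) ! i"
    "same ({0, 1} \<union> range rE) r r1" "low L m m1"
  let ?F = "\<lambda>\<pi>. Basic (Const 7 (of_bool (g \<pi>)))"
  show "wp R N t (dtree (atoms \<sigma> (length (addrs d s k))) [] ?F) Q (r1, m1)"
  proof (rule wp_dtree[OF atoms_ok 1(1)[unfolded a]])
    fix r2 assume 2: "same {0, 1} r1 r2"
    have "same ({0, 1, 7} \<union> range rE) r (r2(7 := x))" for x
      using 1(2) 2 by (auto simp: same_def)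
    then show "wp R N t (?F ([] @ map (holds R (elems N d s as)) (atoms \<sigma> (length (addrs d s k))))) Q (r2, m1)"
      using Q[OF _ _ 1(3)] as(1) by (intro wp_Basic) (simp add: pattern_def)
  qed
qed

text \<open>There is no jump to a computed place, so the keys are tried in turn, with the equality
  test of \<open>branch\<close>.\<close>

primrec dispp :: "nat \<Rightarrow> (nat \<times> prog) list \<Rightarrow> prog" where
  "dispp a [] = Basic (Const 0 0)"
| "dispp a (x # xs) = chain [Const 1 (fst x), Sub 0 a 1, Sub 1 1 a, Add 0 0 1] (IfNZ 0 (dispp a xs) (snd x))"

lemma wp_dispp:
  assumes "(r a, c) \<in> set xs" "distinct (map fst xs)" "a \<notin> {0, 1}"
    and "\<And>r'. same {0, 1} r r' \<Longrightarrow> wp R N t c Q (r', m)"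
  shows "wp R N t (dispp a xs) Q (r, m)"
  using assms
proof (induction xs arbitrary: r)
  case (Cons x xs)
  let ?r = "r(0 := r a - fst x + (fst x - r a), 1 := fst x - r a)"
  have s: "same {0, 1} r ?r" by (simp add: same_def)
  have f: "fold (effect R N) [Const 1 (fst x), Sub 0 a 1, Sub 1 1 a, Add 0 0 1] (r, m) = (?r, m)"
    using Cons.prems(3) by (simp add: fun_upd_twist)
  have a: "?r a = r a" using Cons.prems(3) by simp
  show ?case
    unfolding dispp.simps
  proof (rule wp_chain, unfold f, rule wp_If)
    assume "fst (?r, m) 0 \<noteq> 0"
    then have "(?r a, c) \<in> set xs" using Cons.prems(1) a by auto
    then show "wp R N t (dispp a xs) Q (?r, m)"
    proof (rule Cons.IH)
      fix r' assume "same {0, 1} ?r r'"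
      from same_trans[OF s this] show "wp R N t c Q (r', m)" using Cons.prems(4) by blast
    qed (use Cons.prems in auto)
  next
    assume "fst (?r, m) 0 = 0"
    then have "fst x = r a" by auto
    then have "snd x = c" using Cons.prems(1,2) by force
    then show "wp R N t (snd x) Q (?r, m)" using Cons.prems(4)[OF s] by (simp only:)
  qed
qed simp

type_synonym source = "nat + nat"

primrec sval :: "(nat \<Rightarrow> nat) \<Rightarrow> source \<Rightarrow> nat" where
  "sval r (Inl a) = r a"
| "sval r (Inr c) = c"

primrec putp :: "nat \<Rightarrow> source \<Rightarrow> prog" where
  "putp q (Inl a) = chain [Const 1 q] (Basic (Store 1 a))"
| "putp q (Inr c) = chain [Const 0 c, Const 1 q] (Basic (Store 1 0))"

lemma wp_putp:
  assumes "x \<notin> Inl ` {0, 1}" and "\<And>r'. same {0, 1} r r' \<Longrightarrow> Q (r', m(q := sval r x))"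
  shows "wp R N t (putp q x) Q (r, m)"
proof (cases x)
  case (Inl a)
  have "same {0, 1} r (r(Suc 0 := q))" by (simp add: same_def)
  from assms(2)[OF this] show ?thesis
    unfolding Inl putp.simps using assms(1) Inl by (intro wp_chain) (auto intro!: wp_Basic)
next
  case (Inr c)
  have "same {0, 1} r (r(0 := c, Suc 0 := q))" by (simp add: same_def)
  from assms(2)[OF this] show ?thesis
    unfolding Inr putp.simps using Inr by (intro wp_chain) (auto intro!: wp_Basic)
qed

text \<open>The output overwrites the input from address 0 on, so its values come from registers or
  constants, and not from the scratch registers used for storing.\<close>

definition writeout :: "source list \<Rightarrow> prog" where
  "writeout xs = Seq (putp 0 (Inr (length xs))) (seqs (map (\<lambda>i. putp (Suc i) (xs ! i)) [0..<length xs]))"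

lemma wp_writeout:
  assumes xs: "set xs \<inter> Inl ` {0, 1} = {}" and Q: "\<And>r' m'. get_list 0 m' = map (sval r) xs \<Longrightarrow> Q (r', m')"
  shows "wp R N t (writeout xs) Q (r, m)"
  unfolding writeout_def
proof (intro wp_Seq wp_putp)
  fix r1 assume 1: "same {0, 1} r r1"
  let ?I = "\<lambda>i (r', m'). same {0, 1} r r' \<and> m' 0 = length xs \<and> (\<forall>i' < i. m' (Suc i') = sval r (xs ! i'))"
  let ?f = "\<lambda>i. putp (Suc i) (xs ! i)"
  show "wp R N t (seqs (map ?f [0..<length xs])) Q (r1, m(0 := sval r (Inr (length xs))))"
  proof (rule wp_seqs[where I = ?I])
    fix i s' assume i: "i < length (map ?f [0..<length xs])" and I: "?I i s'"
    obtain r' m' where s': "s' = (r', m')" by (cases s')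
    have I': "same {0, 1} r r'" "m' 0 = length xs" "\<And>i'. i' < i \<Longrightarrow> m' (Suc i') = sval r (xs ! i')"
      using I s' by auto
    have "xs ! i \<in> set xs" using i by simp
    then have ni: "xs ! i \<notin> Inl ` {0, 1}" using xs by blast
    have v: "sval r' (xs ! i) = sval r (xs ! i)"
      using ni I'(1) by (cases "xs ! i") (auto simp: same_def)
    have "wp R N t (?f i) (?I (Suc i)) (r', m')"
    proof (rule wp_putp[OF ni])
      fix r2 assume "same {0, 1} r' r2"
      from same_trans[OF I'(1) this] show "?I (Suc i) (r2, m'(Suc i := sval r' (xs ! i)))"
        using I' v by (auto simp: less_Suc_eq)
    qed
    then show "wp R N t (map ?f [0..<length xs] ! i) (?I (Suc i)) s'" using i s' by simp
  next
    fix r' m' assume I: "?I (length (map ?f [0..<length xs])) (r', m')"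
    show "Q (r'(0 := 0), m')"
      by (rule Q) (use I in \<open>auto simp: get_list_def intro!: nth_equalityI\<close>)
  qed (use 1 in simp)
qed simp

section \<open>The learner and the evaluator\<close>

type_synonym choice = "(nat \<times> nat list) option"

definition parp :: "nat \<Rightarrow> nat \<Rightarrow> choice \<Rightarrow> prog" where
  "parp k q c = (case c of None \<Rightarrow> Basic (Const (rB (k + q)) 0)
     | Some pj \<Rightarrow> Seq (loadex k (rA q) (fst pj) (rB (k + q))) (walkp (rB (k + q)) (snd pj)))"

definition loadu :: "nat \<Rightarrow> prog" where
  "loadu k = seqs (map (\<lambda>p. loadex k 9 p (rB p)) [0..<k])"

text \<open>The error grows by the absolute difference of prediction (register 7) and label
  (register 8). Register 9 then moves to the preceding example, so examples are visited from last to
  first.\<close>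

definition errbody :: "signature \<Rightarrow> nat \<Rightarrow> nat \<Rightarrow> nat \<Rightarrow> nat \<Rightarrow> (bool list \<Rightarrow> bool) \<Rightarrow> prog" where
  "errbody \<sigma> d s k l g = Seq (loadu k) (Seq (evalp \<sigma> d s (k + l) g) (Seq (loadex k 9 k 8)
     (chain [Sub 0 7 8, Sub 1 8 7, Add 0 0 1, Add 4 4 0, Const 0 (Suc k)] (Basic (Sub 9 9 0)))))"

definition errp :: "signature \<Rightarrow> nat \<Rightarrow> nat \<Rightarrow> nat \<Rightarrow> nat \<Rightarrow> (bool list \<Rightarrow> bool) \<Rightarrow> prog" where
  "errp \<sigma> d s k l g = chain [Const 4 0, Const 0 0, Add 9 3 0] (WhileNZ 9 (errbody \<sigma> d s k l g))"

definition updp :: "nat \<Rightarrow> nat \<Rightarrow> nat \<Rightarrow> prog" where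
  "updp k l i = chain [Sub 0 5 4] (IfNZ 0
     (chain [Const 0 0, Add 5 4 0, Const 6 i] (seqs (map (\<lambda>q. copyp (rV q) (rB (k + q))) [0..<l])))
     (Basic (Const 0 0)))"

definition candp :: "signature \<Rightarrow> nat \<Rightarrow> nat \<Rightarrow> nat \<Rightarrow> nat \<Rightarrow> nat \<Rightarrow> (bool list \<Rightarrow> bool) \<Rightarrow> choice list \<Rightarrow> prog" where
  "candp \<sigma> d s k l i g ws =
     Seq (seqs (map (\<lambda>q. parp k q (ws ! q)) [0..<l])) (Seq (errp \<sigma> d s k l g) (updp k l i))"

text \<open>With \<open>t * Suc k\<close> in register 3, a loop register runs through the multiples
  of \<open>Suc k\<close> from there down to \<open>Suc k\<close>, which are the offsets of the
  examples, and 0 ends the loop. Nested over the \<open>l\<close> parameter positions this tries all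
  \<open>t ^ l\<close> choices of examples.\<close>

primrec nest :: "nat \<Rightarrow> nat list \<Rightarrow> prog \<Rightarrow> prog" where
  "nest k [] body = body"
| "nest k (a # as) body =
     Seq (copyp a 3) (WhileNZ a (Seq (nest k as body) (chain [Const 0 (Suc k)] (Basic (Sub a a 0)))))"

text \<open>A parameter is the default element 0 (\<open>None\<close>), or it is reached from entry \<open>p\<close> of some example by
  following the word \<open>js\<close>; the example is chosen by the loops of \<open>nest\<close>.\<close>

definition cands :: "nat \<Rightarrow> nat \<Rightarrow> nat \<Rightarrow> choice list" where
  "cands k d D = None # map Some (List.product [0..<k] (words d D))"

definition outputs :: "nat \<Rightarrow> (fo \<times> (bool list \<Rightarrow> bool)) list \<Rightarrow> nat \<Rightarrow> source list" where
  "outputs l \<Phi> i = map (\<lambda>q. Inl (rV q)) [0..<l] @ map Inr (enc_fo (fst (\<Phi> ! i)))"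

text \<open>Formulas and words do not depend on the input, so their enumeration is unrolled in the
  program text; the choice of examples is made by loops. Initially register 3 gets the input length
  minus 1, which is \<open>t * Suc k\<close>, and register 5 gets \<open>t + 1\<close>.\<close>

definition learnp ::
  "signature \<Rightarrow> nat \<Rightarrow> nat \<Rightarrow> nat \<Rightarrow> nat \<Rightarrow> nat \<Rightarrow> (fo \<times> (bool list \<Rightarrow> bool)) list \<Rightarrow> prog" where
  "learnp \<sigma> d s D k l \<Phi> = chain [Const 1 0, Load 0 1, Const 1 1, Add 2 0 1, Sub 3 0 1, Load 5 1, Add 5 5 1]
     (Seq (seqs (map (\<lambda>(i, ws). nest k (map rA [0..<l]) (candp \<sigma> d s k l i (snd (\<Phi> ! i)) ws))
         (List.product [0..<length \<Phi>] (List.n_lists l (cands k d D)))))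
       (dispp 6 (map (\<lambda>i. (i, writeout (outputs l \<Phi> i))) [0..<length \<Phi>])))"

section \<open>Correctness of the learner\<close>

lemma concat_uniform:
  assumes "\<And>b. b \<in> set bs \<Longrightarrow> length b = c"
  shows "length (concat bs) = length bs * c"
    and "i < length bs \<Longrightarrow> p < c \<Longrightarrow> concat bs ! (i * c + p) = bs ! i ! p"
proof -
  have "length (concat bs) = length bs * c \<and>
    (\<forall>i p. i < length bs \<longrightarrow> p < c \<longrightarrow> concat bs ! (i * c + p) = bs ! i ! p)"
    using assms
  proof (induction bs)
    case (Cons b bs)
    have b: "length b = c" using Cons.prems by simp
    have IH: "length (concat bs) = length bs * c"
      "\<And>i p. i < length bs \<Longrightarrow> p < c \<Longrightarrow> concat bs ! (i * c + p) = bs ! i ! p"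
      using Cons by auto
    have "concat (b # bs) ! (i * c + p) = (b # bs) ! i ! p" if "i < length (b # bs)" "p < c" for i p
    proof (cases i)
      case 0
      then show ?thesis using b that by (simp add: nth_append)
    next
      case (Suc j)
      have "concat (b # bs) ! (i * c + p) = concat bs ! (j * c + p)"
        using b Suc by (simp add: nth_append)
      then show ?thesis using IH(2)[of j p] Suc that by simp
    qed
    then show ?case using b IH(1) by simp
  qed simp
  then show "length (concat bs) = length bs * c"
    and "i < length bs \<Longrightarrow> p < c \<Longrightarrow> concat bs ! (i * c + p) = bs ! i ! p" by auto
qed

text \<open>A run has one final state, so a witness that depends on this state can be fixed
  outside.\<close>

lemma wp_ex: "wp R N t c (\<lambda>s. \<exists>x. Q x s) s0 \<Longrightarrow> \<exists>x. wp R N t c (Q x) s0"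
  unfolding wp_def by blast

locale learner =
  fixes \<sigma> :: signature and d s D k l :: nat and \<Phi> :: "(fo \<times> (bool list \<Rightarrow> bool)) list"
    and B :: "nat struct" and R :: "nat \<Rightarrow> nat list \<Rightarrow> bool" and N :: "nat \<Rightarrow> nat list"
    and T :: "(nat list \<times> bool) list"
  assumes adm: "admissible \<sigma> d B R N" and T: "is_training B k T" and zero: "0 \<in> univ B" and \<Phi>: "\<Phi> \<noteq> []"
begin

abbreviation "t \<equiv> length T"
abbreviation "WP \<equiv> wp R N t"

definition m0 :: "nat \<Rightarrow> nat" where "m0 = put_list 0 (enc_training T) (\<lambda>_. 0)"
definition L0 :: nat where "L0 = length (enc_training T)"

definition row :: "nat \<Rightarrow> nat list" where
  "row i = fst (T ! i) @ [of_bool (snd (T ! i))]"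

definition misclassified :: "(bool list \<Rightarrow> bool) \<Rightarrow> nat list \<Rightarrow> nat \<Rightarrow> bool" where
  "misclassified g v i \<longleftrightarrow> g (pattern \<sigma> d s R N (fst (T ! i) @ v)) \<noteq> snd (T ! i)"

definition error_count :: "(bool list \<Rightarrow> bool) \<Rightarrow> nat list \<Rightarrow> nat" where
  "error_count g v = card {i. i < t \<and> misclassified g v i}"

lemma T_nth: "i < t \<Longrightarrow> length (fst (T ! i)) = k \<and> set (fst (T ! i)) \<subseteq> univ B"
  using T nth_mem[of i T] unfolding is_training_def by (cases "T ! i") auto

text \<open>Memory layout: cell 0 holds the input length, cell 1 the number of examples, then follow
  blocks of \<open>Suc k\<close> cells. Subtracting \<open>k\<close> in the address is exact because
  \<open>Suc i * Suc k\<close> exceeds \<open>k\<close>.\<close>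

lemma L0_eq: "L0 = Suc (t * Suc k)"
  and m0_0: "m0 0 = L0" and m0_1: "m0 (Suc 0) = t"
  and m0_row: "i < t \<Longrightarrow> p \<le> k \<Longrightarrow> m0 (Suc i * Suc k + Suc p - k) = row i ! p"
  and row_le: "i < t \<Longrightarrow> p \<le> k \<Longrightarrow> Suc i * Suc k + Suc p - k \<le> L0"
proof -
  let ?bs = "map (\<lambda>(u, c). u @ [of_bool c]) T :: nat list list"
  have len: "length b = Suc k" if "b \<in> set ?bs" for b
    using that T unfolding is_training_def by auto
  show L: "L0 = Suc (t * Suc k)"
    unfolding L0_def enc_training_def using concat_uniform(1)[of ?bs "Suc k"] len by simp
  show "m0 0 = L0" by (simp add: m0_def L0_def put_list_def)
  show "m0 (Suc 0) = t" by (simp add: m0_def put_list_def enc_training_def)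
  assume i: "i < t" and p: "p \<le> k"
  have a: "Suc i * Suc k + Suc p - k = Suc (Suc (i * Suc k + p))" by simp
  have "Suc i * Suc k \<le> t * Suc k" using i by (intro mult_le_mono1) simp
  then have le: "Suc (Suc (i * Suc k + p)) \<le> L0" using p L by simp
  then show "Suc i * Suc k + Suc p - k \<le> L0" unfolding a .
  have "concat ?bs ! (i * Suc k + p) = ?bs ! i ! p"
    using concat_uniform(2)[of ?bs "Suc k" i p] len i p by simp
  also have "?bs ! i = row i" using i by (simp add: row_def split: prod.split)
  finally show "m0 (Suc i * Suc k + Suc p - k) = row i ! p"
    unfolding a using le by (simp add: m0_def put_list_def L0_def enc_training_def)
qed

lemma wp_load_row:
  assumes "low L0 m0 m" "r a = Suc i * Suc k" "i < t" "p \<le> k" "a \<notin> {0, 1}" "dst \<notin> {0, 1}"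
    and Q: "\<And>r'. r' dst = row i ! p \<Longrightarrow> same {0, 1, dst} r r' \<Longrightarrow> Q (r', m)"
  shows "WP (loadex k a p dst) Q (r, m)"
proof (rule wp_loadex[OF assms(5,6)])
  fix r' assume r': "r' dst = m (r a + Suc p - k)" "same {0, 1, dst} r r'"
  have "m (r a + Suc p - k) = m0 (Suc i * Suc k + Suc p - k)"
    using assms(1) row_le[OF assms(3,4)] unfolding assms(2) low_def by blast
  then show "Q (r', m)" using Q r' m0_row[OF assms(3,4)] by simp
qed

lemma wp_loadu:
  assumes "low L0 m0 m" "r 9 = Suc i * Suc k" "i < t"
    and Q: "\<And>r'. (\<And>p. p < k \<Longrightarrow> r' (rB p) = fst (T ! i) ! p) \<Longrightarrow> same ({0, 1} \<union> rB ` {..<k}) r r' \<Longrightarrow> Q (r', m)"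
  shows "WP (loadu k) Q (r, m)"
proof -
  let ?I = "\<lambda>j (r', m'). m' = m \<and> same ({0, 1} \<union> rB ` {..<k}) r r' \<and> (\<forall>p < j. r' (rB p) = fst (T ! i) ! p)"
  let ?f = "\<lambda>p. loadex k 9 p (rB p)"
  show ?thesis
    unfolding loadu_def
  proof (rule wp_seqs[where I = ?I])
    fix p s' assume p: "p < length (map ?f [0..<k])" and I: "?I p s'"
    obtain r1 where s': "s' = (r1, m)" and r1: "same ({0, 1} \<union> rB ` {..<k}) r r1"
      "\<And>p'. p' < p \<Longrightarrow> r1 (rB p') = fst (T ! i) ! p'" using I by (cases s') auto
    have "WP (?f p) (?I (Suc p)) (r1, m)"
    proof (rule wp_load_row[OF assms(1) _ assms(3)])
      show "r1 9 = Suc i * Suc k" using sameD[OF r1(1), of 9] assms(2) by simp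
      fix r2 assume r2: "r2 (rB p) = row i ! p" "same {0, 1, rB p} r1 r2"
      have "same ({0, 1} \<union> rB ` {..<k}) r r2" by (rule same_trans[OF r1(1) r2(2)]) (use p in auto)
      moreover have "r2 (rB p') = fst (T ! i) ! p'" if "p' < Suc p" for p'
      proof (cases "p' = p")
        case True
        then show ?thesis using r2(1) p T_nth[OF assms(3)] by (simp add: row_def nth_append)
      next
        case False
        then show ?thesis using sameD[OF r2(2), of "rB p'"] r1(2)[of p'] that by simp
      qed
      ultimately show "?I (Suc p) (r2, m)" by simp
    qed (use p in auto)
    then show "WP (map ?f [0..<k] ! p) (?I (Suc p)) s'" using p s' by simp
  next
    fix r' m' assume I: "?I (length (map ?f [0..<k])) (r', m')"
    then have "same ({0, 1} \<union> rB ` {..<k}) r (r'(0 := 0))" "m' = m" by (auto simp: same_def)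
    then show "Q (r'(0 := 0), m')" using Q[of "r'(0 := 0)"] I by simp
  qed simp
qed

text \<open>The registers that computing the error of a candidate may change. It spares the loop
  registers \<open>rA\<close>, the stored parameters \<open>rV\<close> and the current parameters,
  which lie behind the first \<open>k\<close> entries of \<open>rB\<close>.\<close>

abbreviation U :: "nat set" where
  "U \<equiv> {0, 1, 4, 7, 8, 9} \<union> range rE \<union> rB ` {..<k}"

lemma wp_errbody:
  assumes m: "low L0 m0 m" and r: "r 2 = Suc L0" "r 9 = Suc i * Suc k" and i: "i < t"
    and v: "length v = l" "\<And>q. q < l \<Longrightarrow> r (rB (k + q)) = v ! q"
    and Q: "\<And>r' m'. r' 9 = i * Suc k \<Longrightarrow> r' 4 = r 4 + of_bool (misclassified g v i) \<Longrightarrow> same U r r' \<Longrightarrow>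
      low L0 m0 m' \<Longrightarrow> Q (r', m')"
  shows "WP (errbody \<sigma> d s k l g) Q (r, m)"
  unfolding errbody_def
proof (rule wp_Seq, rule wp_loadu[where r = r and m = m and i = i, OF m r(2) i])
  fix r1 assume r1: "\<And>p. p < k \<Longrightarrow> r1 (rB p) = fst (T ! i) ! p" "same ({0, 1} \<union> rB ` {..<k}) r r1"
  let ?as = "fst (T ! i) @ v"
  have lu: "length (fst (T ! i)) = k" using T_nth[OF i] by simp
  have asv: "r1 (rB p) = ?as ! p" if p: "p < k + l" for p
  proof (cases "p < k")
    case True
    then show ?thesis using r1(1) lu by (simp add: nth_append)
  next
    case False
    then have "rB p \<notin> {0, 1} \<union> rB ` {..<k}" by auto
    from sameD[OF r1(2) this] show ?thesis using v(2)[of "p - k"] False p lu by (simp add: nth_append)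
  qed
  have L: "L0 < r1 2" using sameD[OF r1(2), of 2] r(1) by simp
  have las: "length ?as = k + l" using lu v(1) by simp
  let ?c = "chain [Sub 0 7 8, Sub 1 8 7, Add 0 0 1, Add 4 4 0, Const 0 (Suc k)] (Basic (Sub 9 9 0))"
  show "WP (Seq (evalp \<sigma> d s (k + l) g) (Seq (loadex k 9 k 8) ?c)) Q (r1, m)"
  proof (rule wp_Seq, rule wp_evalp[where L = L0 and r = r1, OF L las asv])
    fix r2 m2 assume r2: "r2 7 = of_bool (g (pattern \<sigma> d s R N ?as))" "same ({0, 1, 7} \<union> range rE) r1 r2" "low L0 m m2"
    note m2 = low_trans[OF m r2(3)]
    show "WP (Seq (loadex k 9 k 8) ?c) Q (r2, m2)"
    proof (rule wp_Seq, rule wp_load_row[OF m2 _ i])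
      show "r2 9 = Suc i * Suc k" using sameD[OF r1(2), of 9] sameD[OF r2(2), of 9] r(2) by simp
      fix r3 assume r3: "r3 8 = row i ! k" "same {0, 1, 8} r2 r3"
      have lab: "r3 8 = of_bool (snd (T ! i))" using r3(1) lu by (simp add: row_def nth_append)
      have "r3 7 = r2 7" using sameD[OF r3(2), of 7] by simp
      then have diff: "(r3 7 - r3 8) + (r3 8 - r3 7) = of_bool (misclassified g v i)"
        unfolding lab using r2(1) by (auto simp: misclassified_def)
      have s12: "same U r r2" by (rule same_trans[OF r1(2) r2(2)]) auto
      have s13: "same U r r3" by (rule same_trans[OF s12 r3(2)]) auto
      have r39: "r3 9 = Suc i * Suc k" using \<open>r2 9 = Suc i * Suc k\<close> sameD[OF r3(2), of 9] by simp
      have r34: "r3 4 = r 4" using sameD[OF r1(2), of 4] sameD[OF r2(2), of 4] sameD[OF r3(2), of 4] by simp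
      show "WP ?c Q (r3, m2)"
        by (rule wp_chain, rule wp_Basic, simp, rule Q)
          (use r39 r34 diff m2 s13 in \<open>auto simp: same_def\<close>)
    qed auto
  qed auto
qed

lemma wp_errp:
  assumes m: "low L0 m0 m" and r: "r 2 = Suc L0" "r 3 = t * Suc k"
    and v: "length v = l" "\<And>q. q < l \<Longrightarrow> r (rB (k + q)) = v ! q"
    and Q: "\<And>r' m'. r' 4 = error_count g v \<Longrightarrow> same U r r' \<Longrightarrow> low L0 m0 m' \<Longrightarrow> Q (r', m')"
  shows "WP (errp \<sigma> d s k l g) Q (r, m)"
proof -
  \<comment> \<open>The loop runs downward, so with \<open>j\<close> iterations left the examples
    from \<open>j\<close> on have been counted.\<close>
  let ?I = "\<lambda>j (r', m'). r' 9 = j * Suc k \<and> r' 4 = card {i. j \<le> i \<and> i < t \<and> misclassified g v i} \<and> same U r r' \<and> low L0 m0 m'"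
  let ?r = "r(4 := 0, 0 := 0, 9 := t * Suc k)"
  have f: "fold (effect R N) [Const 4 0, Const 0 0, Add 9 3 0] (r, m) = (?r, m)" using r(2) by simp
  have "WP (WhileNZ 9 (errbody \<sigma> d s k l g)) (?I 0) (?r, m)"
  proof (rule wp_While[where n = t and I = ?I])
    fix j s' assume j: "j < t" and I: "?I (Suc j) s'"
    obtain r' m' where s': "s' = (r', m')" by (cases s')
    have I': "r' 9 = Suc j * Suc k" "r' 4 = card {i. Suc j \<le> i \<and> i < t \<and> misclassified g v i}" "same U r r'" "low L0 m0 m'"
      using I s' by auto
    have "WP (errbody \<sigma> d s k l g) (?I j) (r', m')"
    proof (rule wp_errbody[where r = r' and m = m' and i = j and v = v, OF I'(4) _ I'(1) j v(1)])
      show "r' 2 = Suc L0" using sameD[OF I'(3), of 2] r(1) by simp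
      show "r' (rB (k + q)) = v ! q" if "q < l" for q
        using sameD[OF I'(3), of "rB (k + q)"] v(2)[OF that] by (auto simp: image_iff)
      fix r2 m2 assume 2: "r2 9 = j * Suc k" "r2 4 = r' 4 + of_bool (misclassified g v j)" "same U r' r2" "low L0 m0 m2"
      have "{i. j \<le> i \<and> i < t \<and> misclassified g v i} =
        (if misclassified g v j then insert j {i. Suc j \<le> i \<and> i < t \<and> misclassified g v i} else {i. Suc j \<le> i \<and> i < t \<and> misclassified g v i})"
        using j by (auto simp: Suc_le_eq le_less)
      then have "r2 4 = card {i. j \<le> i \<and> i < t \<and> misclassified g v i}" using 2(2) I'(2) by simp
      then show "?I j (r2, m2)" using 2 same_trans[OF I'(3) 2(3), of U] by simp
    qed
    then show "fst s' 9 \<noteq> 0 \<and> WP (errbody \<sigma> d s k l g) (?I j) s'" using s' I'(1) by simp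
  next
    have "{i. t \<le> i \<and> i < t \<and> misclassified g v i} = {}" by auto
    then show "?I t (?r, m)" using m by (simp add: same_def)
  qed auto
  then have "WP (WhileNZ 9 (errbody \<sigma> d s k l g)) Q (?r, m)"
    by (rule wp_mono) (auto intro: Q simp: error_count_def)
  then show ?thesis unfolding errp_def by (intro wp_chain) (simp only: f)
qed

definition candidate_entry :: "choice list \<Rightarrow> nat list \<Rightarrow> nat \<Rightarrow> nat" where
  "candidate_entry ws x q = (case ws ! q of None \<Rightarrow> 0 | Some pj \<Rightarrow> walk N (fst (T ! (x ! q)) ! fst pj) (snd pj))"

definition candidate :: "choice list \<Rightarrow> nat list \<Rightarrow> nat list" where
  "candidate ws x = map (candidate_entry ws x) [0..<l]"

definition valid :: "nat list \<Rightarrow> bool" where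
  "valid x \<longleftrightarrow> length x = l \<and> (\<forall>q < l. x ! q < t)"

definition ws_ok :: "choice list \<Rightarrow> bool" where
  "ws_ok ws \<longleftrightarrow> length ws = l \<and> set ws \<subseteq> set (cands k d D)"

lemma ws_okD: "ws_ok ws \<Longrightarrow> q < l \<Longrightarrow> ws ! q = Some (p, js) \<Longrightarrow> p < k \<and> js \<in> set (words d D)"
  using nth_mem[of q ws] unfolding ws_ok_def cands_def by auto

lemma candidate_univ:
  assumes "ws_ok ws" "valid x"
  shows "length (candidate ws x) = l" "set (candidate ws x) \<subseteq> univ B"
proof -
  have "candidate_entry ws x q \<in> univ B" if q: "q < l" for q
  proof (cases "ws ! q")
    case None
    then show ?thesis using zero by (simp add: candidate_entry_def)
  next
    case (Some pj)
    then obtain p js where c: "ws ! q = Some (p, js)" by (cases pj) auto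
    have pj: "p < k" "js \<in> set (words d D)" using ws_okD[OF assms(1) q c] by auto
    have "x ! q < t" using assms(2) q by (simp add: valid_def)
    then have "fst (T ! (x ! q)) ! p \<in> univ B" using T_nth[of "x ! q"] pj(1) nth_mem by fastforce
    then have "walk N (fst (T ! (x ! q)) ! p) js \<in> univ B"
      using walk_image[OF adm, of "fst (T ! (x ! q)) ! p" D] pj(2) nbhd_univ[of B D] by blast
    then show ?thesis using c by (simp add: candidate_entry_def)
  qed
  then show "length (candidate ws x) = l" "set (candidate ws x) \<subseteq> univ B" by (auto simp: candidate_def)
qed

lemma wp_params:
  assumes m: "low L0 m0 m" and r: "r 2 = Suc L0" and ws: "ws_ok ws" and x: "valid x"
    and A: "\<And>q. q < l \<Longrightarrow> r (rA q) = Suc (x ! q) * Suc k"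
    and Q: "\<And>r' m'. (\<And>q. q < l \<Longrightarrow> r' (rB (k + q)) = candidate ws x ! q) \<Longrightarrow>
      same ({0, 1} \<union> range rB) r r' \<Longrightarrow> low L0 m0 m' \<Longrightarrow> Q (r', m')"
  shows "WP (seqs (map (\<lambda>q. parp k q (ws ! q)) [0..<l])) Q (r, m)"
proof -
  let ?f = "\<lambda>q. parp k q (ws ! q)"
  let ?I = "\<lambda>j (r', m'). same ({0, 1} \<union> range rB) r r' \<and> low L0 m0 m' \<and> (\<forall>q < j. r' (rB (k + q)) = candidate_entry ws x q)"
  show ?thesis
  proof (rule wp_seqs[where I = ?I])
    fix q s' assume "q < length (map ?f [0..<l])" and I: "?I q s'"
    then have q: "q < l" by simp
    obtain r1 m1 where s': "s' = (r1, m1)" by (cases s')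
    have I': "same ({0, 1} \<union> range rB) r r1" "low L0 m0 m1" "\<And>q'. q' < q \<Longrightarrow> r1 (rB (k + q')) = candidate_entry ws x q'"
      using I s' by auto
    have fin: "?I (Suc q) (r2, m2)"
      if "r2 (rB (k + q)) = candidate_entry ws x q" "same {0, 1, rB (k + q)} r1 r2" "low L0 m0 m2" for r2 m2
    proof -
      have "same ({0, 1} \<union> range rB) r r2" by (rule same_trans[OF I'(1) that(2)]) auto
      moreover have "r2 (rB (k + q')) = candidate_entry ws x q'" if "q' < q" for q'
        using sameD[OF \<open>same {0, 1, rB (k + q)} r1 r2\<close>, of "rB (k + q')"] I'(3)[OF that] that by simp
      ultimately show ?thesis using that by (auto simp: less_Suc_eq)
    qed
    have "WP (?f q) (?I (Suc q)) (r1, m1)"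
    proof (cases "ws ! q")
      case None
      then have "?I (Suc q) (r1(rB (k + q) := 0), m1)"
        using I'(2) by (intro fin) (auto simp: candidate_entry_def same_def)
      then show ?thesis unfolding parp_def None by (auto intro!: wp_Basic)
    next
      case (Some pj)
      then obtain p js where c: "ws ! q = Some (p, js)" by (cases pj) auto
      have pj: "p < k" "js \<in> set (words d D)" using ws_okD[OF ws q c] by auto
      have xq: "x ! q < t" using x q by (simp add: valid_def)
      have "WP (loadex k (rA q) p (rB (k + q))) (WP (walkp (rB (k + q)) js) (?I (Suc q))) (r1, m1)"
      proof (rule wp_load_row[OF I'(2) _ xq])
        show "r1 (rA q) = Suc (x ! q) * Suc k" using sameD[OF I'(1), of "rA q"] A[OF q] by auto
        fix r2 assume r2: "r2 (rB (k + q)) = row (x ! q) ! p" "same {0, 1, rB (k + q)} r1 r2"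
        have e: "row (x ! q) ! p = fst (T ! (x ! q)) ! p" using T_nth[OF xq] pj(1) by (simp add: row_def nth_append)
        show "WP (walkp (rB (k + q)) js) (?I (Suc q)) (r2, m1)"
        proof (rule wp_walkp[where L = L0 and r = r2])
          have "2 \<notin> range rB" by (auto simp: image_iff)
          then have "r1 2 = r 2" using sameD[OF I'(1), of 2] by simp
          then show "L0 < r2 2" using sameD[OF r2(2), of 2] r by simp
          fix r3 m3 assume r3: "r3 (rB (k + q)) = walk N (r2 (rB (k + q))) js" "same {0, 1, rB (k + q)} r2 r3" "low L0 m1 m3"
          show "?I (Suc q) (r3, m3)"
          proof (rule fin)
            show "r3 (rB (k + q)) = candidate_entry ws x q" using r3(1) r2(1) c e by (simp add: candidate_entry_def)
            show "same {0, 1, rB (k + q)} r1 r3" by (rule same_trans[OF r2(2) r3(2)]) auto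
            show "low L0 m0 m3" by (rule low_trans[OF I'(2) r3(3)])
          qed
        qed auto
      qed (use pj in auto)
      then show ?thesis unfolding parp_def c by (simp add: wp_Seq)
    qed
    then show "WP (map ?f [0..<l] ! q) (?I (Suc q)) s'" using q s' by simp
  next
    fix r' m' assume I: "?I (length (map ?f [0..<l])) (r', m')"
    show "Q (r'(0 := 0), m')" by (rule Q) (use I in \<open>auto simp: same_def candidate_def\<close>)
  qed (use m in simp)
qed

definition good :: "state \<Rightarrow> bool" where
  "good s' \<longleftrightarrow> fst s' 2 = Suc L0 \<and> fst s' 3 = t * Suc k \<and> low L0 m0 (snd s')"

text \<open>The value \<open>Suc t\<close> exceeds every error count; it survives only for an empty training sequence.\<close>

definition best :: "(nat \<Rightarrow> nat) \<Rightarrow> bool" where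
  "best r \<longleftrightarrow> r 6 < length \<Phi> \<and> (\<forall>q < l. r (rV q) \<in> univ B) \<and>
     (r 5 = Suc t \<or> r 5 = error_count (snd (\<Phi> ! r 6)) (map (\<lambda>q. r (rV q)) [0..<l]))"

lemma best_cong: "best r \<Longrightarrow> r' 5 = r 5 \<Longrightarrow> r' 6 = r 6 \<Longrightarrow> (\<And>q. r' (rV q) = r (rV q)) \<Longrightarrow> best r'"
  by (simp add: best_def)

text \<open>The record changes only on strict improvement, so afterwards it is at most both the old
  minimum and the current error. Parameters are copied because later candidates overwrite
  \<open>rB\<close>.\<close>

lemma wp_updp:
  assumes b: "best r" and i: "i < length \<Phi>" and v: "length v = l" "set v \<subseteq> univ B"
    "\<And>q. q < l \<Longrightarrow> r (rB (k + q)) = v ! q" and e: "r 4 = error_count (snd (\<Phi> ! i)) v"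
    and Q: "\<And>r'. best r' \<Longrightarrow> r' 5 \<le> r 5 \<Longrightarrow> r' 5 \<le> r 4 \<Longrightarrow> same ({0, 5, 6} \<union> range rV) r r' \<Longrightarrow> Q (r', m)"
  shows "WP (updp k l i) Q (r, m)"
proof -
  let ?r = "r(0 := r 5 - r 4)" and ?r2 = "r(0 := 0, 5 := r 4, 6 := i)"
  have f: "fold (effect R N) [Sub 0 5 4] (r, m) = (?r, m)" by simp
  have g: "fold (effect R N) [Const 0 0, Add 5 4 0, Const 6 i] (?r, m) = (?r2, m)" by simp
  show ?thesis
    unfolding updp_def
  proof (rule wp_chain, unfold f, rule wp_If)
    assume "fst (?r, m) 0 \<noteq> 0"
    then have le: "r 4 < r 5" by simp
    let ?f = "\<lambda>q. copyp (rV q) (rB (k + q))"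
    let ?I = "\<lambda>j (r', m'). m' = m \<and> same ({0} \<union> range rV) ?r2 r' \<and> (\<forall>q < j. r' (rV q) = v ! q)"
    have "WP (seqs (map ?f [0..<l])) Q (?r2, m)"
    proof (rule wp_seqs[where I = ?I])
      fix q s' assume "q < length (map ?f [0..<l])" and I: "?I q s'"
      then have q: "q < l" by simp
      obtain r1 where s': "s' = (r1, m)" and r1: "same ({0} \<union> range rV) ?r2 r1"
        "\<And>q'. q' < q \<Longrightarrow> r1 (rV q') = v ! q'" using I by (cases s') auto
      have "r1 (rB (k + q)) = v ! q" using sameD[OF r1(1), of "rB (k + q)"] v(3)[OF q] by auto
      then have "WP (?f q) (?I (Suc q)) (r1, m)"
        using r1 by (intro wp_copyp) (auto simp: same_def less_Suc_eq)
      then show "WP (map ?f [0..<l] ! q) (?I (Suc q)) s'" using q s' by simp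
    next
      fix r' m' assume I: "?I (length (map ?f [0..<l])) (r', m')"
      let ?r3 = "r'(0 := 0)"
      have 3: "?r3 5 = r 4" "?r3 6 = i" "m' = m" "\<And>q. q < l \<Longrightarrow> ?r3 (rV q) = v ! q"
        using I by (auto simp: same_def image_iff)
      then have "map (\<lambda>q. ?r3 (rV q)) [0..<l] = v" using v(1) by (intro nth_equalityI) auto
      then have "best ?r3" unfolding best_def using 3 e i v(1,2) nth_mem[of _ v] by auto
      moreover have "same ({0, 5, 6} \<union> range rV) r ?r3" using I by (auto simp: same_def)
      ultimately show "Q (?r3, m')" using Q[of ?r3] 3 le by simp
    qed simp
    then show "WP (chain [Const 0 0, Add 5 4 0, Const 6 i] (seqs (map ?f [0..<l]))) Q (?r, m)"
      by (intro wp_chain) (simp only: g)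
  next
    assume "fst (?r, m) 0 = 0"
    then have "r 5 \<le> r 4" by simp
    moreover have "best (r(0 := 0))" using b by (rule best_cong) auto
    ultimately show "WP (Basic (Const 0 0)) Q (?r, m)"
      using Q[of "r(0 := 0)"] by (intro wp_Basic) (simp add: same_def)
  qed
qed

lemma wp_candp:
  assumes gd: "good (r, m)" and b: "best r" and i: "i < length \<Phi>" and ws: "ws_ok ws" and x: "valid x"
    and A: "\<And>q. q < l \<Longrightarrow> r (rA q) = Suc (x ! q) * Suc k"
    and Q: "\<And>r' m'. good (r', m') \<Longrightarrow> best r' \<Longrightarrow> r' 5 \<le> r 5 \<Longrightarrow> r' 5 \<le> error_count (snd (\<Phi> ! i)) (candidate ws x) \<Longrightarrow>
      (\<And>q. r' (rA q) = r (rA q)) \<Longrightarrow> Q (r', m')"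
  shows "WP (candp \<sigma> d s k l i (snd (\<Phi> ! i)) ws) Q (r, m)"
  unfolding candp_def
proof (rule wp_Seq, rule wp_params[where r = r and m = m, OF _ _ ws x A])
  show "low L0 m0 m" "r 2 = Suc L0" using gd by (auto simp: good_def)
  fix r1 m1 assume 1: "\<And>q. q < l \<Longrightarrow> r1 (rB (k + q)) = candidate ws x ! q" "same ({0, 1} \<union> range rB) r r1" "low L0 m0 m1"
  note pvl = candidate_univ[OF ws x]
  have nb: "c \<notin> range rB" if "c < 10" for c using that by (auto simp: image_iff)
  have n1: "r1 c = r c" if "1 < c" "c < 10" for c using sameD[OF 1(2), of c] nb[OF that(2)] that by auto
  have nv: "r1 (rV q) = r (rV q)" "r1 (rA q) = r (rA q)" for q
    using sameD[OF 1(2), of "rV q"] sameD[OF 1(2), of "rA q"] by auto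
  show "WP (Seq (errp \<sigma> d s k l (snd (\<Phi> ! i))) (updp k l i)) Q (r1, m1)"
  proof (rule wp_Seq, rule wp_errp[where r = r1 and m = m1, OF 1(3) _ _ pvl(1) 1(1)])
    show "r1 2 = Suc L0" "r1 3 = t * Suc k" using n1[of 2] n1[of 3] gd by (auto simp: good_def)
    fix r2 m2 assume 2: "r2 4 = error_count (snd (\<Phi> ! i)) (candidate ws x)" "same U r1 r2" "low L0 m0 m2"
    have n2: "r2 c = r1 c" if "c \<in> {2, 3, 5, 6}" for c using sameD[OF 2(2), of c] that by auto
    have nv2: "r2 (rV q) = r1 (rV q)" "r2 (rA q) = r1 (rA q)" for q
      using sameD[OF 2(2), of "rV q"] sameD[OF 2(2), of "rA q"] by auto
    show "WP (updp k l i) Q (r2, m2)"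
    proof (rule wp_updp[where r = r2 and m = m2, OF _ i pvl])
      show "best r2" using b by (rule best_cong) (simp_all add: n2 n1 nv nv2)
      show "r2 (rB (k + q)) = candidate ws x ! q" if "q < l" for q
        using sameD[OF 2(2), of "rB (k + q)"] 1(1)[OF that] by (auto simp: image_iff)
      show "r2 4 = error_count (snd (\<Phi> ! i)) (candidate ws x)" by (rule 2(1))
      fix r3 assume 3: "best r3" "r3 5 \<le> r2 5" "r3 5 \<le> r2 4" "same ({0, 5, 6} \<union> range rV) r2 r3"
      have "r3 2 = r2 2" "r3 3 = r2 3" using sameD[OF 3(4), of 2] sameD[OF 3(4), of 3] by auto
      then have "good (r3, m2)" using gd n1[of 2] n1[of 3] n2[of 2] n2[of 3] 2(3) by (simp add: good_def)
      moreover have "r3 (rA q) = r (rA q)" for q using sameD[OF 3(4), of "rA q"] nv nv2 by auto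
      ultimately show "Q (r3, m2)" using Q 3 2(1) n1[of 5] n2[of 5] by simp
    qed
  qed
qed

text \<open>\<open>body\<close> is specified for every postcondition, so that it fits into any
  context. Induction is on the number of loops still to be opened: the registers below
  \<open>qq\<close> fix a prefix of the choice \<open>x\<close>, and the recorded error ends up at
  most \<open>F x\<close> for all \<open>x\<close> with this prefix.\<close>

lemma wp_nest:
  assumes body: "\<And>r m x Q. good (r, m) \<Longrightarrow> best r \<Longrightarrow> valid x \<Longrightarrow> (\<And>q. q < l \<Longrightarrow> r (rA q) = Suc (x ! q) * Suc k) \<Longrightarrow>
      (\<And>r' m'. good (r', m') \<Longrightarrow> best r' \<Longrightarrow> r' 5 \<le> r 5 \<Longrightarrow> r' 5 \<le> F x \<Longrightarrow>
        (\<And>q. r' (rA q) = r (rA q)) \<Longrightarrow> Q (r', m')) \<Longrightarrow> WP body Q (r, m)"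
  shows "qq \<le> l \<Longrightarrow> good (r, m) \<Longrightarrow> best r \<Longrightarrow> (\<forall>q < qq. \<exists>y < t. r (rA q) = Suc y * Suc k) \<Longrightarrow>
    WP (nest k (map rA [qq..<l]) body) (\<lambda>(r', m'). good (r', m') \<and> best r' \<and> r' 5 \<le> r 5 \<and>
      (\<forall>q < qq. r' (rA q) = r (rA q)) \<and>
      (\<forall>x. valid x \<longrightarrow> (\<forall>q < qq. r (rA q) = Suc (x ! q) * Suc k) \<longrightarrow> r' 5 \<le> F x)) (r, m)"
proof (induction "l - qq" arbitrary: qq r m)
  case 0
  then have qq: "qq = l" by simp
  from 0 obtain y where y: "\<And>q. q < l \<Longrightarrow> y q < t \<and> r (rA q) = Suc (y q) * Suc k"
    unfolding qq by metis
  let ?x = "map y [0..<l]"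
  have x: "valid ?x" using y by (simp add: valid_def)
  \<comment> \<open>With all loops opened the registers determine \<open>x\<close>, since
    \<open>Suc k\<close> can be cancelled.\<close>
  have uniq: "x' = ?x" if "valid x'" "\<forall>q < l. r (rA q) = Suc (x' ! q) * Suc k" for x'
  proof (rule nth_equalityI)
    fix q assume "q < length x'"
    then have q: "q < l" using that(1) by (simp add: valid_def)
    then have "Suc (x' ! q) * Suc k = Suc (y q) * Suc k" using that(2) y by metis
    then have "x' ! q = y q" by (metis Suc_inject mult_cancel2 nat.simps(3))
    then show "x' ! q = ?x ! q" using q by simp
  qed (use that(1) in \<open>simp add: valid_def\<close>)
  have nil: "map rA [qq..<l] = []" using qq by simp
  show ?case
    unfolding nil nest.simps
  proof (rule body[OF 0(3,4) x])
    show "\<And>q. q < l \<Longrightarrow> r (rA q) = Suc (?x ! q) * Suc k" using y by simp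
    fix r' m' assume a: "good (r', m')" "best r'" "r' 5 \<le> r 5" "r' 5 \<le> F ?x" "\<And>q. r' (rA q) = r (rA q)"
    then show "case (r', m') of (r', m') \<Rightarrow> good (r', m') \<and> best r' \<and> r' 5 \<le> r 5 \<and>
      (\<forall>q < qq. r' (rA q) = r (rA q)) \<and>
      (\<forall>x. valid x \<longrightarrow> (\<forall>q < qq. r (rA q) = Suc (x ! q) * Suc k) \<longrightarrow> r' 5 \<le> F x)"
      unfolding qq using uniq by auto
  qed
next
  case (Suc n)
  then have qq: "qq < l" and n: "n = l - Suc qq" by auto
  let ?inner = "nest k (map rA [Suc qq..<l]) body"
  let ?body = "Seq ?inner (chain [Const 0 (Suc k)] (Basic (Sub (rA qq) (rA qq) 0)))"
  \<comment> \<open>With \<open>j\<close> iterations left, every choice whose entry at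
    \<open>qq\<close> is at least \<open>j\<close> has been tried.\<close>
  let ?I = "\<lambda>j (r', m'). good (r', m') \<and> best r' \<and> r' 5 \<le> r 5 \<and> (\<forall>q < qq. r' (rA q) = r (rA q)) \<and>
    r' (rA qq) = j * Suc k \<and>
    (\<forall>x. valid x \<longrightarrow> (\<forall>q < qq. r (rA q) = Suc (x ! q) * Suc k) \<longrightarrow> j \<le> x ! qq \<longrightarrow> r' 5 \<le> F x)"
  have e: "map rA [qq..<l] = rA qq # map rA [Suc qq..<l]" using qq by (simp add: upt_conv_Cons)
  let ?r = "r(0 := 0, rA qq := r 3)"
  have r3: "r 3 = t * Suc k" using Suc.prems(2) by (simp add: good_def)
  have "WP (WhileNZ (rA qq) ?body) (?I 0) (?r, m)"
  proof (rule wp_While[where n = t and I = ?I])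
    fix j s' assume j: "j < t" and I: "?I (Suc j) s'"
    obtain r1 m1 where s': "s' = (r1, m1)" by (cases s')
    have I': "good (r1, m1)" "best r1" "r1 5 \<le> r 5" "\<And>q. q < qq \<Longrightarrow> r1 (rA q) = r (rA q)"
      "r1 (rA qq) = Suc j * Suc k"
      "\<And>x. valid x \<Longrightarrow> (\<forall>q < qq. r (rA q) = Suc (x ! q) * Suc k) \<Longrightarrow> Suc j \<le> x ! qq \<Longrightarrow> r1 5 \<le> F x"
      using I s' by auto
    have pre: "\<forall>q < Suc qq. \<exists>y < t. r1 (rA q) = Suc y * Suc k"
      using Suc.prems(4) I'(4,5) j by (metis less_Suc_eq)
    note inner = Suc.hyps(1)[OF n Suc_leI[OF qq] I'(1,2) pre]
    have "WP ?inner (WP (chain [Const 0 (Suc k)] (Basic (Sub (rA qq) (rA qq) 0))) (?I j)) (r1, m1)"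
      using inner
    proof (rule wp_mono)
      fix s2 assume 2: "case s2 of (r', m') \<Rightarrow> good (r', m') \<and> best r' \<and> r' 5 \<le> r1 5 \<and>
        (\<forall>q < Suc qq. r' (rA q) = r1 (rA q)) \<and>
        (\<forall>x. valid x \<longrightarrow> (\<forall>q < Suc qq. r1 (rA q) = Suc (x ! q) * Suc k) \<longrightarrow> r' 5 \<le> F x)"
      obtain r2 m2 where s2: "s2 = (r2, m2)" by (cases s2)
      have 2: "good (r2, m2)" "best r2" "r2 5 \<le> r1 5" "\<And>q. q < Suc qq \<Longrightarrow> r2 (rA q) = r1 (rA q)"
        "\<And>x. valid x \<Longrightarrow> (\<forall>q < Suc qq. r1 (rA q) = Suc (x ! q) * Suc k) \<Longrightarrow> r2 5 \<le> F x"
        using 2 s2 by auto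
      let ?r3 = "r2(0 := Suc k, rA qq := r2 (rA qq) - Suc k)"
      have "?I j (?r3, m2)"
        unfolding prod.case
      proof (intro conjI allI impI)
        show "good (?r3, m2)" using 2(1) by (simp add: good_def)
        show "best ?r3" using 2(2) by (rule best_cong) auto
        show "?r3 5 \<le> r 5" using 2(3) I'(3) by simp
        show "?r3 (rA q) = r (rA q)" if "q < qq" for q using 2(4)[of q] I'(4)[OF that] that by simp
        show "?r3 (rA qq) = j * Suc k" using 2(4)[of qq] I'(5) by simp
        fix x assume x: "valid x" "\<forall>q < qq. r (rA q) = Suc (x ! q) * Suc k" "j \<le> x ! qq"
        have "r2 5 \<le> F x"
        proof (cases "x ! qq = j")
          case True
          then have "\<forall>q < Suc qq. r1 (rA q) = Suc (x ! q) * Suc k" using x(2) I'(4,5) by (auto simp: less_Suc_eq)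
          then show ?thesis using 2(5) x(1) by blast
        next
          case False
          then have "r1 5 \<le> F x" using I'(6) x by simp
          then show ?thesis using 2(3) by simp
        qed
        then show "?r3 5 \<le> F x" by simp
      qed
      moreover have g: "effect R N (Sub (rA qq) (rA qq) 0) (r2(0 := Suc k), m2) = (?r3, m2)" by simp
      moreover have "fold (effect R N) [Const 0 (Suc k)] (r2, m2) = (r2(0 := Suc k), m2)" by simp
      ultimately show "WP (chain [Const 0 (Suc k)] (Basic (Sub (rA qq) (rA qq) 0))) (?I j) s2"
        unfolding s2 using g by (intro wp_chain) (simp only:, intro wp_Basic, simp only:)
    qed
    then show "fst s' (rA qq) \<noteq> 0 \<and> WP ?body (?I j) s'" using s' I'(5) by (simp add: wp_Seq)
  next
    have "\<not> (valid x \<and> t \<le> x ! qq)" for x using qq by (auto simp: valid_def)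
    moreover have "good (?r, m)" using Suc.prems(2) by (simp add: good_def)
    moreover have "best ?r" using Suc.prems(3) by (rule best_cong) auto
    ultimately show "?I t (?r, m)" using r3 by auto
  qed auto
  then have "WP (WhileNZ (rA qq) ?body) (\<lambda>(r', m'). good (r', m') \<and> best r' \<and> r' 5 \<le> r 5 \<and>
      (\<forall>q < qq. r' (rA q) = r (rA q)) \<and>
      (\<forall>x. valid x \<longrightarrow> (\<forall>q < qq. r (rA q) = Suc (x ! q) * Suc k) \<longrightarrow> r' 5 \<le> F x)) (?r, m)"
    by (rule wp_mono) auto
  then show ?case
    unfolding e nest.simps by (intro wp_Seq wp_copyp) auto
qed

text \<open>For an empty training sequence the loops may never reach a candidate; the initial
  registers already describe a legal answer, formula 0 with all parameters 0. Hence optimality is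
  claimed only for \<open>0 < t\<close>.\<close>

lemma wp_learnp:
  "\<exists>i v. i < length \<Phi> \<and> length v = l \<and> set v \<subseteq> univ B \<and>
    (0 < t \<longrightarrow> (\<forall>i' ws x. i' < length \<Phi> \<longrightarrow> ws_ok ws \<longrightarrow> valid x \<longrightarrow>
      error_count (snd (\<Phi> ! i)) v \<le> error_count (snd (\<Phi> ! i')) (candidate ws x))) \<and>
    WP (learnp \<sigma> d s D k l \<Phi>) (\<lambda>(r, m). get_list 0 m = enc_hyp v (fst (\<Phi> ! i))) (\<lambda>_. 0, m0)"
proof -
  let ?c = "List.product [0..<length \<Phi>] (List.n_lists l (cands k d D))"
  let ?f = "\<lambda>(i, ws). nest k (map rA [0..<l]) (candp \<sigma> d s k l i (snd (\<Phi> ! i)) ws)"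
  let ?G = "\<lambda>i v. i < length \<Phi> \<and> length v = l \<and> set v \<subseteq> univ B \<and>
    (0 < t \<longrightarrow> (\<forall>i' ws x. i' < length \<Phi> \<longrightarrow> ws_ok ws \<longrightarrow> valid x \<longrightarrow>
      error_count (snd (\<Phi> ! i)) v \<le> error_count (snd (\<Phi> ! i')) (candidate ws x)))"
  \<comment> \<open>A single pair \<open>iv\<close> combines both witnesses, so that
    \<open>wp_ex\<close> applies.\<close>
  let ?Q = "\<lambda>s'. \<exists>iv. ?G (fst iv) (snd iv) \<and> get_list 0 (snd s') = enc_hyp (snd iv) (fst (\<Phi> ! fst iv))"
  let ?disp = "dispp 6 (map (\<lambda>i. (i, writeout (outputs l \<Phi> i))) [0..<length \<Phi>])"
  let ?I = "\<lambda>j (r, m). good (r, m) \<and> best r \<and>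
    (\<forall>j' < j. \<forall>x. valid x \<longrightarrow> r 5 \<le> error_count (snd (\<Phi> ! fst (?c ! j'))) (candidate (snd (?c ! j')) x))"
  let ?init = "[Const 1 0, Load 0 1, Const 1 1, Add 2 0 1, Sub 3 0 1, Load 5 1, Add 5 5 1]"
  let ?r = "(\<lambda>_. 0)(0 := L0, 1 := 1, 2 := Suc L0, 3 := t * Suc k, 5 := Suc t)"
  have init: "fold (effect R N) ?init (\<lambda>_. 0, m0) = (?r, m0)"
    using m0_0 m0_1 L0_eq by (auto simp: fun_eq_iff)
  have "WP (seqs (map ?f ?c)) (WP ?disp ?Q) (?r, m0)"
  proof (rule wp_seqs[where I = ?I])
    fix j s' assume j: "j < length (map ?f ?c)" and I: "?I j s'"
    obtain r m where s': "s' = (r, m)" by (cases s')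
    obtain i ws where c: "?c ! j = (i, ws)" by (cases "?c ! j")
    have "?c ! j \<in> set ?c" using j by (intro nth_mem) simp
    then have i: "i < length \<Phi>" and ws: "ws_ok ws" unfolding c by (auto simp: ws_ok_def set_n_lists)
    have I': "good (r, m)" "best r"
      "\<And>j' x. j' < j \<Longrightarrow> valid x \<Longrightarrow> r 5 \<le> error_count (snd (\<Phi> ! fst (?c ! j'))) (candidate (snd (?c ! j')) x)"
      using I s' by auto
    have "WP (nest k (map rA [0..<l]) (candp \<sigma> d s k l i (snd (\<Phi> ! i)) ws)) (?I (Suc j)) (r, m)"
    proof (rule wp_mono[OF wp_nest[where qq = 0 and F = "\<lambda>x. error_count (snd (\<Phi> ! i)) (candidate ws x)"]])
      fix r m x Q
      assume "good (r, m)" "best r" "valid x" "\<And>q. q < l \<Longrightarrow> r (rA q) = Suc (x ! q) * Suc k"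
        "\<And>r' m'. good (r', m') \<Longrightarrow> best r' \<Longrightarrow> r' 5 \<le> r 5 \<Longrightarrow> r' 5 \<le> error_count (snd (\<Phi> ! i)) (candidate ws x) \<Longrightarrow>
        (\<And>q. r' (rA q) = r (rA q)) \<Longrightarrow> Q (r', m')"
      then show "WP (candp \<sigma> d s k l i (snd (\<Phi> ! i)) ws) Q (r, m)"
        using i ws by (intro wp_candp[where x = x]) auto
    next
      fix s2 assume "case s2 of (r', m') \<Rightarrow> good (r', m') \<and> best r' \<and> r' 5 \<le> r 5 \<and>
        (\<forall>q < 0. r' (rA q) = r (rA q)) \<and>
        (\<forall>x. valid x \<longrightarrow> (\<forall>q < 0. r (rA q) = Suc (x ! q) * Suc k) \<longrightarrow> r' 5 \<le> error_count (snd (\<Phi> ! i)) (candidate ws x))"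
      then show "?I (Suc j) s2" using I'(3) c by (cases s2) (auto simp: less_Suc_eq intro: le_trans)
    qed (use I' in auto)
    then show "WP (map ?f ?c ! j) (?I (Suc j)) s'" using j s' c by simp
  next
    have "best ?r" using \<Phi> zero by (simp add: best_def)
    then show "?I 0 (?r, m0)" by (simp add: good_def)
  next
    fix r m assume I: "?I (length (map ?f ?c)) (r, m)"
    have I': "good (r, m) \<and> best r \<and> (\<forall>j' < length ?c. \<forall>x. valid x \<longrightarrow>
        r 5 \<le> error_count (snd (\<Phi> ! fst (?c ! j'))) (candidate (snd (?c ! j')) x))"
      using I unfolding prod.case length_map .
    then have b: "best r" by (elim conjE)
    have opt: "r 5 \<le> error_count (snd (\<Phi> ! i')) (candidate ws x)" if "i' < length \<Phi>" "ws_ok ws" "valid x" for i' ws x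
    proof -
      have "(i', ws) \<in> set ?c" using that by (auto simp: ws_ok_def set_n_lists)
      then obtain j where j: "j < length ?c" "?c ! j = (i', ws)" unfolding in_set_conv_nth by blast
      have "\<forall>j' < length ?c. \<forall>x. valid x \<longrightarrow> r 5 \<le> error_count (snd (\<Phi> ! fst (?c ! j'))) (candidate (snd (?c ! j')) x)"
        using I' by (elim conjE)
      from this[rule_format, OF j(1) that(3)] show ?thesis unfolding j(2) by simp
    qed
    let ?v = "map (\<lambda>q. r (rV q)) [0..<l]"
    have i: "r 6 < length \<Phi>" using b by (simp add: best_def)
    have v: "length ?v = l" "set ?v \<subseteq> univ B" using b by (auto simp: best_def)
    have G: "?G (r 6) ?v"
    proof (intro conjI i v impI allI)
      fix i' ws x assume "0 < t" and a: "i' < length \<Phi>" "ws_ok ws" "valid x"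
      have le: "r 5 \<le> error_count (snd (\<Phi> ! i')) (candidate ws x)" using opt[OF a] .
      \<comment> \<open>The recorded minimum is thus at most \<open>t\<close>. So it is not the
        initial value \<open>Suc t\<close>, but the error of the stored hypothesis.\<close>
      have "error_count (snd (\<Phi> ! i')) (candidate ws x) \<le> t"
        unfolding error_count_def by (rule order_trans[OF card_mono[of "{..<t}"]]) auto
      then have "r 5 = error_count (snd (\<Phi> ! r 6)) ?v" using le b by (simp add: best_def)
      then show "error_count (snd (\<Phi> ! r 6)) ?v \<le> error_count (snd (\<Phi> ! i')) (candidate ws x)" using le by simp
    qed
    show "WP ?disp ?Q (r(0 := 0), m)"
    proof (rule wp_dispp[where c = "writeout (outputs l \<Phi> (r 6))"])
      show "((r(0 := 0)) 6, writeout (outputs l \<Phi> (r 6))) \<in> set (map (\<lambda>i. (i, writeout (outputs l \<Phi> i))) [0..<length \<Phi>])"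
        using i by auto
      fix r' assume r': "same {0, 1} (r(0 := 0)) r'"
      show "WP (writeout (outputs l \<Phi> (r 6))) ?Q (r', m)"
      proof (rule wp_writeout)
        show "set (outputs l \<Phi> (r 6)) \<inter> Inl ` {0, 1} = {}" by (auto simp: outputs_def)
        fix r2 m2 assume g: "get_list 0 m2 = map (sval r') (outputs l \<Phi> (r 6))"
        have "r' (rV q) = r (rV q)" for q using sameD[OF r', of "rV q"] by simp
        then have "get_list 0 m2 = enc_hyp ?v (fst (\<Phi> ! r 6))"
          unfolding g outputs_def enc_hyp_def by (simp add: comp_def)
        then show "?Q (r2, m2)" using G by (intro exI[of _ "(r 6, ?v)"]) simp
      qed
    qed (auto simp: comp_def)
  qed
  then have "WP (learnp \<sigma> d s D k l \<Phi>) ?Q (\<lambda>_. 0, m0)"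
    unfolding learnp_def by (intro wp_chain) (simp only: init, rule wp_Seq)
  from wp_ex[OF this] obtain iv where
    w: "WP (learnp \<sigma> d s D k l \<Phi>) (\<lambda>s'. ?G (fst iv) (snd iv) \<and> get_list 0 (snd s') = enc_hyp (snd iv) (fst (\<Phi> ! fst iv))) (\<lambda>_. 0, m0)"
    by blast
  then have G: "?G (fst iv) (snd iv)" unfolding wp_def by blast
  moreover have "WP (learnp \<sigma> d s D k l \<Phi>) (\<lambda>(r, m). get_list 0 m = enc_hyp (snd iv) (fst (\<Phi> ! fst iv))) (\<lambda>_. 0, m0)"
    using w by (rule wp_mono) auto
  ultimately show ?thesis by blast
qed

end

section \<open>Evaluating a returned hypothesis\<close>

definition evaluator :: "signature \<Rightarrow> nat \<Rightarrow> nat \<Rightarrow> nat \<Rightarrow> (fo \<times> (bool list \<Rightarrow> bool)) list \<Rightarrow> prog" where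
  "evaluator \<sigma> d s m \<Phi> = chain [Const 1 0, Load 9 1, Const 1 1, Add 2 9 1]
     (Seq (seqs (map (\<lambda>p. chain [Const 1 (Suc p)] (Basic (Load (rB p) 1))) [0..<m]))
       (Seq (dispp 9 (map (\<lambda>(\<phi>, g). (m + length (enc_fo \<phi>), evalp \<sigma> d s m g)) \<Phi>)) (writeout [Inl 7])))"

text \<open>The program has no loop, so the budget holds for any \<open>t\<close>. The input length
  identifies the formula because the lengths in \<open>\<Phi>\<close> are distinct.\<close>

lemma wp_evaluator:
  assumes as: "length as = m" and \<Phi>: "(\<phi>, g) \<in> set \<Phi>" "distinct (map (\<lambda>(\<phi>, g). length (enc_fo \<phi>)) \<Phi>)"
  shows "wp R N t (evaluator \<sigma> d s m \<Phi>) (\<lambda>(r, m'). get_list 0 m' = [of_bool (g (pattern \<sigma> d s R N as))])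
    (\<lambda>_. 0, put_list 0 (as @ enc_fo \<phi>) (\<lambda>_. 0))"
proof -
  let ?m0 = "put_list 0 (as @ enc_fo \<phi>) (\<lambda>_. 0)" and ?L = "m + length (enc_fo \<phi>)"
  let ?Q = "\<lambda>(r, m'). get_list 0 m' = [of_bool (g (pattern \<sigma> d s R N as))]"
  let ?f = "\<lambda>p. chain [Const 1 (Suc p)] (Basic (Load (rB p) 1))"
  let ?r = "(\<lambda>_. 0)(9 := ?L, 1 := 1, 2 := Suc ?L)"
  let ?xs = "map (\<lambda>(\<phi>, g). (m + length (enc_fo \<phi>), evalp \<sigma> d s m g)) \<Phi>"
  let ?I = "\<lambda>j (r, m'). m' = ?m0 \<and> r 9 = ?L \<and> r 2 = Suc ?L \<and> (\<forall>p < j. r (rB p) = as ! p)"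
  have m00: "?m0 0 = ?L" using as by (simp add: put_list_def)
  have m0p: "?m0 (Suc p) = as ! p" if "p < m" for p using that as by (simp add: put_list_def nth_append)
  have init: "fold (effect R N) [Const 1 0, Load 9 1, Const 1 1, Add 2 9 1] (\<lambda>_. 0, ?m0) = (?r, ?m0)"
    using m00 by (auto simp: fun_eq_iff)
  have "wp R N t (seqs (map ?f [0..<m])) (wp R N t (Seq (dispp 9 ?xs) (writeout [Inl 7])) ?Q) (?r, ?m0)"
  proof (rule wp_seqs[where I = ?I])
    fix p s' assume "p < length (map ?f [0..<m])" and I: "?I p s'"
    then have p: "p < m" by simp
    obtain r where s': "s' = (r, ?m0)" and r: "r 9 = ?L" "r 2 = Suc ?L" "\<And>p'. p' < p \<Longrightarrow> r (rB p') = as ! p'"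
      using I by (cases s') auto
    let ?r1 = "r(1 := Suc p)"
    have f: "fold (effect R N) [Const 1 (Suc p)] (r, ?m0) = (?r1, ?m0)" by simp
    have "wp R N t (Basic (Load (rB p) 1)) (?I (Suc p)) (?r1, ?m0)"
      by (rule wp_Basic) (use r m0p[OF p] in \<open>auto simp: less_Suc_eq\<close>)
    then have "wp R N t (?f p) (?I (Suc p)) (r, ?m0)" by (intro wp_chain) (simp only: f)
    then show "wp R N t (map ?f [0..<m] ! p) (?I (Suc p)) s'" using p s' by simp
  next
    fix r m' assume I: "?I (length (map ?f [0..<m])) (r, m')"
    then have m': "m' = ?m0" and r: "r 9 = ?L" "r 2 = Suc ?L" "\<And>p. p < m \<Longrightarrow> r (rB p) = as ! p" by auto
    show "wp R N t (Seq (dispp 9 ?xs) (writeout [Inl 7])) ?Q (r(0 := 0), m')"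
    proof (rule wp_Seq, rule wp_dispp[where c = "evalp \<sigma> d s m g"])
      show "((r(0 := 0)) 9, evalp \<sigma> d s m g) \<in> set ?xs" using \<Phi>(1) r(1) by force
      have "map fst ?xs = map ((+) m) (map (\<lambda>(\<phi>, g). length (enc_fo \<phi>)) \<Phi>)" by auto
      then show "distinct (map fst ?xs)" using \<Phi>(2) by (simp only: distinct_map[of "(+) m"]) simp
      fix r1 assume "same {0, 1} (r(0 := 0)) r1"
      note s1 = this
      have r1: "r1 2 = Suc ?L" using sameD[OF s1, of 2] r by simp
      have rb: "r1 (rB p) = as ! p" if "p < m" for p using sameD[OF s1, of "rB p"] r(3)[OF that] by simp
      show "wp R N t (evalp \<sigma> d s m g) (wp R N t (writeout [Inl 7]) ?Q) (r1, m')"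
      proof (rule wp_evalp[where L = ?L and r = r1, OF _ as rb])
        fix r2 m2 :: "nat \<Rightarrow> nat" assume r2: "r2 7 = of_bool (g (pattern \<sigma> d s R N as))"
        show "wp R N t (writeout [Inl 7]) ?Q (r2, m2)"
          by (rule wp_writeout) (use r2 in auto)
      qed (use r1 in auto)
    qed simp
  qed simp
  then show ?thesis unfolding evaluator_def by (intro wp_chain) (simp only: init, intro wp_Seq)
qed

section \<open>Optimality of the learned hypothesis\<close>

context learner
begin

lemma T_instance:
  assumes u: "u \<in> set (map fst T)"
  shows "length u = k \<and> set u \<subseteq> univ B"
proof -
  obtain c where "(u, c) \<in> set T" using u by auto
  then show ?thesis using T unfolding is_training_def by blast
qed

text \<open>A parameter near the instances lies in the \<open>D\<close>-ball of entry
  \<open>p\<close> of some example and is reached from there by a word; 0 is the default. Even a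
  default parameter is paired with an example, which needs \<open>0 < t\<close>.\<close>

lemma candidate_onto:
  assumes "0 < t" and v: "length v = l" "set v \<subseteq> insert 0 (nbhd B D (concat (map fst T)))"
  shows "\<exists>ws x. ws_ok ws \<and> valid x \<and> candidate ws x = v"
proof -
  have step: "\<exists>c x. c \<in> set (cands k d D) \<and> x < t \<and>
      v ! q = (case c of None \<Rightarrow> 0 | Some pj \<Rightarrow> walk N (fst (T ! x) ! fst pj) (snd pj))" if q: "q < l" for q
  proof (cases "v ! q = 0")
    case True
    then show ?thesis using \<open>0 < t\<close> by (intro exI[of _ None] exI[of _ 0]) (simp add: cands_def)
  next
    case False
    have "v ! q \<in> set v" using v(1) q by simp
    from subsetD[OF v(2) this] False have "v ! q \<in> nbhd B D (concat (map fst T))" by (simp only: insert_iff simp_thms)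
    then obtain a where a: "a \<in> set (concat (map fst T))" "v ! q \<in> nbhd B D [a]"
      unfolding nbhd_iff_single[of _ B D "concat (map fst T)"] by blast
    from a(1) obtain u where u: "u \<in> set (map fst T)" "a \<in> set u" by auto
    from u(1) obtain y where "y \<in> set T" "u = fst y" by auto
    then obtain x where x: "x < t" "a \<in> set (fst (T ! x))" using u(2) by (metis in_set_conv_nth)
    then obtain p where p: "p < k" "a = fst (T ! x) ! p" using T_nth[OF x(1)] by (auto simp: in_set_conv_nth)
    have "a \<in> univ B" using x T_nth[OF x(1)] by auto
    then obtain js where js: "js \<in> set (words d D)" "v ! q = walk N a js"
      using a(2) walk_image[OF adm, of a D] by blast
    have "(p, js) \<in> set (List.product [0..<k] (words d D))" using p(1) js(1) by simp
    then have "Some (p, js) \<in> set (cands k d D)" unfolding cands_def by simp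
    then show ?thesis using x(1) js(2) p(2) by (intro exI[of _ "Some (p, js)"] exI[of _ x]) simp
  qed
  have "\<forall>q \<in> {..<l}. \<exists>cx. fst cx \<in> set (cands k d D) \<and> snd cx < t \<and>
      v ! q = (case fst cx of None \<Rightarrow> 0 | Some pj \<Rightarrow> walk N (fst (T ! snd cx) ! fst pj) (snd pj))"
  proof
    fix q assume "q \<in> {..<l}"
    with step obtain c x where "c \<in> set (cands k d D)" "x < t"
      "v ! q = (case c of None \<Rightarrow> 0 | Some pj \<Rightarrow> walk N (fst (T ! x) ! fst pj) (snd pj))" by blast
    then show "\<exists>cx. fst cx \<in> set (cands k d D) \<and> snd cx < t \<and>
      v ! q = (case fst cx of None \<Rightarrow> 0 | Some pj \<Rightarrow> walk N (fst (T ! snd cx) ! fst pj) (snd pj))"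
      by (intro exI[of _ "(c, x)"]) (simp only: fst_conv snd_conv simp_thms)
  qed
  from bchoice[OF this] obtain f where f: "\<forall>q \<in> {..<l}. fst (f q) \<in> set (cands k d D) \<and> snd (f q) < t \<and>
      v ! q = (case fst (f q) of None \<Rightarrow> 0 | Some pj \<Rightarrow> walk N (fst (T ! snd (f q)) ! fst pj) (snd pj))" ..
  define c x where "c q = fst (f q)" and "x q = snd (f q)" for q
  have cx: "\<And>q. q < l \<Longrightarrow> c q \<in> set (cands k d D) \<and> x q < t \<and>
      v ! q = (case c q of None \<Rightarrow> 0 | Some pj \<Rightarrow> walk N (fst (T ! x q) ! fst pj) (snd pj))"
    using f unfolding c_def x_def by blast
  have "candidate (map c [0..<l]) (map x [0..<l]) = v"
    using cx v(1) by (intro nth_equalityI) (auto simp: candidate_def candidate_entry_def split: option.split)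
  moreover have "ws_ok (map c [0..<l])" "valid (map x [0..<l])"
    using cx by (auto simp: ws_ok_def valid_def)
  ultimately show ?thesis by blast
qed

lemma err_eq_error_count:
  assumes "\<And>i. i < t \<Longrightarrow> H (fst (T ! i)) \<longleftrightarrow> g (pattern \<sigma> d s R N (fst (T ! i) @ v))"
  shows "err T H = real (error_count g v) / real t"
proof -
  have "{i. i < t \<and> H (fst (T ! i)) \<noteq> snd (T ! i)} = {i. i < t \<and> misclassified g v i}"
    using assms by (auto simp: misclassified_def)
  then show ?thesis by (simp add: err_def error_count_def)
qed

text \<open>\<open>H\<close> is any competitor that cannot separate instances whose spheres together
  with \<open>vv\<close> are isomorphic. Moving \<open>vv\<close> near the instances keeps this
  property, so some stored formula with the new parameters agrees with \<open>H\<close> on all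
  examples, and the learner has tried it.\<close>

lemma optimal:
  assumes \<Phi>_eval: "\<And>\<phi> g. (\<phi>, g) \<in> set \<Phi> \<Longrightarrow> evals \<sigma> d s (k + l) K \<phi> g"
    and \<Phi>_all: "\<And>S. S \<subseteq> patterns \<sigma> d s (k + l) \<Longrightarrow> \<exists>\<phi>. (\<phi>, type_test \<sigma> d s (k + l) S) \<in> set \<Phi>"
    and D: "D = l * (2 * s + 1)"
    and i: "i < length \<Phi>" and v: "length v = l" "set v \<subseteq> univ B"
    and opt: "0 < t \<longrightarrow> (\<forall>i' ws x. i' < length \<Phi> \<longrightarrow> ws_ok ws \<longrightarrow> valid x \<longrightarrow>
      error_count (snd (\<Phi> ! i)) v \<le> error_count (snd (\<Phi> ! i')) (candidate ws x))"
    and vv: "length vv = l" "set vv \<subseteq> univ B"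
    and H: "\<And>u u'. u \<in> set (map fst T) \<Longrightarrow> u' \<in> set (map fst T) \<Longrightarrow> sim B s (u @ vv) (u' @ vv) \<Longrightarrow> H u = H u'"
  shows "err T (fo_hyp B (fst (\<Phi> ! i)) k l v) \<le> err T H"
proof (cases "t = 0")
  case True
  then show ?thesis by (simp add: err_def)
next
  case False
  let ?us = "map fst T"
  have B: "is_struct \<sigma> B" using adm by (simp add: admissible_def)
  note us = T_instance
  obtain v' where v': "length v' = l" "set v' \<subseteq> insert 0 (nbhd B D (concat ?us))"
    "\<And>u u'. u \<in> set ?us \<Longrightarrow> u' \<in> set ?us \<Longrightarrow> sim B s (u @ v') (u' @ v') \<Longrightarrow> sim B s (u @ vv) (u' @ vv)"
    using param_reduction[OF B vv(2) us zero, where \<rho> = s] unfolding vv(1) D by metis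
  have v'u: "set v' \<subseteq> univ B" using v'(2) zero nbhd_univ[of B D "concat ?us"] by auto
  let ?S = "{pattern \<sigma> d s R N (u @ v') | u. u \<in> set ?us \<and> H u}"
  have "?S \<subseteq> patterns \<sigma> d s (k + l)"
  proof
    fix \<pi> assume "\<pi> \<in> ?S"
    then obtain u where u: "\<pi> = pattern \<sigma> d s R N (u @ v')" "u \<in> set ?us" by blast
    have "length (u @ v') = k + l" "set (u @ v') \<subseteq> univ B" using us[OF u(2)] v'(1) v'u by simp_all
    from pattern_in_patterns[OF adm this] show "\<pi> \<in> patterns \<sigma> d s (k + l)" unfolding u(1) .
  qed
  then obtain \<phi> where "(\<phi>, type_test \<sigma> d s (k + l) ?S) \<in> set \<Phi>" using \<Phi>_all by blast
  then obtain i' where i': "i' < length \<Phi>" "\<Phi> ! i' = (\<phi>, type_test \<sigma> d s (k + l) ?S)"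
    by (auto simp: in_set_conv_nth)
  have "type_test \<sigma> d s (k + l) ?S (pattern \<sigma> d s R N (u @ v')) \<longleftrightarrow> H u" if "u \<in> set ?us" for u
    using us v'(1) v'u by (intro type_test_complete[OF adm _ _ that] H v'(3)) auto
  then have eH: "err T H = real (error_count (snd (\<Phi> ! i')) v') / real t"
    unfolding i'(2) snd_conv by (intro err_eq_error_count) auto
  obtain ws x where wx: "ws_ok ws" "valid x" "candidate ws x = v'"
    using candidate_onto[OF _ v'(1,2)] False by blast
  have le: "error_count (snd (\<Phi> ! i)) v \<le> error_count (snd (\<Phi> ! i')) v'" using opt False i'(1) wx by blast
  have "(fst (\<Phi> ! i), snd (\<Phi> ! i)) \<in> set \<Phi>" using i by simp
  from \<Phi>_eval[OF this] have "err T (fo_hyp B (fst (\<Phi> ! i)) k l v) = real (error_count (snd (\<Phi> ! i)) v) / real t"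
    using T_nth v adm by (intro err_eq_error_count) (simp add: evals_def fo_hyp_def)
  then show ?thesis unfolding eH using le by (simp add: divide_right_mono)
qed

end

section \<open>Assembling learner, evaluator and time bounds\<close>

theorem theorem9:
  fixes \<sigma> :: signature and P :: "'p numpreds" and d k l r w :: nat
  assumes "is_numpreds P"
  shows "\<exists>(L :: prog) (E :: prog) (e :: nat).
    \<forall>(n :: nat) (B :: nat struct) R N T.
      is_struct \<sigma> B \<and> univ B = {0..<n} \<and> n > 0 \<and> degree B \<le> d \<and>
      local_access B R N \<and> is_training B k T \<longrightarrow>
      (\<exists>\<phi>' v' time.
        runs R N L (enc_training T) time (enc_hyp v' \<phi>') \<and>
        (sphere_comb \<sigma> ((2 * w + 1) ^ r) {0..<k + l} \<phi>' \<and> length v' = l \<and> set v' \<subseteq> univ B) \<and>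
        (\<forall>(\<epsilon> :: real) (\<phi> :: 'p fm) xs ys ks v \<mu>.
          fm_wf \<sigma> P \<phi> \<and> br \<phi> \<le> r \<and> bw \<phi> \<le> w \<and>
          length xs = k \<and> length ys = l \<and> distinct (xs @ ys) \<and> fv \<phi> \<subseteq> set (xs @ ys) \<and>
          distinct ks \<and> nfv \<phi> \<subseteq> set ks \<and>
          length v = l \<and> set v \<subseteq> univ B \<and> length \<mu> = length ks \<and> set \<mu> \<subseteq> {0..n} \<and>
          err T (focn_hyp P B \<phi> xs ys ks v \<mu>) \<le> \<epsilon> \<longrightarrow>
          err T (fo_hyp B \<phi>' k l v') \<le> \<epsilon>) \<and>
        real time \<le> (log 2 (real n) + real (length T) + 2) ^ e \<and>
        (\<forall>u. length u = k \<and> set u \<subseteq> univ B \<longrightarrow>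
          (\<exists>time'. runs R N E (u @ enc_hyp v' \<phi>') time' [of_bool (fo_hyp B \<phi>' k l v' u)] \<and>
             real time' \<le> (log 2 (real n) + 2) ^ e)))"
proof -
  \<comment> \<open>The radius at which formulas of rank \<open>r\<close> and width \<open>w\<close>
    are local. \<open>D\<close> is the search distance for parameters: one ring of width
    \<open>2 * s + 1\<close> for each of the \<open>l\<close> parameters.\<close>
  define s where "s = rad w r"
  define D where "D = l * (2 * s + 1)"
  let ?K = "(2 * w + 1) ^ r"
  have "s < ?K" unfolding s_def by (rule rad_less)
  then obtain \<Phi> where fam: "\<Phi> \<noteq> []" "distinct (map (\<lambda>(\<phi>, g). length (enc_fo \<phi>)) \<Phi>)"
    and \<Phi>_eval: "\<And>\<phi> g. (\<phi>, g) \<in> set \<Phi> \<Longrightarrow> evals \<sigma> d s (k + l) ?K \<phi> g"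
    and \<Phi>_all: "\<And>S. S \<subseteq> patterns \<sigma> d s (k + l) \<Longrightarrow> \<exists>\<phi>. (\<phi>, type_test \<sigma> d s (k + l) S) \<in> set \<Phi>"
    by (rule formula_family[of s ?K \<sigma> d "k + l"]) blast
  define L where "L = learnp \<sigma> d s D k l \<Phi>"
  define E where "E = evaluator \<sigma> d s (k + l) \<Phi>"
  \<comment> \<open>Bounds the length of every stored encoding and the numbers in it; a constant
    because the family is finite.\<close>
  define e0 where "e0 = (\<Sum>(\<phi>, g) \<leftarrow> \<Phi>. length (enc_fo \<phi>) + sum_list (enc_fo \<phi>))"
  \<comment> \<open>Chosen so that \<open>n * (length T + 1) * CL\<close> bounds the input length,
    the input numbers, the degree and the program constants. \<open>CE\<close> does the same for the
    evaluator, whose input also contains a formula.\<close>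
  define CL where "CL = pconst L + d + k + 2"
  define CE where "CE = pconst E + d + k + l + e0 + 1"
  \<comment> \<open>The sum of the exponents that \<open>runs_of_wp\<close> asks for, so that one
    \<open>e\<close> serves both programs.\<close>
  define e where "e = (2 * psize L + 1 + (3 + 2 * d + pconst L) * psize L * (psize L + CL + 4)) +
    (2 * psize E + 1 + (3 + 2 * d + pconst E) * psize E * (psize E + CE + 4))"
  have e0: "length (enc_fo \<phi>) \<le> e0" "\<And>x. x \<in> set (enc_fo \<phi>) \<Longrightarrow> x \<le> e0" if "(\<phi>, g) \<in> set \<Phi>" for \<phi> g
  proof -
    have "length (enc_fo \<phi>) + sum_list (enc_fo \<phi>) \<in> set (map (\<lambda>(\<phi>, g). length (enc_fo \<phi>) + sum_list (enc_fo \<phi>)) \<Phi>)"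
      using that by force
    from member_le_sum_list[OF this] have le: "length (enc_fo \<phi>) + sum_list (enc_fo \<phi>) \<le> e0"
      unfolding e0_def by simp
    then show "length (enc_fo \<phi>) \<le> e0" by linarith
    show "x \<le> e0" if "x \<in> set (enc_fo \<phi>)" for x using member_le_sum_list[OF that] le by linarith
  qed
  show ?thesis
  proof (rule exI[of _ L], rule exI[of _ E], rule exI[of _ e], intro allI impI, elim conjE)
    fix n :: nat and B :: "nat struct" and R N and T :: "(nat list \<times> bool) list"
    assume B: "is_struct \<sigma> B" and uB: "univ B = {0..<n}" and n: "n > 0" and deg: "degree B \<le> d"
      and la: "local_access B R N" and T: "is_training B k T"
    have adm: "admissible \<sigma> d B R N" using B uB n deg la by (auto simp: admissible_def)
    have zero: "0 \<in> univ B" using uB n by simp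
    interpret learner \<sigma> d s D k l \<Phi> B R N T
      using adm T zero fam(1) by unfold_locales
    obtain i v' where i: "i < length \<Phi>" and v': "length v' = l" "set v' \<subseteq> univ B"
      and opt: "0 < length T \<longrightarrow> (\<forall>i' ws x. i' < length \<Phi> \<longrightarrow> ws_ok ws \<longrightarrow> valid x \<longrightarrow>
        error_count (snd (\<Phi> ! i)) v' \<le> error_count (snd (\<Phi> ! i')) (candidate ws x))"
      and wpL: "wp R N (length T) L (\<lambda>(r, m). get_list 0 m = enc_hyp v' (fst (\<Phi> ! i))) (\<lambda>_. 0, m0)"
      using wp_learnp unfolding L_def by blast
    let ?\<phi> = "fst (\<Phi> ! i)" and ?g = "snd (\<Phi> ! i)"
    have i\<Phi>: "(?\<phi>, ?g) \<in> set \<Phi>" using i by simp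
    note ev = \<Phi>_eval[OF i\<Phi>]
    have Nu: "x < n" if "x \<in> set (N a)" for a x
    proof -
      have "(a, x) \<in> gaifman B" using that admissible_N(1)[OF adm] by (simp add: nbrs_def)
      then show ?thesis using gaifman_univ(2)[OF B] uB by auto
    qed
    have "\<exists>time. runs R N L (enc_training T) time (enc_hyp v' ?\<phi>) \<and>
      real time \<le> (log 2 (real n) + real (length T) + 2) ^ e"
    proof (rule runs_of_wp[OF wpL[unfolded m0_def] _ _ order_refl refl])
      let ?X = "n * (length T + 1) * CL"
      have "1 * CL \<le> ?X" "n * (length T + 1) * 1 \<le> ?X"
        using n by (intro mult_le_mono; simp add: CL_def)+
      moreover have "1 * (length T + 1) * (k + 2) \<le> ?X"
        using n by (intro mult_le_mono; simp add: CL_def)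
      ultimately have X: "pconst L \<le> ?X" "d \<le> ?X" "n \<le> ?X" "length T + 1 \<le> ?X" "(length T + 1) * (k + 2) \<le> ?X"
        using n by (auto simp: CL_def ac_simps)
      then show "pconst L \<le> ?X" "d \<le> ?X" by auto
      show "length (enc_training T) \<le> ?X" using X(5) L0_eq unfolding L0_def by (simp add: algebra_simps)
      show "x \<le> ?X" if "x \<in> set (enc_training T)" for x
      proof -
        have "x = length T \<or> x < n \<or> x \<le> 1"
          using that T uB unfolding enc_training_def is_training_def by fastforce
        then show ?thesis using X(3,4) by linarith
      qed
      show "x \<le> ?X" if "x \<in> set (N a)" for a x using Nu[OF that] X(3) by linarith
      show "length (N a) \<le> d" for a using admissible_N(2)[OF adm] .
    qed (use n in \<open>auto simp: CL_def e_def\<close>)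
    then obtain time where time: "runs R N L (enc_training T) time (enc_hyp v' ?\<phi>)"
      "real time \<le> (log 2 (real n) + real (length T) + 2) ^ e" by blast
    have eval: "\<exists>time'. runs R N E (u @ enc_hyp v' ?\<phi>) time' [of_bool (fo_hyp B ?\<phi> k l v' u)] \<and>
        real time' \<le> (log 2 (real n) + 2) ^ e" if u: "length u = k" "set u \<subseteq> univ B" for u
    proof -
      have as: "length (u @ v') = k + l" "set (u @ v') \<subseteq> univ B" using u v' by auto
      have g: "fo_hyp B ?\<phi> k l v' u \<longleftrightarrow> ?g (pattern \<sigma> d s R N (u @ v'))"
        using ev adm as unfolding evals_def fo_hyp_def by blast
      \<comment> \<open>Taking \<open>t = 0\<close> removes the training sequence from the time
        bound; this is allowed because the evaluator has no loops.\<close>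
      have "\<exists>time'. runs R N E ((u @ v') @ enc_fo ?\<phi>) time' [of_bool (?g (pattern \<sigma> d s R N (u @ v')))] \<and>
        real time' \<le> (log 2 (real n) + real 0 + 2) ^ e"
      proof (rule runs_of_wp[where t = 0 and n = n and C' = CE and D = d, OF _ _ _ order_refl refl])
        show "wp R N 0 E (\<lambda>(r, m). get_list 0 m = [of_bool (?g (pattern \<sigma> d s R N (u @ v')))])
          (\<lambda>_. 0, put_list 0 ((u @ v') @ enc_fo ?\<phi>) (\<lambda>_. 0))"
          unfolding E_def by (rule wp_evaluator[OF as(1) i\<Phi> fam(2)])
        let ?X = "n * (0 + 1) * CE"
        have "1 * CE \<le> ?X" "n * (0 + 1) * 1 \<le> ?X" using n by (intro mult_le_mono; simp add: CE_def)+
        then have X: "pconst E \<le> ?X" "d \<le> ?X" "k + l + e0 \<le> ?X" "n \<le> ?X" by (auto simp: CE_def)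
        then show "pconst E \<le> ?X" "d \<le> ?X" by auto
        show "length ((u @ v') @ enc_fo ?\<phi>) \<le> ?X" using as(1) e0(1)[OF i\<Phi>] X(3) by simp
        show "x \<le> ?X" if "x \<in> set ((u @ v') @ enc_fo ?\<phi>)" for x
        proof -
          have "x < n \<or> x \<le> e0" using that as(2) e0(2)[OF i\<Phi>] uB by auto
          then show ?thesis using X(3,4) by linarith
        qed
        show "x \<le> ?X" if "x \<in> set (N a)" for a x using Nu[OF that] X(4) by linarith
        show "length (N a) \<le> d" for a using admissible_N(2)[OF adm] .
      qed (use n in \<open>auto simp: CE_def e_def\<close>)
      then show ?thesis unfolding g enc_hyp_def by simp
    qed
    have "err T (fo_hyp B ?\<phi> k l v') \<le> \<epsilon>"
      if \<phi>: "fm_wf \<sigma> P \<phi>" "br \<phi> \<le> r" "bw \<phi> \<le> w" and xy: "length xs = k" "length ys = l"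
        "distinct (xs @ ys)" "fv \<phi> \<subseteq> set (xs @ ys)" and v: "length v = l" "set v \<subseteq> univ B"
        and err: "err T (focn_hyp P B \<phi> xs ys ks v \<mu>) \<le> \<epsilon>"
      for \<epsilon> :: real and \<phi> :: "'p fm" and xs ys ks v \<mu>
    proof -
      have "err T (fo_hyp B ?\<phi> k l v') \<le> err T (focn_hyp P B \<phi> xs ys ks v \<mu>)"
      proof (rule optimal[OF \<Phi>_eval \<Phi>_all D_def i v' opt v])
        fix u u' assume u: "u \<in> set (map fst T)" "u' \<in> set (map fst T)" "sim B s (u @ v) (u' @ v)"
        then have "length u = k" "length u' = k" "set u \<subseteq> univ B" using T_instance by blast+
        then show "focn_hyp P B \<phi> xs ys ks v \<mu> u = focn_hyp P B \<phi> xs ys ks v \<mu> u'"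
          using u(3) v xy unfolding s_def by (intro focn_hyp_local[OF B \<phi> xy(3,4)]) auto
      qed
      then show ?thesis using err by linarith
    qed
    then show "\<exists>\<phi>' v' time.
        runs R N L (enc_training T) time (enc_hyp v' \<phi>') \<and>
        (sphere_comb \<sigma> ?K {0..<k + l} \<phi>' \<and> length v' = l \<and> set v' \<subseteq> univ B) \<and>
        (\<forall>(\<epsilon> :: real) (\<phi> :: 'p fm) xs ys ks v \<mu>.
          fm_wf \<sigma> P \<phi> \<and> br \<phi> \<le> r \<and> bw \<phi> \<le> w \<and>
          length xs = k \<and> length ys = l \<and> distinct (xs @ ys) \<and> fv \<phi> \<subseteq> set (xs @ ys) \<and>
          distinct ks \<and> nfv \<phi> \<subseteq> set ks \<and>
          length v = l \<and> set v \<subseteq> univ B \<and> length \<mu> = length ks \<and> set \<mu> \<subseteq> {0..n} \<and>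
          err T (focn_hyp P B \<phi> xs ys ks v \<mu>) \<le> \<epsilon> \<longrightarrow>
          err T (fo_hyp B \<phi>' k l v') \<le> \<epsilon>) \<and>
        real time \<le> (log 2 (real n) + real (length T) + 2) ^ e \<and>
        (\<forall>u. length u = k \<and> set u \<subseteq> univ B \<longrightarrow>
          (\<exists>time'. runs R N E (u @ enc_hyp v' \<phi>') time' [of_bool (fo_hyp B \<phi>' k l v' u)] \<and>
             real time' \<le> (log 2 (real n) + 2) ^ e))"
      using time v' ev eval unfolding evals_def
      by (intro exI[of _ ?\<phi>] exI[of _ v'] exI[of _ time] conjI) blast+
  qed
qed

end
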